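(* Let $E$ be a real linear space and $d\in\mathbb{N}$ (so $d\ge1$). Suppose that: (a) $h\in C(E)$, $h(t)>0$ for all $t\in E$, and $h$ is not identically equal to $h(0)$ on $E$; (b) $\varphi$ is continuous on $[0,+\infty)$ and $\varphi(0)>0$; (c) $\rho:\mathbb{R}^d\to\mathbb{R}$ is continuous, $\rho(tx)=|t|\rho(x)$ for all $t\in\mathbb{R}$, $x\in\mathbb{R}^d$, and $\rho(x)>0$ for $x\neq 0$; (d) the function $K(x,t):=(h(t))^{-\frac d2}\varphi\left(\frac{\rho^2(x)}{h(t)}\right)$ belongs to $\Phi(\mathbb{R}^d\times E)$. Then: 1. $(h(t))^{-\frac d2}\in\Phi(E)$ and $\varphi(\rho^2(x))\in\Phi(\mathbb{R}^d)$. 2. If there exists an integer $n$ with $1\le n\le d$ such that $\int_0^{+\infty}|\varphi(u^2)|u^{n-1}\,du<+\infty$, then for every $m=1,\dots,n$ and every $v\in\mathbb{R}^m$ the function $s\mapsto f_{m,v}(s):=s^{m-d}G_m(sv)$ is decreasing (not necessarily strictly) on $(0,+\infty)$. Furthermore, $\lim_{s\to+\infty}f_{m,v}(s)=0$ for $v\neq 0$. 3. If $\int_0^{+\infty}|\varphi(u^2)|u^{d-1}\,du<+\infty$, then $G_d(0)>0$. If, in addition, $G_d$ is real-analytic, then for every $v\in\mathbb{R}^d$, $v\ne 0$, the function $s\mapsto G_d(sv)$ is strictly decreasing on $[0,+\infty)$, and $G_d(v)>0$ for all $v\in\mathbb{R}^d$. 4. If $\int_0^{+\infty}|\varphi(u^2)|u^{d+1}\,du<+\infty$,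 then $\alpha_1(v):=\int_{\mathbb{R}^d}\varphi(\rho^2(y))(y,v)^2\,dy\ge 0$ for all $v\in\mathbb{S}^{d-1}$ and $\beta_1:=\int_{\mathbb{R}^d}\varphi(\rho^2(y))\|y\|_2^2\,dy\ge 0$. Furthermore, $\alpha_1(v)=0$ for all $v\in\mathbb{S}^{d-1}$ if and only if $\beta_1=0$. If, in addition, $\beta_1>0$, then $e^{-\lambda h(t)}\in\Phi(E)$ for all $\lambda>0$. 5. If $\int_0^{+\infty}|\varphi(u^2)|e^{\varepsilon u}\,du<+\infty$ for some $\varepsilon>0$ (for example, when $\varphi$ has compact support), then there exists $p\in\mathbb{N}$ such that $e^{-\lambda h^p(t)}\in\Phi(E)$ for all $\lambda>0$. Moreover, for $p$ one may take any of the following (well-defined) numbers: $$p(v):=\min\left\{k\in\mathbb{N}:\ \alpha_k(v):=\int_{\mathbb{R}^d}\varphi(\rho^2(y))(y,v)^{2k}\,dy\neq 0\right\},\quad v\in\mathbb{S}^{d-1},$$ $$q:=\min\left\{k\in\mathbb{N}:\ \beta_k:=\int_{\mathbb{R}^d}\varphi(\rho^2(y))\|y\|_2^{2k}\,dy\neq 0\right\}.$$ The function $p(\cdot)$ is bounded on $\mathbb{S}^{d-1}$ and $q=\min_{v\in\mathbb{S}^{d-1}}p(v)$.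
   Context: For a real linear space $E$, $\Phi(E)$ denotes the set of positive definite functions on $E$: functions $f:E\to\mathbb{C}$ such that for every finite collection $\xi_1,\dots,\xi_n\in E$ and all $a_1,\dots,a_n\in\mathbb{C}$, $\sum_{i,j=1}^n a_i f(\xi_i-\xi_j)\overline{a_j}\ge 0$ (real and nonnegative). No continuity is part of this definition. $C(E)$: if $\dim E=n<\infty$ with basis $e_1,\dots,e_n$, then $f\in C(E)$ means that $(x_1,\dots,x_n)\mapsto f(x_1e_1+\dots+x_ne_n)$ is continuous on $\mathbb{R}^n$; if $\dim E=\infty$, then $f\in C(E)$ means that the restriction of $f$ to every finite-dimensional linear subspace $E_0$ of $E$ belongs to $C(E_0)$. $(\cdot,\cdot)$ is the usual dot product, $\|\cdot\|_2$ the Euclidean norm, $\mathbb{S}^{d-1}=\{x\in\mathbb{R}^d:\|x\|_2=1\}$, and $\mathbb{N}=\{1,2,\dots\}$. For $1\le m\le d$ with $\int_0^{+\infty}|\varphi(u^2)|u^{m-1}\,du<+\infty$, define $$G_m(v):=\int_{\mathbb{R}^m}\varphi(\rho^2(y))e^{i(y,v)}\,dy,\qquad v\in\mathbb{R}^m,$$ where for $m<d$ the space $\mathbb{R}^m$ is identified with the coordinate subspace $\mathbb{R}^m\times\{0\}\subset\mathbb{R}^d$, so that $\rho(y)$ means $\rho(y,0)$. *)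

theory Defs
  imports "HOL-Analysis.Analysis" "HOL-Library.Complex_Order"
begin

text \<open>
  Complex numbers carry the order of \<^theory>\<open>HOL-Library.Complex_Order\<close>:
  \<open>0 \<le> z\<close> says that \<open>z\<close> is real and nonnegative, and a complex function that is monotone
  in this order has constant imaginary part.
\<close>

definition Phi :: "('a::real_vector \<Rightarrow> complex) set" where
  "Phi = {f. \<forall>(n::nat) (\<xi> :: nat \<Rightarrow> 'a) (a :: nat \<Rightarrow> complex).
              0 \<le> (\<Sum>i<n. \<Sum>j<n. a i * f (\<xi> i - \<xi> j) * cnj (a j))}"

text \<open>
  \<open>C_findim S\<close> is \<open>C(S)\<close> for a finite-dimensional subspace \<open>S\<close>. The coordinate space
  \<open>\<real>\<^sup>n\<close> attached to a basis \<open>B\<close> is the product space \<open>\<real>\<^sup>B\<close>; quantifying over all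
  bases is harmless, since a linear change of coordinates is a homeomorphism.
\<close>

definition C_findim :: "'a::real_vector set \<Rightarrow> ('a \<Rightarrow> 'b::topological_space) set" where
  "C_findim S = {f. \<forall>B. finite B \<and> independent B \<and> span B = S \<longrightarrow>
     continuous_map (powertop_real B) euclidean (\<lambda>x. f (\<Sum>b\<in>B. x b *\<^sub>R b))}"

definition C_space :: "('a::real_vector \<Rightarrow> 'b::topological_space) set" where
  "C_space =
     (if \<exists>B::'a set. finite B \<and> span B = UNIV then C_findim UNIV
      else {f. \<forall>S. (\<exists>B. finite B \<and> span B = S) \<longrightarrow> f \<in> C_findim S})"

text \<open>
  \<open>\<real>\<^sup>m\<close> is identified with the subspace \<open>\<real>\<^sup>m \<times> {0}\<close> of \<open>\<real>\<^sup>d\<close> spanned by the first \<open>m\<close>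
  coordinates; the order on the index type only serves to say which coordinates come first.
  The measure \<open>coord_lborel m\<close> is \<open>m\<close>-dimensional Lebesgue measure carried by that subspace.
\<close>

definition first_coords :: "nat \<Rightarrow> 'd::{finite,linorder} set" where
  "first_coords m = {i. card {j. j < i} < m}"

definition coord_subspace :: "nat \<Rightarrow> (real ^ 'd::{finite,linorder}) set" where
  "coord_subspace m = {v. \<forall>i. i \<notin> first_coords m \<longrightarrow> v $ i = 0}"

definition coord_lborel :: "nat \<Rightarrow> (real ^ 'd::{finite,linorder}) measure" where
  "coord_lborel m =
     distr (\<Pi>\<^sub>M i\<in>first_coords m. lborel) borel (\<lambda>y. \<Sum>i\<in>first_coords m. y i *\<^sub>R axis i 1)"

definition G ::
  "(real \<Rightarrow> complex) \<Rightarrow> (real ^ 'd::{finite,linorder} \<Rightarrow> real) \<Rightarrow> nat \<Rightarrow>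
     real ^ 'd::{finite,linorder} \<Rightarrow> complex" where
  "G \<phi> \<rho> m v = (\<integral>y. \<phi> ((\<rho> y)\<^sup>2) * exp (\<i> * complex_of_real (y \<bullet> v)) \<partial>coord_lborel m)"

definition \<alpha> :: "(real \<Rightarrow> complex) \<Rightarrow> (real ^ 'd \<Rightarrow> real) \<Rightarrow> nat \<Rightarrow> real ^ 'd \<Rightarrow> complex" where
  "\<alpha> \<phi> \<rho> k v = (\<integral>y. \<phi> ((\<rho> y)\<^sup>2) * complex_of_real ((y \<bullet> v) ^ (2 * k)) \<partial>lborel)"

definition \<beta> :: "(real \<Rightarrow> complex) \<Rightarrow> (real ^ 'd \<Rightarrow> real) \<Rightarrow> nat \<Rightarrow> complex" where
  "\<beta> \<phi> \<rho> k = (\<integral>y. \<phi> ((\<rho> y)\<^sup>2) * complex_of_real (norm y ^ (2 * k)) \<partial>lborel)"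

definition p_min :: "(real \<Rightarrow> complex) \<Rightarrow> (real ^ 'd \<Rightarrow> real) \<Rightarrow> real ^ 'd \<Rightarrow> nat" where
  "p_min \<phi> \<rho> v = (LEAST k. 1 \<le> k \<and> \<alpha> \<phi> \<rho> k v \<noteq> 0)"

definition q_min :: "(real \<Rightarrow> complex) \<Rightarrow> (real ^ 'd \<Rightarrow> real) \<Rightarrow> nat" where
  "q_min \<phi> \<rho> = (LEAST k. 1 \<le> k \<and> \<beta> \<phi> \<rho> k \<noteq> 0)"

text \<open>
  Around every point the function is the sum of an (unconditionally convergent) power series;
  the series is indexed by multi-indices \<open>k\<close>.
\<close>

definition real_analytic :: "(real ^ 'd \<Rightarrow> complex) \<Rightarrow> bool" where
  "real_analytic f \<longleftrightarrow>
     (\<forall>x0. \<exists>r>0. \<exists>c :: ('d \<Rightarrow> nat) \<Rightarrow> complex. \<forall>x\<in>ball x0 r.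
        ((\<lambda>k. c k * complex_of_real (\<Prod>i\<in>UNIV. (x $ i - x0 $ i) ^ k i)) has_sum f x) UNIV)"

lemma card_first_coords:
  assumes "m \<le> CARD('d)"
  shows "card (first_coords m :: 'd::{finite,linorder} set) = m"
proof -
  let ?r = "\<lambda>i::'d. card {j. j < i}"
  have mono: "?r i < ?r j" if "i < j" for i j :: 'd
  proof (rule psubset_card_mono)
    show "{k. k < i} \<subset> {k. k < j}"
      using that by (auto dest: less_trans)
  qed simp
  have inj: "inj ?r"
    by (rule injI) (metis mono less_irrefl linorder_cases)
  have sub: "?r ` UNIV \<subseteq> {..<CARD('d)}"
  proof clarsimp
    fix i :: 'd
    have "{j. j < i} \<subset> UNIV" by auto
    then show "?r i < CARD('d)" by (intro psubset_card_mono) auto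
  qed
  have surj: "?r ` UNIV = {..<CARD('d)}"
    by (rule card_subset_eq) (use sub inj in \<open>auto simp: card_image\<close>)
  have "?r ` (first_coords m) = {..<m}"
  proof
    show "?r ` (first_coords m) \<subseteq> {..<m}" by (auto simp: first_coords_def)
    show "{..<m} \<subseteq> ?r ` (first_coords m)"
    proof
      fix k assume k: "k \<in> {..<m}"
      then have "k \<in> ?r ` UNIV" using surj assms by auto
      then obtain i where "k = ?r i" by auto
      then show "k \<in> ?r ` (first_coords m)" using k by (auto simp: first_coords_def)
    qed
  qed
  then have "card (?r ` (first_coords m)) = m" by simp
  then show ?thesis
    using card_image[OF inj_on_subset[OF inj subset_UNIV], of "first_coords m"] by simp
qed

lemma first_coords_UNIV: "first_coords CARD('d) = (UNIV :: 'd::{finite,linorder} set)"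
  by (rule card_subset_eq) (simp_all add: card_first_coords)

lemma coord_subspace_UNIV:
  "coord_subspace CARD('d) = (UNIV :: (real ^ 'd::{finite,linorder}) set)"
  by (simp add: coord_subspace_def first_coords_UNIV)

lemma coord_lborel_UNIV:
  "coord_lborel CARD('d) = (lborel :: (real ^ 'd::{finite,linorder}) measure)"
proof (rule sym, rule lborel_eqI)
  let ?I = "UNIV :: 'd set"
  let ?P = "\<Pi>\<^sub>M i\<in>?I. (lborel :: real measure)"
  let ?T = "\<lambda>y. \<Sum>i\<in>?I. y i *\<^sub>R axis i (1::real)"
  interpret product_sigma_finite "\<lambda>_::'d. lborel :: real measure" ..
  have T: "?T y $ i = y i" for y i
    by (simp add: axis_def if_distrib cong: if_cong)
  have meas: "?T \<in> ?P \<rightarrow>\<^sub>M borel" by measurable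
  fix l u :: "(real, 'd) vec"
  assume "\<And>b. b \<in> Basis \<Longrightarrow> l \<bullet> b \<le> u \<bullet> b"
  then have le: "l $ i \<le> u $ i" for i
    by (metis axis_in_Basis_iff Basis_real_def cart_eq_inner_axis insertI1)
  have "?T -` box l u \<inter> space ?P = (\<Pi>\<^sub>E i\<in>?I. {l $ i <..< u $ i})"
    unfolding vimage_def mem_box_cart T by (auto simp: space_PiM PiE_iff)
  then have "emeasure (coord_lborel CARD('d)) (box l u) = (\<Prod>i\<in>?I. emeasure lborel {l $ i <..< u $ i})"
    using meas by (simp add: coord_lborel_def first_coords_UNIV emeasure_distr emeasure_PiM)
  also have "\<dots> = ennreal (\<Prod>i\<in>?I. u $ i - l $ i)"
    using le by (simp add: prod_ennreal)
  also have "(\<Prod>i\<in>?I. u $ i - l $ i) = (\<Prod>b\<in>Basis. (u - l) \<bullet> b)"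
  proof -
    have B: "(Basis :: (real, 'd) vec set) = (\<lambda>i. axis i 1) ` ?I"
      by (auto simp: Basis_vec_def)
    show ?thesis
      unfolding B by (subst prod.reindex) (auto simp: inj_on_def axis_eq_axis inner_axis)
  qed
  finally show "emeasure (coord_lborel CARD('d)) (box l u) = ennreal (\<Prod>b\<in>Basis. (u - l) \<bullet> b)" .
qed (simp add: coord_lborel_def)

end

theory Submission
  imports Defs "HOL-Probability.Probability" "HOL-Complex_Analysis.Cauchy_Integral_Formula"
begin

text \<open>
  Integrating the kernel against \<open>exp (\<i> * (x \<bullet> v))\<close> in the variable \<open>x\<close> alone leaves a positive
  definite function of \<open>t\<close>, namely \<open>t \<mapsto> r ^ (m - d) * G\<^sub>m (r * v)\<close> with \<open>r = sqrt (h t)\<close>. It is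
  therefore largest at \<open>t = 0\<close>. As \<open>h\<close> is nonconstant, at least \<open>h 0\<close>, and continuous on lines, this
  means that \<open>f\<^bsub>m,v\<^esub> (c * s) \<le> f\<^bsub>m,v\<^esub> s\<close> for all \<open>s > 0\<close> and all \<open>c\<close> in some interval \<open>[1, C]\<close> with \<open>C > 1\<close>,
  and iteration gives monotonicity. For \<open>m = d\<close> the monotone function \<open>s \<mapsto> G\<^sub>d (s * v)\<close> starts at the positive value
  \<open>G\<^sub>d 0\<close> and tends to \<open>0\<close>, so it cannot be constant on an interval when it is analytic. The same
  argument excludes that all moments \<open>\<alpha>\<^sub>k v\<close> vanish, and the first nonvanishing one, of order \<open>p\<close>, yields
  \<open>(G\<^sub>d (sqrt (h t) * s * v) / G\<^sub>d 0) ^ n \<longlongrightarrow> exp (- l * h t ^ p)\<close> for a suitable \<open>s\<close> of order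
  \<open>n ^ (- 1 / (2 * p))\<close>. The moments \<open>\<beta>\<^sub>k\<close> are, up to positive factors, Gaussian averages of \<open>\<alpha>\<^sub>k\<close>.
\<close>

subsection \<open>Positive definite functions\<close>

text \<open>Membership in \<open>Phi\<close> involves no topology on E, so nothing like Bochner's
  theorem is at hand in \<open>t\<close>; the points of E stay fixed while \<open>x\<close> is
  integrated, which keeps the quadratic form in \<open>t\<close> intact. In \<open>x\<close> only
  the nonnegativity of a Fourier integral is wanted, and averaging gives it: the difference of two
  independent Gaussian points is again Gaussian, so the double integral of \<open>H (x - y)\<close>
  collapses to an integral of \<open>H\<close> against one Gaussian, whose width is then sent to
  infinity. \<open>h 0\<close> is the minimum of \<open>h\<close> because at \<open>x = 0\<close>
  the kernel is a multiple of h^(-d/2), and a positive definite function has its largest modulus at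
  0. The value G_d(0) is positive because otherwise 0 \<le> G_d \<le> G_d(0) would make the whole
  transform vanish, and testing it against Gaussians would give \<open>\<phi> 0 = 0\<close>. Only
  even orders occur among the moments since \<phi>(\<rho>^2) is even. The exponential limit has the
  right sign because G_d decreases along rays, which makes its first nonvanishing Taylor coefficient
  at 0 negative.\<close>

lemma complex_nonneg_closed: "closed {z::complex. 0 \<le> z}"
proof -
  have "{z::complex. 0 \<le> z} = {z. 0 \<le> Re z} \<inter> {z. Im z = 0}"
    by (auto simp: less_eq_complex_def)
  moreover have "closed ({z. 0 \<le> Re z} \<inter> {z. Im z = 0})"
    by (intro closed_Int closed_Collect_le closed_Collect_eq continuous_intros)
  ultimately show ?thesis by simp
qed

lemma complex_nonneg_LIMSEQ:
  fixes f :: "nat \<Rightarrow> complex"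
  assumes "f \<longlonglongrightarrow> l" "\<And>n. 0 \<le> f n"
  shows "0 \<le> l"
  using closed_sequentially[OF complex_nonneg_closed, of f l] assms by auto

lemma complex_nonneg_mult:
  fixes z w :: complex
  assumes "0 \<le> z" "0 \<le> w"
  shows "0 \<le> z * w"
  using assms by (auto simp: less_eq_complex_def)

lemma of_real_nonneg_iff: "0 \<le> complex_of_real x \<longleftrightarrow> 0 \<le> x"
  by (simp add: less_eq_complex_def)

lemma mult_cnj_nonneg: "0 \<le> z * cnj z" for z :: complex
  by (simp add: less_eq_complex_def)

text \<open>Frees the definition from initial segments of the naturals; \<open>scaled_G_Phi\<close>
  needs a set of pairs as index set.\<close>

lemma Phi_finite:
  assumes "f \<in> Phi" "finite A"
  shows "0 \<le> (\<Sum>i\<in>A. \<Sum>j\<in>A. a i * f (\<xi> i - \<xi> j) * cnj (a j))"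
proof -
  obtain g where g: "bij_betw g {..<card A} A"
    using ex_bij_betw_nat_finite[OF assms(2)] by (auto simp: atLeast0LessThan)
  have "0 \<le> (\<Sum>i<card A. \<Sum>j<card A. a (g i) * f (\<xi> (g i) - \<xi> (g j)) * cnj (a (g j)))"
    using assms(1) unfolding Phi_def by (auto dest!: spec[of _ "card A"] spec[of _ "\<lambda>i. \<xi> (g i)"])
  also have "\<dots> = (\<Sum>i\<in>A. \<Sum>j<card A. a i * f (\<xi> i - \<xi> (g j)) * cnj (a (g j)))"
    by (rule sum.reindex_bij_betw[OF g])
  also have "\<dots> = (\<Sum>i\<in>A. \<Sum>j\<in>A. a i * f (\<xi> i - \<xi> j) * cnj (a j))"
    by (intro sum.cong refl sum.reindex_bij_betw[OF g])
  finally show ?thesis .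
qed

lemma PhiI:
  assumes "\<And>n \<xi> a. 0 \<le> (\<Sum>i<(n::nat). \<Sum>j<n. a i * f (\<xi> i - \<xi> j) * cnj (a j))"
  shows "f \<in> Phi"
  using assms unfolding Phi_def by blast

lemma PhiD:
  assumes "f \<in> Phi"
  shows "0 \<le> (\<Sum>i<(n::nat). \<Sum>j<n. a i * f (\<xi> i - \<xi> j) * cnj (a j))"
  using assms unfolding Phi_def by blast

lemma Phi_comp_linear:
  assumes "f \<in> Phi" "\<And>x y. L (x - y) = L x - L y"
  shows "(\<lambda>x. f (L x)) \<in> Phi"
  using PhiD[OF assms(1)] by (intro PhiI) (simp add: assms(2))

lemma Phi_scale:
  assumes "f \<in> Phi" "0 \<le> c"
  shows "(\<lambda>x. c * f x) \<in> Phi"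
proof (rule PhiI)
  fix n :: nat and \<xi> :: "nat \<Rightarrow> 'a" and a :: "nat \<Rightarrow> complex"
  have "(\<Sum>i<n. \<Sum>j<n. a i * (c * f (\<xi> i - \<xi> j)) * cnj (a j))
      = c * (\<Sum>i<n. \<Sum>j<n. a i * f (\<xi> i - \<xi> j) * cnj (a j))"
    by (simp add: sum_distrib_left mult_ac)
  then show "0 \<le> (\<Sum>i<n. \<Sum>j<n. a i * (c * f (\<xi> i - \<xi> j)) * cnj (a j))"
    using PhiD[OF assms(1)] complex_nonneg_mult[OF assms(2)] by simp
qed

lemma Phi_limit:
  assumes "\<And>k::nat. f k \<in> Phi" "\<And>x. (\<lambda>k. f k x) \<longlonglongrightarrow> g x"
  shows "g \<in> Phi"
proof (rule PhiI)
  fix n :: nat and \<xi> :: "nat \<Rightarrow> 'a" and a :: "nat \<Rightarrow> complex"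
  have "(\<lambda>k. \<Sum>i<n. \<Sum>j<n. a i * f k (\<xi> i - \<xi> j) * cnj (a j))
      \<longlonglongrightarrow> (\<Sum>i<n. \<Sum>j<n. a i * g (\<xi> i - \<xi> j) * cnj (a j))"
    by (intro tendsto_intros assms)
  then show "0 \<le> (\<Sum>i<n. \<Sum>j<n. a i * g (\<xi> i - \<xi> j) * cnj (a j))"
    using PhiD[OF assms(1)] by (rule complex_nonneg_LIMSEQ)
qed

lemma Phi_zero:
  assumes "f \<in> Phi"
  shows "0 \<le> f 0"
  using PhiD[OF assms, of "\<lambda>_. 1" "\<lambda>_. 0" 1] by simp

text \<open>Reality of the form at the vectors (1, 1) and (1, i) gives Hermitian symmetry; the
  determinant bound is the discriminant condition for a real quadratic polynomial that stays
  nonnegative.\<close>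

lemma psd2:
  fixes A :: "nat \<Rightarrow> nat \<Rightarrow> complex"
  assumes psd: "\<And>a b. 0 \<le> a * p * cnj a + a * q * cnj b + b * r * cnj a + b * s * cnj b"
  shows psd2_hermitian: "r = cnj q" and psd2_det: "(cmod q)\<^sup>2 \<le> Re p * Re s"
proof -
  have p: "0 \<le> p" using psd[of 1 0] by simp
  have s: "0 \<le> s" using psd[of 0 1] by simp
  from p s have I: "Im p = 0" "Im s = 0" "Re p \<ge> 0" "Re s \<ge> 0" by (auto simp: less_eq_complex_def)
  have 1: "Im q + Im r = 0" using psd[of 1 1] I by (simp add: less_eq_complex_def)
  have 2: "Re q = Re r" using psd[of 1 \<i>] I by (simp add: less_eq_complex_def)
  show r: "r = cnj q" using 1 2 by (simp add: complex_eq_iff)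
  \<comment> \<open>The vector (x * cnj q, 1) cancels the phase of q, so that the form becomes a
    real quadratic polynomial in x.\<close>
  have le: "0 \<le> Re p * x\<^sup>2 * (cmod q)\<^sup>2 + 2 * x * (cmod q)\<^sup>2 + Re s" for x :: real
  proof -
    have "Re p * x\<^sup>2 * (cmod q)\<^sup>2 + 2 * x * (cmod q)\<^sup>2 + Re s
        = Re ((x * cnj q) * p * cnj (x * cnj q) + (x * cnj q) * q * cnj 1 + 1 * r * cnj (x * cnj q) + 1 * s * cnj 1)"
      unfolding r cmod_power2 by (simp add: algebra_simps power2_eq_square)
    also have "\<dots> \<ge> 0" using psd[of "x * cnj q" 1] by (simp only: less_eq_complex_def zero_complex.simps)
    finally show ?thesis .
  qed
  show "(cmod q)\<^sup>2 \<le> Re p * Re s"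
  proof (cases "Re p = 0")
    case True
    have "(cmod q)\<^sup>2 = 0"
    proof (rule ccontr)
      assume "(cmod q)\<^sup>2 \<noteq> 0"
      \<comment> \<open>Without a quadratic term the polynomial is affine with slope 2 |q|^2; at
        this x it equals -1.\<close>
      with le[of "- (Re s + 1) / (2 * (cmod q)\<^sup>2)"] True show False by (simp add: field_simps)
    qed
    with True show ?thesis by simp
  next
    case False
    then have pos: "Re p > 0" using I by simp
    \<comment> \<open>The value of the polynomial at its minimizer x = -1 / Re p.\<close>
    have "0 \<le> Re s - (cmod q)\<^sup>2 / Re p"
      using le[of "- 1 / Re p"] pos by (simp add: field_simps power2_eq_square)
    then show ?thesis using pos by (simp add: field_simps)
  qed
qed

lemma Phi_two_points:
  assumes "f \<in> Phi"
  shows "0 \<le> a * f 0 * cnj a + a * f x * cnj b + b * f (- x) * cnj a + b * f 0 * cnj b"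
proof -
  have "{..<2::nat} = {0, 1}" by auto
  then show ?thesis
    using PhiD[OF assms, of "\<lambda>i. if i = 0 then a else b" "\<lambda>i. if i = 0 then x else 0" 2]
    by (simp add: add.assoc)
qed

text \<open>The determinant bound for the points x and 0. Every comparison with the value at the
  origin in the sequel comes from here.\<close>

lemma Phi_norm_le:
  assumes "f \<in> Phi"
  shows "cmod (f x) \<le> Re (f 0)"
proof (rule power2_le_imp_le)
  show "(cmod (f x))\<^sup>2 \<le> (Re (f 0))\<^sup>2"
    unfolding power2_eq_square[of "Re _"] by (rule psd2_det[OF Phi_two_points[OF assms]])
  show "0 \<le> Re (f 0)"
    using Phi_zero[OF assms] by (simp add: less_eq_complex_def)
qed

section \<open>Positive semidefinite matrices and Schur's product theorem\<close>

definition psd :: "nat \<Rightarrow> (nat \<Rightarrow> nat \<Rightarrow> complex) \<Rightarrow> bool" where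
  "psd n A \<longleftrightarrow> (\<forall>a. 0 \<le> (\<Sum>i<n. \<Sum>j<n. a i * A i j * cnj (a j)))"

text \<open>Vectors supported on one or two indices reduce everything to \<open>psd2\<close>; in
  particular Hermitian symmetry is derived rather than built into \<open>psd\<close>.\<close>

lemma psd_minor:
  assumes "psd n A" "i < n" "j < n"
  shows "A j i = cnj (A i j)" "(cmod (A i j))\<^sup>2 \<le> Re (A i i) * Re (A j j)" "0 \<le> A i i"
proof -
  have diag: "0 \<le> A i i" if "i < n" for i
  proof -
    have "0 \<le> (\<Sum>k<n. \<Sum>l<n. (if k = i then 1 else 0) * A k l * cnj (if l = i then 1 else 0))"
      using assms(1) unfolding psd_def by (rule spec)
    also have "\<dots> = (\<Sum>k\<in>{i}. \<Sum>l<n. (if k = i then 1 else 0) * A k l * cnj (if l = i then 1 else 0))"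
      using that by (intro sum.mono_neutral_right) auto
    also have "\<dots> = (\<Sum>k\<in>{i}. \<Sum>l\<in>{i}. (if k = i then 1 else 0) * A k l * cnj (if l = i then 1 else 0))"
      using that by (intro sum.cong refl sum.mono_neutral_right) auto
    also have "\<dots> = A i i" by simp
    finally show ?thesis .
  qed
  then show "0 \<le> A i i" using assms by blast
  show "A j i = cnj (A i j)" "(cmod (A i j))\<^sup>2 \<le> Re (A i i) * Re (A j j)"
  proof (atomize (full), cases "i = j")
    case True
    then show "A j i = cnj (A i j) \<and> (cmod (A i j))\<^sup>2 \<le> Re (A i i) * Re (A j j)"
      using diag[OF assms(2)] cmod_power2[of "A i i"]
      by (auto simp: less_eq_complex_def complex_eq_iff power2_eq_square)
  next
    case False
    have "0 \<le> a * A i i * cnj a + a * A i j * cnj b + b * A j i * cnj a + b * A j j * cnj b" for a b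
    proof -
      let ?c = "\<lambda>k. if k = i then a else if k = j then b else 0"
      have "0 \<le> (\<Sum>k<n. \<Sum>l<n. ?c k * A k l * cnj (?c l))"
        using assms(1) unfolding psd_def by (rule spec)
      also have "\<dots> = (\<Sum>k\<in>{i,j}. \<Sum>l<n. ?c k * A k l * cnj (?c l))"
        using assms by (intro sum.mono_neutral_right) auto
      also have "\<dots> = (\<Sum>k\<in>{i,j}. \<Sum>l\<in>{i,j}. ?c k * A k l * cnj (?c l))"
        using assms by (intro sum.cong refl sum.mono_neutral_right) auto
      also have "\<dots> = a * A i i * cnj a + a * A i j * cnj b + b * A j i * cnj a + b * A j j * cnj b"
        using False by (simp add: add.assoc)
      finally show ?thesis .
    qed
    from psd2_hermitian[OF this] psd2_det[OF this]
    show "A j i = cnj (A i j) \<and> (cmod (A i j))\<^sup>2 \<le> Re (A i i) * Re (A j j)" by simp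
  qed
qed

lemma psd_mult_rank1:
  assumes "psd n B"
  shows "psd n (\<lambda>i j. u i * cnj (u j) * B i j)"
  unfolding psd_def
proof
  fix a :: "nat \<Rightarrow> complex"
  have "0 \<le> (\<Sum>i<n. \<Sum>j<n. (a i * u i) * B i j * cnj (a j * u j))"
    using assms unfolding psd_def by (rule spec)
  then show "0 \<le> (\<Sum>i<n. \<Sum>j<n. a i * (u i * cnj (u j) * B i j) * cnj (a j))"
    by (simp add: mult_ac)
qed

lemma psd_add: "psd n A \<Longrightarrow> psd n B \<Longrightarrow> psd n (\<lambda>i j. A i j + B i j)"
  unfolding psd_def by (simp add: distrib_left distrib_right sum.distrib)

text \<open>Schur's product theorem, by splitting off the rank-one matrix that clears the last row and
  column of \<open>A\<close>.\<close>

lemma psd_mult: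
  assumes "psd n A" "psd n B"
  shows "psd n (\<lambda>i j. A i j * B i j)"
  using assms
proof (induction n arbitrary: A B)
  case 0
  then show ?case by (simp add: psd_def)
next
  case (Suc n)
  note A = psd_minor[OF Suc.prems(1)]
  define D where "D = A n n"
  have D0: "Re D \<ge> 0" "Im D = 0" using A(3)[of n n] by (auto simp: D_def less_eq_complex_def)
  \<comment> \<open>A vanishing pivot forces its whole row and column to vanish, by the 2x2 minors.
    Division by \<open>D = 0\<close> yields 0, so the formulas below remain correct in that
    case.\<close>
  have row0: "A i n = 0" "A n i = 0" if "D = 0" "i \<le> n" for i
    using A(2)[of i n] A(1)[of i n] that by (auto simp: D_def)
  \<comment> \<open>The Schur complement of the last pivot, kept at full size with a zero last row
    and column.\<close>
  define A' where "A' i j = A i j - A i n * cnj (A j n) / D" for i j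
  have A'n: "A' i n = 0" "A' n i = 0" if "i \<le> n" for i
  proof -
    have D: "cnj D = D" using D0 by (simp add: complex_eq_iff)
    have 1: "A n i = cnj (A i n)" using A(1)[of i n] that by simp
    show "A' i n = 0"
      using row0(1)[OF _ that] by (cases "D = 0") (simp_all add: A'_def D D_def[symmetric])
    show "A' n i = 0"
      using row0(2)[OF _ that] 1 by (cases "D = 0") (simp_all add: A'_def D_def[symmetric])
  qed
  have psdA': "psd n A'"
    unfolding psd_def
  proof
    fix a :: "nat \<Rightarrow> complex"
    define w where "w = (\<Sum>i<n. a i * A i n)"
    \<comment> \<open>The last coordinate that minimizes the form of \<open>A\<close> when the
      others are given by \<open>a\<close>; the minimum is the form of \<open>A'\<close>. For
      \<open>D = 0\<close> it is 0, and \<open>w\<close> vanishes as well.\<close>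
    define c where "c = - w / D"
    define b where "b i = (if i = n then c else a i)" for i
    have S: "(\<Sum>j<n. A n j * cnj (a j)) = cnj w"
    proof -
      have "A n j = cnj (A j n)" if "j < n" for j using A(1)[of j n] that by simp
      then show ?thesis unfolding w_def cnj_sum by (intro sum.cong refl) simp
    qed
    have w0: "w = 0" if "D = 0" using row0[OF that] by (simp add: w_def)
    have cD: "cnj D = D" using D0 by (simp add: complex_eq_iff)
    have "0 \<le> (\<Sum>i<Suc n. \<Sum>j<Suc n. b i * A i j * cnj (b j))"
      using Suc.prems(1) unfolding psd_def by (rule spec)
    also have "\<dots> = (\<Sum>i<n. \<Sum>j<n. a i * A i j * cnj (a j)) + (\<Sum>i<n. a i * A i n) * cnj c
       + c * (\<Sum>j<n. A n j * cnj (a j)) + c * A n n * cnj c"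
      by (simp add: b_def sum.distrib sum_distrib_right sum_distrib_left mult.assoc)
    also have "\<dots> = (\<Sum>i<n. \<Sum>j<n. a i * A i j * cnj (a j)) + w * cnj c + c * cnj w + c * D * cnj c"
      by (simp only: S w_def[symmetric] D_def[symmetric])
    also have "\<dots> = (\<Sum>i<n. \<Sum>j<n. a i * A i j * cnj (a j)) - w * cnj w / D"
      using w0 by (cases "D = 0") (auto simp: c_def cD field_simps)
    also have "w * cnj w / D = (\<Sum>i<n. \<Sum>j<n. a i * (A i n * cnj (A j n) / D) * cnj (a j))"
      by (simp add: w_def sum_product sum_divide_distrib mult_ac)
    also have "(\<Sum>i<n. \<Sum>j<n. a i * A i j * cnj (a j)) - \<dots> = (\<Sum>i<n. \<Sum>j<n. a i * A' i j * cnj (a j))"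
      by (simp add: A'_def sum_subtractf algebra_simps)
    finally show "0 \<le> (\<Sum>i<n. \<Sum>j<n. a i * A' i j * cnj (a j))" .
  qed
  have psdB: "psd n B"
    unfolding psd_def
  proof
    fix a :: "nat \<Rightarrow> complex"
    have "0 \<le> (\<Sum>i<Suc n. \<Sum>j<Suc n. (if i < n then a i else 0) * B i j * cnj (if j < n then a j else 0))"
      using Suc.prems(2) unfolding psd_def by (rule spec)
    then show "0 \<le> (\<Sum>i<n. \<Sum>j<n. a i * B i j * cnj (a j))" by simp
  qed
  \<comment> \<open>The last row and column of \<open>A'\<close> are zero, so the induction
    hypothesis in size n already covers size \<open>Suc n\<close>.\<close>
  have 1: "psd (Suc n) (\<lambda>i j. A' i j * B i j)"
    using Suc.IH[OF psdA' psdB] by (simp add: psd_def A'n)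
  \<comment> \<open>The part split off from \<open>A\<close> is u u* with u the last column divided
    by the square root of the pivot, and multiplying by such a matrix only rescales the test
    vector.\<close>
  have "psd (Suc n) (\<lambda>i j. (A i n / csqrt D) * cnj (A j n / csqrt D) * B i j)"
    by (rule psd_mult_rank1[OF Suc.prems(2)])
  moreover have "csqrt D * cnj (csqrt D) = D"
    using D0 by (simp add: complex_eq_iff csqrt_of_real_nonneg[of D] complex_is_Real_iff)
  then have "(A i n / csqrt D) * cnj (A j n / csqrt D) = A i n * cnj (A j n) / D" for i j
    by (simp only: complex_cnj_divide times_divide_times_eq)
  ultimately have 2: "psd (Suc n) (\<lambda>i j. A i n * cnj (A j n) / D * B i j)"
    by (simp only:)
  show ?case
    using psd_add[OF 1 2] by (simp add: A'_def algebra_simps)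
qed

lemma Phi_mult:
  assumes "f \<in> Phi" "g \<in> Phi"
  shows "(\<lambda>x. f x * g x) \<in> Phi"
proof (rule PhiI)
  fix n :: nat and \<xi> :: "nat \<Rightarrow> 'a" and a :: "nat \<Rightarrow> complex"
  have "psd n (\<lambda>i j. f (\<xi> i - \<xi> j))" "psd n (\<lambda>i j. g (\<xi> i - \<xi> j))"
    using assms by (simp_all add: psd_def PhiD)
  from psd_mult[OF this]
  show "0 \<le> (\<Sum>i<n. \<Sum>j<n. a i * (f (\<xi> i - \<xi> j) * g (\<xi> i - \<xi> j)) * cnj (a j))"
    unfolding psd_def by blast
qed

lemma Phi_one: "(\<lambda>x. 1) \<in> Phi"
proof (rule PhiI)
  fix n :: nat and a :: "nat \<Rightarrow> complex"
  have "(\<Sum>i<n. \<Sum>j<n. a i * 1 * cnj (a j)) = (\<Sum>i<n. a i) * cnj (\<Sum>i<n. a i)"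
    by (simp add: sum_product)
  then show "0 \<le> (\<Sum>i<n. \<Sum>j<n. a i * 1 * cnj (a j))"
    by (simp only: mult_cnj_nonneg)
qed

lemma Phi_power: "f \<in> Phi \<Longrightarrow> (\<lambda>x. f x ^ k) \<in> Phi"
  by (induction k) (auto intro: Phi_one Phi_mult)

lemma Phi_exp_inner: "(\<lambda>x. exp (\<i> * complex_of_real (x \<bullet> v))) \<in> Phi"
proof (rule PhiI)
  fix n :: nat and a :: "nat \<Rightarrow> complex" and \<xi> :: "nat \<Rightarrow> 'a"
  let ?b = "\<lambda>i. a i * exp (\<i> * complex_of_real (\<xi> i \<bullet> v))"
  have "(\<Sum>i<n. \<Sum>j<n. a i * exp (\<i> * complex_of_real ((\<xi> i - \<xi> j) \<bullet> v)) * cnj (a j))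
     = (\<Sum>i<n. ?b i) * cnj (\<Sum>i<n. ?b i)"
  proof -
    have "exp (\<i> * complex_of_real ((\<xi> i - \<xi> j) \<bullet> v))
      = exp (\<i> * complex_of_real (\<xi> i \<bullet> v)) * cnj (exp (\<i> * complex_of_real (\<xi> j \<bullet> v)))" for i j
      by (simp add: inner_diff_left exp_cnj right_diff_distrib flip: exp_add)
    then show ?thesis by (simp add: sum_product mult_ac)
  qed
  then show "0 \<le> (\<Sum>i<n. \<Sum>j<n. a i * exp (\<i> * complex_of_real ((\<xi> i - \<xi> j) \<bullet> v)) * cnj (a j))"
    by (simp only: mult_cnj_nonneg)
qed

subsection \<open>Lebesgue measure on a coordinate subspace\<close>

abbreviation embed :: "'d set \<Rightarrow> ('d \<Rightarrow> real) \<Rightarrow> real ^ 'd" where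
  "embed I y \<equiv> (\<Sum>i\<in>I. y i *\<^sub>R axis i 1)"

lemma embed_nth: "embed I y $ i = (if i \<in> I then y i else 0)" for I :: "'d::finite set"
proof -
  show ?thesis
    by (simp add: axis_def if_distrib cong: if_cong)
qed

lemma measurable_embed [measurable]:
  "embed I \<in> (\<Pi>\<^sub>M i\<in>I. (lborel :: real measure)) \<rightarrow>\<^sub>M borel" for I :: "'d::finite set"
  by measurable

lemma sets_coord_lborel [simp, measurable_cong]: "sets (coord_lborel m) = sets borel"
  by (simp add: coord_lborel_def)

lemma space_coord_lborel [simp]: "space (coord_lborel m) = UNIV"
  by (simp add: coord_lborel_def)

lemma emeasure_lborel_affine_vimage:
  assumes "(c::real) \<noteq> 0" and [measurable]: "A \<in> sets borel"
  shows "ennreal \<bar>c\<bar> * emeasure lborel ((\<lambda>x. a + c * x) -` A) = emeasure lborel A"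
proof -
  have "emeasure lborel A = emeasure (density (distr lborel borel (\<lambda>x. a + c * x)) (\<lambda>_. \<bar>c\<bar>)) A"
    using lborel_real_affine[OF assms(1), of a] by simp
  also have "\<dots> = ennreal \<bar>c\<bar> * emeasure lborel ((\<lambda>x. a + c * x) -` A)"
    by (simp add: emeasure_density_const emeasure_distr)
  finally show ?thesis by simp
qed

lemma PiM_lborel_affine:
  assumes "finite I" "(c::real) \<noteq> 0"
  shows "density (distr (\<Pi>\<^sub>M i\<in>I. lborel) (\<Pi>\<^sub>M i\<in>I. lborel) (\<lambda>y. \<lambda>i\<in>I. a i + c * y i))
     (\<lambda>_. ennreal (\<bar>c\<bar> ^ card I)) = (\<Pi>\<^sub>M i\<in>I. lborel)"
    (is "?P = ?Q")
proof -
  interpret product_sigma_finite "\<lambda>_. lborel :: real measure" ..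
  have [measurable]: "(\<lambda>y. \<lambda>i\<in>I. a i + c * y i) \<in> ?Q \<rightarrow>\<^sub>M ?Q"
    by measurable
  show ?thesis
  proof (rule PiM_eqI[OF assms(1)])
    fix A :: "'a \<Rightarrow> real set" assume A: "\<And>i. i \<in> I \<Longrightarrow> A i \<in> sets lborel"
    have PA: "Pi\<^sub>E I A \<in> sets ?Q" using A assms by (intro sets_PiM_I_finite) auto
    have "(\<lambda>y. \<lambda>i\<in>I. a i + c * y i) -` Pi\<^sub>E I A \<inter> space ?Q
        = Pi\<^sub>E I (\<lambda>i. (\<lambda>x. a i + c * x) -` A i)"
      by (auto simp: space_PiM PiE_iff)
    moreover have "(\<lambda>x. a i + c * x) -` A i \<in> sets borel" if "i \<in> I" for i
      using A[OF that] measurable_sets[of "\<lambda>x. a i + c * x" borel borel "A i"] by simp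
    ultimately have "emeasure ?P (Pi\<^sub>E I A)
        = ennreal (\<bar>c\<bar> ^ card I) * (\<Prod>i\<in>I. emeasure lborel ((\<lambda>x. a i + c * x) -` A i))"
      using PA assms(1) by (simp add: emeasure_density_const emeasure_distr emeasure_PiM)
    also have "\<dots> = (\<Prod>i\<in>I. ennreal \<bar>c\<bar> * emeasure lborel ((\<lambda>x. a i + c * x) -` A i))"
      by (simp add: prod.distrib ennreal_power)
    also have "\<dots> = (\<Prod>i\<in>I. emeasure lborel (A i))"
      using A assms by (intro prod.cong refl emeasure_lborel_affine_vimage) auto
    finally show "emeasure ?P (Pi\<^sub>E I A) = (\<Prod>i\<in>I. emeasure lborel (A i))" .
  qed simp
qed

text \<open>Transports the coordinatewise substitution through \<open>embed\<close>. The shift has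
  to stay in the subspace that carries the measure, and the Jacobian is |c|^m, not |c|^d.\<close>

lemma coord_lborel_affine:
  fixes v :: "real ^ 'd::{finite,linorder}"
  assumes "m \<le> CARD('d)" "c \<noteq> 0" "v \<in> coord_subspace m"
  shows "coord_lborel m =
     density (distr (coord_lborel m) borel (\<lambda>y. v + c *\<^sub>R y)) (\<lambda>_. ennreal (\<bar>c\<bar> ^ m))"
proof -
  let ?I = "first_coords m :: 'd set" let ?Q = "\<Pi>\<^sub>M i\<in>?I. (lborel :: real measure)"
  let ?g = "\<lambda>y. \<lambda>i\<in>?I. v $ i + c * y i"
  have [measurable]: "?g \<in> ?Q \<rightarrow>\<^sub>M ?Q" by measurable
  have g: "embed ?I (\<lambda>i. v $ i + c * y i) = v + c *\<^sub>R embed ?I y" for y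
    using assms(3) by (auto simp: vec_eq_iff embed_nth coord_subspace_def simp del: sum_component)
  have "coord_lborel m = distr (density (distr ?Q ?Q ?g) (\<lambda>_. ennreal (\<bar>c\<bar> ^ card ?I))) borel (embed ?I)"
    unfolding PiM_lborel_affine[OF finite assms(2)] coord_lborel_def ..
  also have "\<dots> = density (distr (distr ?Q ?Q ?g) borel (embed ?I)) (\<lambda>_. ennreal (\<bar>c\<bar> ^ m))"
    by (subst density_distr) (simp_all add: card_first_coords[OF assms(1)])
  also have "distr (distr ?Q ?Q ?g) borel (embed ?I) = distr (coord_lborel m) borel (\<lambda>y. v + c *\<^sub>R y)"
    unfolding coord_lborel_def by (simp add: distr_distr o_def g)
  finally show ?thesis .
qed

lemma nn_integral_coord_lborel_affine:
  fixes v :: "real ^ 'd::{finite,linorder}"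
  assumes "m \<le> CARD('d)" "c \<noteq> 0" "v \<in> coord_subspace m" and [measurable]: "f \<in> borel_measurable borel"
  shows "(\<integral>\<^sup>+y. f y \<partial>coord_lborel m) = ennreal (\<bar>c\<bar> ^ m) * (\<integral>\<^sup>+y. f (v + c *\<^sub>R y) \<partial>coord_lborel m)"
  by (subst coord_lborel_affine[OF assms(1-3)])
    (simp add: nn_integral_density nn_integral_distr nn_integral_cmult)

lemma integral_coord_lborel_affine:
  fixes v :: "real ^ 'd::{finite,linorder}" and f :: "_ \<Rightarrow> 'b::{banach,second_countable_topology}"
  assumes "m \<le> CARD('d)" "c \<noteq> 0" "v \<in> coord_subspace m" and [measurable]: "f \<in> borel_measurable borel"
  shows "(\<integral>y. f y \<partial>coord_lborel m) = (\<bar>c\<bar> ^ m) *\<^sub>R (\<integral>y. f (v + c *\<^sub>R y) \<partial>coord_lborel m)"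
  by (subst coord_lborel_affine[OF assms(1-3)])
    (simp add: integral_density integral_distr)

lemma integrable_coord_lborel_affine:
  fixes v :: "real ^ 'd::{finite,linorder}" and f :: "_ \<Rightarrow> 'b::{banach,second_countable_topology}"
  assumes "m \<le> CARD('d)" "c \<noteq> 0" "v \<in> coord_subspace m" and [measurable]: "f \<in> borel_measurable borel"
  shows "integrable (coord_lborel m) (\<lambda>y. f (v + c *\<^sub>R y)) \<longleftrightarrow> integrable (coord_lborel m) f"
proof -
  have "integrable (coord_lborel m) f \<longleftrightarrow>
     integrable (density (distr (coord_lborel m) borel (\<lambda>y. v + c *\<^sub>R y)) (\<lambda>_. ennreal (\<bar>c\<bar> ^ m))) f"
    using coord_lborel_affine[OF assms(1-3)] by simp
  also have "\<dots> \<longleftrightarrow> integrable (coord_lborel m) (\<lambda>y. f (v + c *\<^sub>R y))"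
    using assms(2) integrable_scaleR_right[of "1 / \<bar>c\<bar> ^ m" "coord_lborel m" "\<lambda>y. (\<bar>c\<bar> ^ m) *\<^sub>R f (v + c *\<^sub>R y)"]
    by (auto simp: integrable_density integrable_distr_eq)
  finally show ?thesis by simp
qed

lemma zero_in_coord_subspace [simp]: "0 \<in> coord_subspace m"
  by (simp add: coord_subspace_def)

lemma emeasure_coord_lborel_cball:
  "emeasure (coord_lborel m) (cball (0 :: real ^ 'd::{finite,linorder}) r) < \<infinity>"
proof -
  let ?I = "first_coords m :: 'd set" let ?Q = "\<Pi>\<^sub>M i\<in>?I. (lborel :: real measure)"
  interpret product_sigma_finite "\<lambda>_::'d. lborel :: real measure" ..
  have sub: "embed ?I -` cball 0 r \<inter> space ?Q \<subseteq> (\<Pi>\<^sub>E i\<in>?I. {- r..r})"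
  proof (intro subsetI PiE_I)
    fix y i assume y: "y \<in> embed ?I -` cball 0 r \<inter> space ?Q" and i: "i \<in> ?I"
    have "\<bar>y i\<bar> \<le> r"
      using component_le_norm_cart[of "embed ?I y" i] i y by (simp add: embed_nth del: sum_component)
    then show "y i \<in> {- r..r}" by auto
  qed (auto simp: space_PiM PiE_iff extensional_def)
  have "emeasure (coord_lborel m) (cball (0 :: (real, 'd) vec) r) = emeasure ?Q (embed ?I -` cball 0 r \<inter> space ?Q)"
    unfolding coord_lborel_def by (subst emeasure_distr) auto
  also have "\<dots> \<le> emeasure ?Q (\<Pi>\<^sub>E i\<in>?I. {- r..r})"
    by (rule emeasure_mono[OF sub]) (auto intro: sets_PiM_I_finite)
  also have "\<dots> = (\<Prod>i\<in>?I. emeasure lborel {- r..r})"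
    by (rule emeasure_PiM) auto
  also have "\<dots> < \<infinity>" by (cases "0 \<le> r") (auto simp: ennreal_power less_top power_0_left)
  finally show ?thesis .
qed

lemma sigma_finite_coord_lborel:
  "sigma_finite_measure (coord_lborel m :: (real ^ 'd::{finite,linorder}) measure)"
proof
  show "\<exists>A::(real, 'd) vec set set. countable A \<and> A \<subseteq> sets (coord_lborel m) \<and>
     \<Union> A = space (coord_lborel m) \<and> (\<forall>a\<in>A. emeasure (coord_lborel m) a \<noteq> \<infinity>)"
  proof (intro exI[of _ "range (\<lambda>n::nat. cball 0 (real n))"] conjI)
    show "(\<Union>n::nat. cball (0 :: (real, 'd) vec) (real n)) = space (coord_lborel m)"
      using real_arch_simple by auto
    show "\<forall>a\<in>range (\<lambda>n::nat. cball (0 :: (real, 'd) vec) (real n)). emeasure (coord_lborel m) a \<noteq> \<infinity>"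
      using emeasure_coord_lborel_cball by (auto simp: less_top)
  qed auto
qed

lemma coord_lborel_nonnull:
  "emeasure (coord_lborel m) (UNIV :: (real ^ 'd::{finite,linorder}) set) \<noteq> 0"
proof -
  interpret product_sigma_finite "\<lambda>_::'d. lborel :: real measure" ..
  let ?I = "first_coords m :: 'd set" let ?Q = "\<Pi>\<^sub>M i\<in>?I. (lborel :: real measure)"
  have "emeasure (coord_lborel m) (UNIV :: ((real, 'd) vec) set) = emeasure ?Q (space ?Q)"
    unfolding coord_lborel_def by (subst emeasure_distr) auto
  also have "space ?Q = (\<Pi>\<^sub>E i\<in>?I. UNIV)" by (simp add: space_PiM)
  also have "emeasure ?Q \<dots> = (\<Prod>i\<in>?I. emeasure lborel (UNIV :: real set))"
    by (rule emeasure_PiM) auto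
  also have "\<dots> \<noteq> 0" by (auto simp: emeasure_lborel_UNIV)
  finally show ?thesis .
qed

subsection \<open>Integration of functions of a gauge\<close>

text \<open>No triangle inequality is assumed, so sublevel sets need not be convex; integration only
  uses how their volume scales.\<close>

locale gauge =
  fixes \<rho> :: "real ^ 'd::{finite,linorder} \<Rightarrow> real"
  assumes rho_cont: "continuous_on UNIV \<rho>"
    and rho_hom: "\<And>t x. \<rho> (t *\<^sub>R x) = \<bar>t\<bar> * \<rho> x"
    and rho_pos: "\<And>x. x \<noteq> 0 \<Longrightarrow> \<rho> x > 0"
begin

lemma rho_measurable [measurable]: "\<rho> \<in> borel_measurable borel"
  using rho_cont by (rule borel_measurable_continuous_onI)

lemma rho_zero [simp]: "\<rho> 0 = 0"
  using rho_hom[of 0 0] by simp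

lemma rho_nonneg: "0 \<le> \<rho> x"
  using rho_pos[of x] by (cases "x = 0") auto

lemma rho_minus: "\<rho> (- x) = \<rho> x"
  using rho_hom[of "-1" x] by simp

text \<open>The minimum of \<open>\<rho>\<close> on the compact unit sphere is positive, and
  homogeneity extends the bound to all vectors.\<close>

lemma rho_ge_norm: obtains a where "a > 0" "\<And>x. a * norm x \<le> \<rho> x"
proof -
  let ?S = "sphere (0 :: (real, 'd) vec) 1"
  have ne: "axis undefined 1 \<in> ?S" by simp
  obtain x0 where x0: "x0 \<in> ?S" "\<And>x. x \<in> ?S \<Longrightarrow> \<rho> x0 \<le> \<rho> x"
    using continuous_attains_inf[of ?S \<rho>] ne rho_cont by (metis compact_sphere continuous_on_subset empty_iff subset_UNIV)
  show ?thesis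
  proof
    show "\<rho> x0 > 0" using x0(1) rho_pos[of x0] by force
    show "\<rho> x0 * norm x \<le> \<rho> x" for x
    proof (cases "x = 0")
      case False
      have "\<rho> x0 \<le> \<rho> ((1 / norm x) *\<^sub>R x)" using False by (intro x0(2)) simp
      then show ?thesis using False unfolding rho_hom by (simp add: field_simps)
    qed simp
  qed
qed

context
  fixes m :: nat
  assumes m: "1 \<le> m" "m \<le> CARD('d)"
begin

lemma emeasure_rho_le_finite: "emeasure (coord_lborel m) {y. \<rho> y \<le> r} < \<infinity>"
proof -
  obtain a where a: "a > 0" "\<And>x. a * norm x \<le> \<rho> x" using rho_ge_norm by blast
  have "norm x \<le> r / a" if "\<rho> x \<le> r" for x
  proof -
    have "a * norm x \<le> r" using a(2)[of x] that by simp
    with a(1) show ?thesis by (simp add: field_simps)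
  qed
  then have "{y. \<rho> y \<le> r} \<subseteq> cball 0 (r / a)" by auto
  then have "emeasure (coord_lborel m) {y. \<rho> y \<le> r} \<le> emeasure (coord_lborel m) (cball (0::(real,'d) vec) (r / a))"
    by (intro emeasure_mono) auto
  then show ?thesis using emeasure_coord_lborel_cball[of m "r / a"] by (rule order_le_less_trans)
qed

text \<open>Times m, this is the constant in front of u^(m-1) in polar coordinates for
  \<open>\<rho>\<close>, the analogue of the area of the unit sphere.\<close>

definition unit_volume :: real where
  "unit_volume = measure (coord_lborel m) {y. \<rho> y \<le> 1}"

lemma unit_volume_nonneg: "0 \<le> unit_volume"
  by (simp add: unit_volume_def)

lemma emeasure_rho_le_pos:
  assumes "r > 0"
  shows "emeasure (coord_lborel m) {y. \<rho> y \<le> r} = ennreal (unit_volume * r ^ m)"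
proof -
  have "emeasure (coord_lborel m) {y. \<rho> y \<le> r} = (\<integral>\<^sup>+y. indicator {y. \<rho> y \<le> r} y \<partial>coord_lborel m)"
    by simp
  also have "\<dots> = ennreal (\<bar>r\<bar> ^ m) * (\<integral>\<^sup>+y. indicator {y. \<rho> y \<le> r} (0 + r *\<^sub>R y) \<partial>coord_lborel m)"
    using assms m by (intro nn_integral_coord_lborel_affine) auto
  also have "(\<lambda>y. indicator {y. \<rho> y \<le> r} (0 + r *\<^sub>R y) :: ennreal) = indicator {y. \<rho> y \<le> 1}"
    using assms by (auto simp: indicator_def fun_eq_iff rho_hom)
  also have "(\<integral>\<^sup>+y. indicator {y. \<rho> y \<le> 1} y \<partial>coord_lborel m) = emeasure (coord_lborel m) {y. \<rho> y \<le> 1}"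
    by simp
  also have "\<dots> = ennreal unit_volume"
    unfolding unit_volume_def using emeasure_rho_le_finite[of 1] by (simp add: emeasure_eq_ennreal_measure)
  finally show ?thesis using assms by (simp add: ennreal_mult' mult.commute unit_volume_nonneg)
qed

lemma emeasure_rho_le:
  "emeasure (coord_lborel m) {y. \<rho> y \<le> r} = (if 0 \<le> r then ennreal (unit_volume * r ^ m) else 0)"
proof -
  consider "r > 0" | "r = 0" | "r < 0" by linarith
  then show ?thesis
  proof cases
    case 1 then show ?thesis by (simp add: emeasure_rho_le_pos)
  next
    case 2
    \<comment> \<open>Scaling says nothing at radius 0; the set is squeezed between sublevel sets of
      radius tending to 0, whose volume vanishes in the limit because
      \<open>m \<ge> 1\<close>.\<close>
    have "emeasure (coord_lborel m) {y. \<rho> y \<le> 0} \<le> ennreal (unit_volume * (1 / real (Suc k)) ^ m)" for k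
    proof -
      have "emeasure (coord_lborel m) {y. \<rho> y \<le> 0} \<le> emeasure (coord_lborel m) {y. \<rho> y \<le> 1 / real (Suc k)}"
        by (intro emeasure_mono) (auto intro: order_trans[where y = 0])
      then show ?thesis by (simp add: emeasure_rho_le_pos)
    qed
    moreover have "(\<lambda>k. ennreal (unit_volume * (1 / real (Suc k)) ^ m)) \<longlonglongrightarrow> ennreal (unit_volume * 0 ^ m)"
      by (intro tendsto_ennrealI tendsto_intros LIMSEQ_Suc[OF lim_1_over_n])
    ultimately have "emeasure (coord_lborel m) {y. \<rho> y \<le> 0} \<le> ennreal (unit_volume * 0 ^ m)"
      by (intro LIMSEQ_le_const) auto
    then show ?thesis using 2 m by (simp add: power_0_left)
  next
    case 3
    then have "{y. \<rho> y \<le> r} = {}" using rho_nonneg by (auto simp: not_le intro: less_le_trans)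
    then show ?thesis using 3 by simp
  qed
qed

lemma nn_integral_radial_density:
  "(\<integral>\<^sup>+u. ennreal (unit_volume * real m * u ^ (m - 1)) * indicator {0..} u * indicator {..r} u \<partial>lborel)
     = (if 0 \<le> r then ennreal (unit_volume * r ^ m) else 0)"
proof (cases "0 \<le> r")
  case True
  have "(\<integral>\<^sup>+u. ennreal (unit_volume * real m * u ^ (m - 1)) * indicator {0..r} u \<partial>lborel)
     = unit_volume * r ^ m - unit_volume * 0 ^ m"
  proof (rule nn_integral_FTC_Icc[where F = "\<lambda>u. unit_volume * u ^ m"])
    show "DERIV (\<lambda>u. unit_volume * u ^ m) x :> unit_volume * real m * x ^ (m - 1)" for x
      by (auto intro!: derivative_eq_intros)
  qed (use True unit_volume_nonneg in auto)
  moreover have "(\<lambda>u. ennreal (unit_volume * real m * u ^ (m - 1)) * indicator {0..} u * indicator {..r} u)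
     = (\<lambda>u. ennreal (unit_volume * real m * u ^ (m - 1)) * indicator {0..r} u)"
    by (auto simp: fun_eq_iff indicator_def)
  ultimately show ?thesis using True m by (simp add: power_0_left)
next
  case False
  then have "(\<lambda>u. ennreal (unit_volume * real m * u ^ (m - 1)) * indicator {0..} u * indicator {..r} u)
     = (\<lambda>u. 0)"
    by (auto simp: fun_eq_iff indicator_def)
  with False show ?thesis by simp
qed

text \<open>Polar coordinates: by homogeneity \<open>{\<rho> \<le> r}\<close> has volume proportional to \<open>r ^ m\<close>.\<close>

lemma distr_rho:
  "distr (coord_lborel m) borel \<rho> =
     density lborel (\<lambda>u. ennreal (unit_volume * real m * u ^ (m - 1)) * indicator {0..} u)"
    (is "?A = ?B")
proof (rule measure_eqI_generator_eq[where E = "range (\<lambda>r::real. {..r})" and \<Omega> = UNIV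
      and A = "\<lambda>n. {..real n}"])
  have A: "emeasure ?A {..r} = (if 0 \<le> r then ennreal (unit_volume * r ^ m) else 0)" for r
    using emeasure_rho_le[of r] by (simp add: emeasure_distr vimage_def)
  show "Int_stable (range (\<lambda>r::real. {..r}))"
    by (auto simp: Int_stable_def)
  show "emeasure ?A X = emeasure ?B X" if "X \<in> range (\<lambda>r::real. {..r})" for X
    using that A nn_integral_radial_density by (auto simp: emeasure_density)
  show "sets ?A = sigma_sets UNIV (range (\<lambda>r::real. {..r}))"
       "sets ?B = sigma_sets UNIV (range (\<lambda>r::real. {..r}))"
    by (simp_all add: borel_eq_atMost)
  show "(\<Union>n. {..real n}) = UNIV" using real_arch_simple by auto
  show "emeasure ?A {..real n} \<noteq> \<infinity>" for n by (simp add: A)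
qed auto

lemma integrable_radial:
  fixes f :: "real \<Rightarrow> 'b::{banach,second_countable_topology}"
  assumes [measurable]: "f \<in> borel_measurable borel"
    and int: "set_integrable lborel {0..} (\<lambda>u. norm (f u) * u ^ (m - 1))"
  shows "integrable (coord_lborel m) (\<lambda>y. f (\<rho> y))"
proof -
  have "integrable lborel (\<lambda>u. (unit_volume * real m) * (indicator {0..} u *\<^sub>R (norm (f u) * u ^ (m - 1))))"
    using int unfolding set_integrable_def by (rule integrable_mult_right)
  then have "integrable lborel (\<lambda>u. (unit_volume * real m * u ^ (m - 1) * indicator {0..} u) *\<^sub>R f u)"
    by (rule Bochner_Integration.integrable_bound) 
      (auto simp: indicator_def unit_volume_nonneg abs_mult intro!: AE_I2)
  then have "integrable (density lborel (\<lambda>u. ennreal (unit_volume * real m * u ^ (m - 1) * indicator {0..} u))) f"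
    by (subst integrable_density) (auto simp: indicator_def unit_volume_nonneg)
  also have "(\<lambda>u. ennreal (unit_volume * real m * u ^ (m - 1) * indicator {0..} u)) =
      (\<lambda>u. ennreal (unit_volume * real m * u ^ (m - 1)) * indicator {0..} u)"
    by (auto simp: fun_eq_iff indicator_def)
  finally have "integrable (distr (coord_lborel m) borel \<rho>) f"
    unfolding distr_rho .
  then show ?thesis by (subst (asm) integrable_distr_eq) auto
qed

end

end

lemma gauge_norm: "gauge (norm :: real ^ 'd::{finite,linorder} \<Rightarrow> real)"
  by standard (auto intro: continuous_on_norm_id)

text \<open>Polar coordinates for the norm turn this into an absolute moment of order k + m - 1 of
  the normal law with variance 1 / (2 s).\<close>

lemma integrable_gaussian_moment:
  assumes m: "1 \<le> m" "m \<le> CARD('d)" and s: "s > 0"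
  shows "integrable (coord_lborel m) (\<lambda>y :: real ^ 'd::{finite,linorder}. exp (- s * (norm y)\<^sup>2) * norm y ^ k)"
proof -
  define \<sigma> where "\<sigma> = 1 / sqrt (2 * s)"
  have \<sigma>: "\<sigma> > 0" "2 * \<sigma>\<^sup>2 = 1 / s" using s by (simp_all add: \<sigma>_def power_divide)
  interpret gauge "norm :: (real, 'd) vec \<Rightarrow> real" by (rule gauge_norm)
  have "integrable lborel (\<lambda>u. normal_density 0 \<sigma> u * \<bar>u - 0\<bar> ^ (k + (m - 1)))"
    using \<sigma> by (intro integrable_normal_moment_abs)
  then have "integrable lborel (\<lambda>u. sqrt (2 * pi * \<sigma>\<^sup>2) * (normal_density 0 \<sigma> u * \<bar>u - 0\<bar> ^ (k + (m - 1))))"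
    by (rule integrable_mult_right)
  also have "(\<lambda>u. sqrt (2 * pi * \<sigma>\<^sup>2) * (normal_density 0 \<sigma> u * \<bar>u - 0\<bar> ^ (k + (m - 1))))
    = (\<lambda>u. norm (exp (- s * u\<^sup>2) * u ^ k) * \<bar>u\<bar> ^ (m - 1))"
    using \<sigma> s by (simp add: normal_density_def fun_eq_iff power_add abs_mult power_abs mult.commute[of s])
  finally have "integrable lborel (\<lambda>u. norm (exp (- s * u\<^sup>2) * u ^ k) * \<bar>u\<bar> ^ (m - 1))" .
  then have "set_integrable lborel {0..} (\<lambda>u. norm (exp (- s * u\<^sup>2) * u ^ k) * u ^ (m - 1))"
    unfolding set_integrable_def
    by (rule Bochner_Integration.integrable_bound) (auto simp: indicator_def abs_mult power_abs intro!: AE_I2)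
  from integrable_radial[OF m _ this] show ?thesis by simp
qed

subsection \<open>Integrable positive definite functions have nonnegative integral\<close>

lemma integral_complex_nonneg:
  fixes f :: "'a \<Rightarrow> complex"
  assumes "\<And>x. 0 \<le> f x"
  shows "0 \<le> integral\<^sup>L M f"
proof (cases "integrable M f")
  case True
  have "Re (integral\<^sup>L M f) = (\<integral>x. Re (f x) \<partial>M)" "Im (integral\<^sup>L M f) = (\<integral>x. Im (f x) \<partial>M)"
    using True by simp_all
  moreover have "(\<integral>x. Re (f x) \<partial>M) \<ge> 0" "(\<integral>x. Im (f x) \<partial>M) = 0"
    using assms by (auto simp: less_eq_complex_def integral_nonneg_AE)
  ultimately show ?thesis by (simp add: less_eq_complex_def)
next
  case False
  \<comment> \<open>The integral of a nonintegrable function is 0 by convention.\<close>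
  then show ?thesis by (simp add: not_integrable_integral_eq)
qed

lemma integrable_pair_mult:
  fixes f :: "'a \<Rightarrow> 'c::{real_normed_field,banach,second_countable_topology}"
  assumes "sigma_finite_measure M1" "sigma_finite_measure M2" "integrable M1 f" "integrable M2 g"
  shows "integrable (M1 \<Otimes>\<^sub>M M2) (\<lambda>(x, y). f x * g y)"
proof -
  interpret pair_sigma_finite M1 M2
    using assms by (simp add: pair_sigma_finite_def)
  have [measurable]: "f \<in> borel_measurable M1" "g \<in> borel_measurable M2"
    using assms by auto
  show ?thesis
    using assms(3,4)
    by (intro Fubini_integrable) (auto simp: norm_mult)
qed

text \<open>Two distinct coordinates of an i.i.d. sequence are independent; this evaluates the
  off-diagonal expectations in the sampling argument.\<close>

lemma distr_PiM_pair:
  assumes "prob_space \<mu>" "k \<noteq> l"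
  shows "distr (\<Pi>\<^sub>M i\<in>(UNIV :: nat set). \<mu>) (\<mu> \<Otimes>\<^sub>M \<mu>) (\<lambda>\<omega>. (\<omega> k, \<omega> l)) = \<mu> \<Otimes>\<^sub>M \<mu>"
proof (rule sym, rule pair_measure_eqI)
  interpret \<mu>: prob_space \<mu> by fact
  interpret product_prob_space "\<lambda>_::nat. \<mu>" UNIV by standard
  show "sigma_finite_measure \<mu>" "sigma_finite_measure \<mu>" by unfold_locales
  fix A B assume AB: "A \<in> sets \<mu>" "B \<in> sets \<mu>"
  let ?X = "\<lambda>i. if i = k then A else B"
  have "(\<lambda>\<omega>. (\<omega> k, \<omega> l)) -` (A \<times> B) \<inter> space (\<Pi>\<^sub>M i\<in>(UNIV :: nat set). \<mu>)
      = prod_emb UNIV (\<lambda>_. \<mu>) {k, l} (Pi\<^sub>E {k, l} ?X)"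
    using assms(2) by (auto simp: prod_emb_def space_PiM PiE_iff)
  then have "emeasure (distr (\<Pi>\<^sub>M i\<in>(UNIV :: nat set). \<mu>) (\<mu> \<Otimes>\<^sub>M \<mu>) (\<lambda>\<omega>. (\<omega> k, \<omega> l))) (A \<times> B)
      = emeasure (\<Pi>\<^sub>M i\<in>(UNIV :: nat set). \<mu>) (prod_emb UNIV (\<lambda>_. \<mu>) {k, l} (Pi\<^sub>E {k, l} ?X))"
    using AB by (subst emeasure_distr) auto
  also have "\<dots> = (\<Prod>i\<in>{k, l}. emeasure \<mu> (?X i))"
    using AB by (intro emeasure_PiM_emb) auto
  also have "\<dots> = emeasure \<mu> A * emeasure \<mu> B" using assms(2) by simp
  finally show "emeasure \<mu> A * emeasure \<mu> B =
     emeasure (distr (\<Pi>\<^sub>M i\<in>(UNIV :: nat set). \<mu>) (\<mu> \<Otimes>\<^sub>M \<mu>) (\<lambda>\<omega>. (\<omega> k, \<omega> l))) (A \<times> B)" by simp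
qed simp

text \<open>Evaluate the kernel at \<open>N\<close> independent points: the expectation of the resulting double sum is
  \<open>N * (N - 1)\<close> times the double integral, up to an error of order \<open>N\<close> from the diagonal.\<close>

lemma psd_kernel_double_integral_nonneg:
  fixes W :: "'a \<Rightarrow> 'a \<Rightarrow> complex"
  assumes \<mu>: "prob_space \<mu>"
    and W [measurable]: "(\<lambda>(x, y). W x y) \<in> borel_measurable (\<mu> \<Otimes>\<^sub>M \<mu>)"
    and bound: "\<And>x y. cmod (W x y) \<le> B"
    and psd: "\<And>N (\<xi> :: nat \<Rightarrow> 'a). 0 \<le> (\<Sum>k<(N::nat). \<Sum>l<N. W (\<xi> k) (\<xi> l))"
  shows "0 \<le> (\<integral>x. (\<integral>y. W x y \<partial>\<mu>) \<partial>\<mu>)"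
proof -
  interpret \<mu>: prob_space \<mu> by fact
  interpret \<mu>\<mu>: pair_prob_space \<mu> \<mu> ..
  interpret P: product_prob_space "\<lambda>_::nat. \<mu>" UNIV by standard
  let ?P = "\<Pi>\<^sub>M i\<in>(UNIV :: nat set). \<mu>"
  define J where "J = (\<integral>p. (case p of (x, y) \<Rightarrow> W x y) \<partial>(\<mu> \<Otimes>\<^sub>M \<mu>))"
  have "integrable (\<mu> \<Otimes>\<^sub>M \<mu>) (\<lambda>(x, y). W x y)"
    by (rule \<mu>\<mu>.P.integrable_const_bound[where B = B]) (use bound in \<open>auto intro!: AE_I2\<close>)
  then have J: "J = (\<integral>x. (\<integral>y. W x y \<partial>\<mu>) \<partial>\<mu>)"
    unfolding J_def using \<mu>\<mu>.integral_fst' by fastforce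
  have meas [measurable]: "(\<lambda>\<omega>. W (\<omega> k) (\<omega> l)) \<in> borel_measurable ?P" for k l
    using measurable_compose[of "\<lambda>\<omega>. (\<omega> k, \<omega> l)" ?P "\<mu> \<Otimes>\<^sub>M \<mu>", OF _ W] by simp
  have int: "integrable ?P (\<lambda>\<omega>. W (\<omega> k) (\<omega> l))" for k l
    by (rule P.P.integrable_const_bound[where B = B]) (use bound in \<open>auto intro!: AE_I2\<close>)
  have off: "(\<integral>\<omega>. W (\<omega> k) (\<omega> l) \<partial>?P) = J" if "k \<noteq> l" for k l
  proof -
    have "J = (\<integral>p. (case p of (x, y) \<Rightarrow> W x y) \<partial>distr ?P (\<mu> \<Otimes>\<^sub>M \<mu>) (\<lambda>\<omega>. (\<omega> k, \<omega> l)))"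
      unfolding J_def distr_PiM_pair[OF \<mu> that] ..
    also have "\<dots> = (\<integral>\<omega>. W (\<omega> k) (\<omega> l) \<partial>?P)"
      by (subst integral_distr) auto
    finally show ?thesis by simp
  qed
  define D where "D k = (\<integral>\<omega>. W (\<omega> k) (\<omega> k) \<partial>?P)" for k
  have D: "cmod (D k) \<le> B" for k
  proof -
    have "cmod (D k) \<le> (\<integral>\<omega>. cmod (W (\<omega> k) (\<omega> k)) \<partial>?P)"
      unfolding D_def by (rule integral_norm_bound)
    also have "\<dots> \<le> (\<integral>\<omega>. B \<partial>?P)"
      by (intro integral_mono integrable_norm int) (auto simp: bound)
    finally show ?thesis by (simp add: P.P.prob_space)
  qed
  have E: "0 \<le> of_nat N * (of_nat N - 1) * J + (\<Sum>k<N. D k)" for N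
  proof -
    have "0 \<le> (\<integral>\<omega>. (\<Sum>k<N. \<Sum>l<N. W (\<omega> k) (\<omega> l)) \<partial>?P)"
      by (intro integral_complex_nonneg psd)
    also have "\<dots> = (\<Sum>k<N. \<Sum>l<N. (\<integral>\<omega>. W (\<omega> k) (\<omega> l) \<partial>?P))"
      by (simp add: int)
    also have "\<dots> = (\<Sum>k<N. D k + (of_nat N - 1) * J)"
    proof (intro sum.cong refl)
      fix k assume k: "k \<in> {..<N}"
      have "(\<Sum>l<N. (\<integral>\<omega>. W (\<omega> k) (\<omega> l) \<partial>?P)) = D k + (\<Sum>l\<in>{..<N} - {k}. J)"
        using k off by (subst sum.remove[of _ k]) (auto simp: D_def intro!: sum.cong)
      also have "(\<Sum>l\<in>{..<N} - {k}. J) = (of_nat N - 1) * J"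
        using k by (simp add: card_Diff_singleton of_nat_diff)
      finally show "(\<Sum>l<N. (\<integral>\<omega>. W (\<omega> k) (\<omega> l) \<partial>?P)) = D k + (of_nat N - 1) * J" .
    qed
    also have "\<dots> = of_nat N * (of_nat N - 1) * J + (\<Sum>k<N. D k)"
      by (simp only: sum.distrib sum_constant card_lessThan) simp
    finally show ?thesis .
  qed
  \<comment> \<open>Divided by N^2 with \<open>N = Suc n\<close>, the off-diagonal part tends to J,
    while the diagonal part is at most B / N.\<close>
  have "0 \<le> (1 - 1 / of_nat (Suc n)) * J + (\<Sum>k<Suc n. D k) / (of_nat (Suc n))\<^sup>2" for n
  proof -
    have "0 \<le> complex_of_real (1 / (real (Suc n))\<^sup>2) * (of_nat (Suc n) * (of_nat (Suc n) - 1) * J + (\<Sum>k<Suc n. D k))"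
      by (rule complex_nonneg_mult[OF _ E], subst of_real_nonneg_iff) simp
    also have "\<dots> = (1 - 1 / of_nat (Suc n)) * J + (\<Sum>k<Suc n. D k) / (of_nat (Suc n))\<^sup>2"
      by (simp add: field_simps power2_eq_square del: of_nat_Suc sum.lessThan_Suc)
    finally show ?thesis .
  qed
  moreover have "(\<lambda>n. (1 - 1 / of_nat (Suc n)) * J + (\<Sum>k<Suc n. D k) / (of_nat (Suc n))\<^sup>2)
     \<longlonglongrightarrow> (1 - 0) * J + 0"
  proof (intro tendsto_intros LIMSEQ_Suc[OF lim_1_over_n])
    show "(\<lambda>n. (\<Sum>k<Suc n. D k) / (of_nat (Suc n))\<^sup>2) \<longlonglongrightarrow> 0"
    proof (rule Lim_null_comparison)
      show "\<forall>\<^sub>F n in sequentially. norm ((\<Sum>k<Suc n. D k) / (of_nat (Suc n))\<^sup>2) \<le> B * (1 / real (Suc n))"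
      proof (intro always_eventually allI)
        fix n
        have "cmod (\<Sum>k<Suc n. D k) \<le> real (Suc n) * B"
          using sum_norm_bound[of "{..<Suc n}" D B] D by simp
        then have "cmod (\<Sum>k<Suc n. D k) / (real (Suc n))\<^sup>2 \<le> (real (Suc n) * B) / (real (Suc n))\<^sup>2"
          by (intro divide_right_mono) auto
        then show "norm ((\<Sum>k<Suc n. D k) / (of_nat (Suc n))\<^sup>2) \<le> B * (1 / real (Suc n))"
          by (simp add: norm_divide norm_power norm_mult power2_eq_square del: of_nat_Suc sum.lessThan_Suc)
      qed
      show "(\<lambda>n. B * (1 / real (Suc n))) \<longlonglongrightarrow> 0"
        by (rule tendsto_mult_right_zero[OF LIMSEQ_Suc[OF lim_1_over_n]])
    qed
  qed
  ultimately have "0 \<le> (1 - 0) * J + 0" by (rule complex_nonneg_LIMSEQ[rotated])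
  then show ?thesis using J by simp
qed

text \<open>Justifies substitutions whose shift is itself an integration variable, since shifts must
  lie in the subspace.\<close>

lemma AE_coord_subspace:
  "AE y in coord_lborel m. (y :: real ^ 'd::{finite,linorder}) \<in> coord_subspace m"
proof -
  have [measurable]: "coord_subspace m \<in> sets (borel :: (real, 'd) vec measure)"
    unfolding coord_subspace_def by measurable
  show ?thesis
    unfolding coord_lborel_def
    by (subst AE_distr_iff) (auto simp: coord_subspace_def embed_nth simp del: sum_component)
qed

text \<open>Completing the square: |x|^2 + |x - z|^2 = 2 |x - z/2|^2 + |z|^2 / 2. Integration in x
  then leaves a pure Gaussian in z.\<close>

lemma gaussian_parallelogram:
  fixes x z :: "'a::real_inner"
  shows "exp (- s * (norm x)\<^sup>2) * exp (- s * (norm (x - z))\<^sup>2)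
    = exp (- (2 * s) * (norm (x - (1/2) *\<^sub>R z))\<^sup>2) * exp (- (s / 2) * (norm z)\<^sup>2)"
  unfolding exp_add[symmetric]
  by (rule arg_cong[where f = exp])
    (simp add: power2_norm_eq_inner inner_diff_left inner_diff_right inner_commute algebra_simps)

lemma integral_gaussian_pos:
  assumes "1 \<le> m" "m \<le> CARD('d)" "r > 0"
  shows "0 < (\<integral>x. exp (- r * (norm x)\<^sup>2) \<partial>(coord_lborel m :: (real ^ 'd::{finite,linorder}) measure))"
proof -
  let ?M = "coord_lborel m :: (real, 'd) vec measure"
  define g where "g x = exp (- r * (norm x)\<^sup>2)" for x :: "(real, 'd) vec"
  have gpos: "g x > 0" for x by (simp add: g_def)
  have gint: "integrable ?M g"
    using integrable_gaussian_moment[OF assms, of 0] by (simp add: g_def[abs_def])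
  have "integral\<^sup>L ?M g \<noteq> 0"
  proof
    assume "integral\<^sup>L ?M g = 0"
    then have "AE x in ?M. g x = 0"
      using gpos gint by (subst (asm) integral_nonneg_eq_0_iff_AE) (auto simp: less_imp_le)
    then have "AE x in ?M. False" using gpos by (simp add: less_imp_neq[symmetric])
    then show False using coord_lborel_nonnull[of m, where 'd = 'd]
      by (subst (asm) AE_iff_measurable[where N = UNIV]) auto
  qed
  moreover have "integral\<^sup>L ?M g \<ge> 0"
    using gpos by (intro integral_nonneg_AE AE_I2) (simp add: less_imp_le)
  ultimately have "integral\<^sup>L ?M g > 0" by simp
  then show ?thesis by (simp add: g_def[abs_def])
qed

text \<open>If x and y are independent with density proportional to exp(-s |x|^2), their difference
  has density proportional to exp(-(s/2) |z|^2). Hence the double integral of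
  \<open>H (x - y)\<close>, which is nonnegative, is a positive multiple of the integral in
  question.\<close>

lemma integral_Phi_nonneg_gaussian:
  fixes H :: "real ^ 'd::{finite,linorder} \<Rightarrow> complex"
  assumes m: "1 \<le> m" "m \<le> CARD('d)" and s: "s > 0"
    and H: "H \<in> Phi" and [measurable]: "H \<in> borel_measurable borel" and int: "integrable (coord_lborel m) H"
  shows "0 \<le> (\<integral>z. H z * complex_of_real (exp (- (s / 2) * (norm z)\<^sup>2)) \<partial>coord_lborel m)"
proof -
  let ?M = "coord_lborel m :: (real, 'd) vec measure"
  interpret M: sigma_finite_measure ?M by (rule sigma_finite_coord_lborel)
  interpret MM: pair_sigma_finite ?M ?M ..
  define g where "g r x = exp (- r * (norm x)\<^sup>2)" for r and x :: "(real, 'd) vec"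
  have [measurable]: "g r \<in> borel_measurable borel" for r unfolding g_def by measurable
  have gpos: "g r x > 0" for r x by (simp add: g_def)
  have gle: "g r x \<le> 1" if "r > 0" for r x using that by (simp add: g_def)
  have gint: "integrable ?M (g r)" if "r > 0" for r
    using integrable_gaussian_moment[OF m that, of 0] by (simp add: g_def[abs_def])
  have Z: "integral\<^sup>L ?M (g r) > 0" if "r > 0" for r
    using integral_gaussian_pos[OF m that] by (simp add: g_def[abs_def])
  define c where "c = integral\<^sup>L ?M (g s)"
  have c: "c > 0" using Z[OF s] by (simp add: c_def)
  define \<mu> where "\<mu> = density ?M (\<lambda>x. ennreal (g s x / c))"
  have [measurable_cong]: "sets \<mu> = sets borel" by (simp add: \<mu>_def)
  have "prob_space \<mu>"
  proof
    have "emeasure \<mu> (space \<mu>) = (\<integral>\<^sup>+x. ennreal (g s x / c) \<partial>?M)"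
      by (simp add: \<mu>_def emeasure_density)
    also have "\<dots> = ennreal (\<integral>x. g s x / c \<partial>?M)"
      using gint[OF s] gpos c by (intro nn_integral_eq_integral) (auto simp: less_imp_le)
    also have "\<dots> = 1" using c by (simp add: c_def)
    finally show "emeasure \<mu> (space \<mu>) = 1" .
  qed
  have int\<mu>: "(\<integral>x. f x \<partial>\<mu>) = (\<integral>x. complex_of_real (g s x / c) * f x \<partial>?M)" 
    if [measurable]: "f \<in> borel_measurable borel" for f :: "_ \<Rightarrow> complex"
    unfolding \<mu>_def using gpos c
    by (subst integral_density) (auto simp: less_imp_le scaleR_conv_of_real)
  have "0 \<le> (\<integral>x. (\<integral>y. H (x - y) \<partial>\<mu>) \<partial>\<mu>)"
  proof (rule psd_kernel_double_integral_nonneg[OF \<open>prob_space \<mu>\<close>])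
    show "cmod (H (x - y)) \<le> Re (H 0)" for x y by (rule Phi_norm_le[OF H])
    show "0 \<le> (\<Sum>k<N. \<Sum>l<N. H (\<xi> k - \<xi> l))" for N :: nat and \<xi> 
      using PhiD[OF H, of "\<lambda>_. 1" \<xi> N] by simp
  qed measurable
  also have "(\<integral>x. (\<integral>y. H (x - y) \<partial>\<mu>) \<partial>\<mu>)
     = (\<integral>x. complex_of_real (g s x / c) * (\<integral>y. complex_of_real (g s y / c) * H (x - y) \<partial>?M) \<partial>?M)"
    by (subst int\<mu>, measurable) (simp add: int\<mu>)
  \<comment> \<open>Substitution y = x - z in the inner integral, legitimate for almost every
    x.\<close>
  also have "\<dots> = (\<integral>x. complex_of_real (g s x / c) * (\<integral>z. complex_of_real (g s (x - z) / c) * H z \<partial>?M) \<partial>?M)"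
  proof (rule integral_cong_AE)
    show "AE x in ?M. complex_of_real (g s x / c) * (\<integral>y. complex_of_real (g s y / c) * H (x - y) \<partial>?M) =
      complex_of_real (g s x / c) * (\<integral>z. complex_of_real (g s (x - z) / c) * H z \<partial>?M)"
      using AE_coord_subspace
    proof eventually_elim
      case (elim x)
      show ?case
        by (subst integral_coord_lborel_affine[OF m(2), of "-1" x]) (use elim in auto)
    qed
  qed measurable
  also have "\<dots> = (\<integral>x. (\<integral>z. complex_of_real (g s x * g s (x - z)) * (H z / c\<^sup>2) \<partial>?M) \<partial>?M)"
    by (simp add: power2_eq_square mult_ac flip: integral_mult_right_zero)
  also have "\<dots> = (\<integral>z. (\<integral>x. complex_of_real (g s x * g s (x - z)) * (H z / c\<^sup>2) \<partial>?M) \<partial>?M)"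
  proof (rule MM.Fubini_integral[symmetric])
    have "integrable (?M \<Otimes>\<^sub>M ?M) (\<lambda>(x, z). complex_of_real (g s x) * (H z / c\<^sup>2))"
      using gint[OF s] int by (intro integrable_pair_mult sigma_finite_coord_lborel) auto
    then show "integrable (?M \<Otimes>\<^sub>M ?M) (\<lambda>(x, z). complex_of_real (g s x * g s (x - z)) * (H z / c\<^sup>2))"
    proof (rule Bochner_Integration.integrable_bound, goal_cases)
      case 2
      have "g s x * g s (x - z) * (cmod (H z) / c\<^sup>2) \<le> g s x * 1 * (cmod (H z) / c\<^sup>2)" for x z
        using gpos gle[OF s] by (intro mult_right_mono mult_left_mono) (auto simp: less_imp_le)
      then show ?case using gpos by (auto simp: norm_mult norm_divide norm_power less_imp_le intro!: AE_I2)
    qed measurable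
  qed
  \<comment> \<open>The inner Gaussian is centred at z / 2, so its integral over x does not depend
    on z.\<close>
  also have "\<dots> = (\<integral>z. complex_of_real (integral\<^sup>L ?M (g (2 * s)) / c\<^sup>2) * (H z * complex_of_real (g (s / 2) z)) \<partial>?M)"
  proof (rule integral_cong_AE)
    show "AE z in ?M. (\<integral>x. complex_of_real (g s x * g s (x - z)) * (H z / c\<^sup>2) \<partial>?M)
      = complex_of_real (integral\<^sup>L ?M (g (2 * s)) / c\<^sup>2) * (H z * complex_of_real (g (s / 2) z))"
      using AE_coord_subspace
    proof eventually_elim
      case (elim z)
      have "- ((1/2) *\<^sub>R z) \<in> coord_subspace m" using elim by (simp add: coord_subspace_def)
      then have "integral\<^sup>L ?M (g (2 * s)) = (\<integral>x. g (2 * s) (x - (1/2) *\<^sub>R z) \<partial>?M)"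
        by (subst integral_coord_lborel_affine[OF m(2), of 1 "- ((1/2) *\<^sub>R z)"]) auto
      moreover have "g s x * g s (x - z) = g (2 * s) (x - (1/2) *\<^sub>R z) * g (s / 2) z" for x
        unfolding g_def by (rule gaussian_parallelogram)
      ultimately show ?case
        by simp
    qed
  qed measurable
  finally have *: "0 \<le> complex_of_real (integral\<^sup>L ?M (g (2 * s)) / c\<^sup>2) * (\<integral>z. H z * complex_of_real (g (s / 2) z) \<partial>?M)"
    by simp
  have "0 \<le> complex_of_real (c\<^sup>2 / integral\<^sup>L ?M (g (2 * s))) *
     (complex_of_real (integral\<^sup>L ?M (g (2 * s)) / c\<^sup>2) * (\<integral>z. H z * complex_of_real (g (s / 2) z) \<partial>?M))"
    by (rule complex_nonneg_mult[OF _ *], subst of_real_nonneg_iff) (use Z[of "2 * s"] s in simp)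
  also have "\<dots> = (\<integral>z. H z * complex_of_real (g (s / 2) z) \<partial>?M)"
    using Z[of "2 * s"] s c by (simp add: mult.assoc[symmetric] flip: of_real_mult of_real_divide)
  finally show ?thesis by (simp add: g_def)
qed

text \<open>Removes the Gaussian weight by letting its rate tend to 0, with |H| as dominating
  function.\<close>

lemma integral_Phi_nonneg:
  fixes H :: "real ^ 'd::{finite,linorder} \<Rightarrow> complex"
  assumes m: "1 \<le> m" "m \<le> CARD('d)"
    and H: "H \<in> Phi" and [measurable]: "H \<in> borel_measurable borel" and int: "integrable (coord_lborel m) H"
  shows "0 \<le> (\<integral>z. H z \<partial>coord_lborel m)"
proof (rule complex_nonneg_LIMSEQ)
  show "0 \<le> (\<integral>z. H z * complex_of_real (exp (- ((1 / real (Suc n)) / 2) * (norm z)\<^sup>2)) \<partial>coord_lborel m)" for n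
    by (rule integral_Phi_nonneg_gaussian[OF m _ H]) (auto intro: int)
  show "(\<lambda>n. \<integral>z. H z * complex_of_real (exp (- ((1 / real (Suc n)) / 2) * (norm z)\<^sup>2)) \<partial>coord_lborel m)
    \<longlonglongrightarrow> (\<integral>z. H z \<partial>coord_lborel m)"
  proof (rule integral_dominated_convergence[where w = "\<lambda>z. cmod (H z)"])
    show "AE z in coord_lborel m. (\<lambda>n. H z * complex_of_real (exp (- ((1 / real (Suc n)) / 2) * (norm z)\<^sup>2)))
      \<longlonglongrightarrow> H z"
    proof (intro AE_I2)
      fix z
      have "(\<lambda>n. H z * complex_of_real (exp (- ((1 / real (Suc n)) / 2) * (norm z)\<^sup>2)))
        \<longlonglongrightarrow> H z * complex_of_real (exp (- (0 / 2) * (norm z)\<^sup>2))"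
        by (intro tendsto_intros LIMSEQ_Suc[OF lim_1_over_n]) auto
      then show "(\<lambda>n. H z * complex_of_real (exp (- ((1 / real (Suc n)) / 2) * (norm z)\<^sup>2))) \<longlonglongrightarrow> H z"
        by simp
    qed
    show "AE z in coord_lborel m. norm (H z * complex_of_real (exp (- ((1 / real (Suc n)) / 2) * (norm z)\<^sup>2)))
      \<le> cmod (H z)" for n
      by (auto simp: norm_mult intro!: AE_I2 mult_left_le)
  qed (use int in auto)
qed

text \<open>By Schur's theorem the product with a character is still positive definite, so the case
  of the plain integral applies.\<close>

lemma fourier_Phi_nonneg:
  fixes H :: "real ^ 'd::{finite,linorder} \<Rightarrow> complex"
  assumes m: "1 \<le> m" "m \<le> CARD('d)"
    and H: "H \<in> Phi" and [measurable]: "H \<in> borel_measurable borel" and int: "integrable (coord_lborel m) H"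
  shows "0 \<le> (\<integral>z. H z * exp (\<i> * complex_of_real (z \<bullet> v)) \<partial>coord_lborel m)"
proof (rule integral_Phi_nonneg[OF m])
  show "(\<lambda>z. H z * exp (\<i> * complex_of_real (z \<bullet> v))) \<in> Phi"
    by (rule Phi_mult[OF H Phi_exp_inner])
  show "integrable (coord_lborel m) (\<lambda>z. H z * exp (\<i> * complex_of_real (z \<bullet> v)))"
    by (rule Bochner_Integration.integrable_bound[OF int]) (auto simp: norm_mult)
qed measurable

subsection \<open>The Riemann--Lebesgue lemma\<close>

text \<open>Continuity of translation in L^1 by Scheffe's lemma: pointwise convergence comes from
  continuity of \<open>F\<close>, and translates within the subspace all have the same norm.\<close>

lemma integral_translate_diff_tendsto_0:
  fixes F :: "real ^ 'd::{finite,linorder} \<Rightarrow> complex"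
  assumes m: "m \<le> CARD('d)" and cont: "continuous_on UNIV F" and int: "integrable (coord_lborel m) F"
    and a: "\<And>n. a n \<in> coord_subspace m" "a \<longlonglongrightarrow> 0"
  shows "(\<lambda>n. \<integral>y. cmod (F (a n + y) - F y) \<partial>coord_lborel m) \<longlonglongrightarrow> 0"
proof -
  have [measurable]: "F \<in> borel_measurable borel"
    using cont by (rule borel_measurable_continuous_onI)
  have eq: "(\<integral>\<^sup>+y. norm (F (a n + y)) \<partial>coord_lborel m) = (\<integral>\<^sup>+y. norm (F y) \<partial>coord_lborel m)" for n
    using nn_integral_coord_lborel_affine[OF m _ a(1), of 1 "\<lambda>y. norm (F y)" n] by simp
  have "(\<lambda>n. \<integral>\<^sup>+y. norm (F (a n + y) - F y) \<partial>coord_lborel m) \<longlonglongrightarrow> 0"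
  proof (rule Scheffe_lemma2[OF _ int])
    show "AE y in coord_lborel m. (\<lambda>n. F (a n + y)) \<longlonglongrightarrow> F y"
    proof (intro AE_I2)
      fix y
      have "(\<lambda>n. a n + y) \<longlonglongrightarrow> 0 + y" by (intro tendsto_intros a)
      then show "(\<lambda>n. F (a n + y)) \<longlonglongrightarrow> F y"
        using cont continuous_on_tendsto_compose[of UNIV F "\<lambda>n. a n + y" y sequentially] by simp
    qed
  qed (simp_all add: eq)
  moreover have "(\<integral>\<^sup>+y. norm (F (a n + y) - F y) \<partial>coord_lborel m)
      = ennreal (\<integral>y. cmod (F (a n + y) - F y) \<partial>coord_lborel m)" for n
    using integrable_coord_lborel_affine[OF m, of 1 "a n" F] a(1) int
    by (intro nn_integral_eq_integral) auto
  ultimately have "(\<lambda>n. ennreal (\<integral>y. cmod (F (a n + y) - F y) \<partial>coord_lborel m)) \<longlonglongrightarrow> ennreal 0"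
    by simp
  then show ?thesis by (rule tendsto_ennrealD) auto
qed

text \<open>Shifting by half a period changes the sign of the exponential, so twice the integral is
  an integral of \<open>F y - F (a n + y)\<close> against a unimodular factor, and the shift tends
  to 0.\<close>

lemma Riemann_Lebesgue:
  fixes F :: "real ^ 'd::{finite,linorder} \<Rightarrow> complex"
  assumes m: "m \<le> CARD('d)" and cont: "continuous_on UNIV F" and int: "integrable (coord_lborel m) F"
    and v: "v \<in> coord_subspace m" "v \<noteq> 0"
  shows "((\<lambda>s. \<integral>y. F y * exp (\<i> * complex_of_real (y \<bullet> (s *\<^sub>R v))) \<partial>coord_lborel m) \<longlongrightarrow> 0) at_top"
proof (rule tendsto_at_topI_sequentially)
  fix X :: "nat \<Rightarrow> real" assume X: "filterlim X at_top sequentially"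
  define g where "g s y = F y * exp (\<i> * complex_of_real (y \<bullet> (s *\<^sub>R v)))" for s y
  have [measurable]: "F \<in> borel_measurable borel"
    using cont by (rule borel_measurable_continuous_onI)
  have [measurable]: "g s \<in> borel_measurable borel" for s unfolding g_def by measurable
  \<comment> \<open>Normalized so that the inner product of \<open>a n\<close> with the frequency
    \<open>X n *\<^sub>R v\<close> is pi.\<close>
  define a where "a n = (pi / (X n * (norm v)\<^sup>2)) *\<^sub>R v" for n
  have aV: "a n \<in> coord_subspace m" for n using v by (simp add: a_def coord_subspace_def)
  have "(\<lambda>n. (pi / (norm v)\<^sup>2 * inverse (X n)) *\<^sub>R v) \<longlonglongrightarrow> (pi / (norm v)\<^sup>2 * 0) *\<^sub>R v"
    by (intro tendsto_intros tendsto_inverse_0_at_top X)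
  then have a0: "a \<longlonglongrightarrow> 0" by (simp add: a_def[abs_def] field_simps)
  have gint: "integrable (coord_lborel m) (g s)" for s
    by (rule Bochner_Integration.integrable_bound[OF int]) (auto simp: g_def norm_mult)
  have bound: "cmod (\<integral>y. g (X n) y \<partial>coord_lborel m) \<le> (1/2) * (\<integral>y. cmod (F (a n + y) - F y) \<partial>coord_lborel m)"
    if "X n > 0" for n
  proof -
    have shift: "g (X n) (a n + y) = - (F (a n + y) * exp (\<i> * complex_of_real (y \<bullet> (X n *\<^sub>R v))))" for y
    proof -
      have "a n \<bullet> (X n *\<^sub>R v) = pi"
        using that v by (simp add: a_def power2_norm_eq_inner)
      then show ?thesis
        by (simp add: g_def inner_add_left distrib_left exp_add)
    qed
    have ig: "integrable (coord_lborel m) (\<lambda>y. g (X n) (a n + y))"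
      using integrable_coord_lborel_affine[OF m, of 1 "a n" "g (X n)"] aV gint by simp
    have "(\<integral>y. g (X n) y \<partial>coord_lborel m) = (\<integral>y. g (X n) (a n + y) \<partial>coord_lborel m)"
      using integral_coord_lborel_affine[OF m, of 1 "a n" "g (X n)"] aV by simp
    then have "2 * (\<integral>y. g (X n) y \<partial>coord_lborel m) = (\<integral>y. g (X n) y + g (X n) (a n + y) \<partial>coord_lborel m)"
      using gint ig by simp
    also have "\<dots> = (\<integral>y. (F y - F (a n + y)) * exp (\<i> * complex_of_real (y \<bullet> (X n *\<^sub>R v))) \<partial>coord_lborel m)"
      unfolding shift by (simp add: g_def algebra_simps)
    finally have "cmod (2 * (\<integral>y. g (X n) y \<partial>coord_lborel m))
       \<le> (\<integral>y. cmod ((F y - F (a n + y)) * exp (\<i> * complex_of_real (y \<bullet> (X n *\<^sub>R v)))) \<partial>coord_lborel m)"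
      by simp
    also have "\<dots> = (\<integral>y. cmod (F (a n + y) - F y) \<partial>coord_lborel m)"
      by (simp add: norm_mult norm_minus_commute)
    finally show ?thesis by (simp add: norm_mult)
  qed
  have "(\<lambda>n. \<integral>y. g (X n) y \<partial>coord_lborel m) \<longlonglongrightarrow> 0"
  proof (rule Lim_null_comparison)
    show "\<forall>\<^sub>F n in sequentially. cmod (\<integral>y. g (X n) y \<partial>coord_lborel m)
        \<le> (1/2) * (\<integral>y. cmod (F (a n + y) - F y) \<partial>coord_lborel m)"
      using filterlim_at_top_dense[THEN iffD1, OF X, rule_format, of 0]
      by eventually_elim (rule bound)
    show "(\<lambda>n. (1/2) * (\<integral>y. cmod (F (a n + y) - F y) \<partial>coord_lborel m)) \<longlonglongrightarrow> 0"
      by (intro tendsto_mult_right_zero integral_translate_diff_tendsto_0 m cont int aV a0)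
  qed
  then show "(\<lambda>n. \<integral>y. F y * exp (\<i> * complex_of_real (y \<bullet> (X n *\<^sub>R v))) \<partial>coord_lborel m) \<longlonglongrightarrow> 0"
    by (simp add: g_def)
qed

subsection \<open>Gaussian averages\<close>

text \<open>The standard normal density on R^d, in product form so that integrals factor over the
  coordinates.\<close>

definition gaussian :: "real ^ 'd \<Rightarrow> real" where
  "gaussian v = (\<Prod>i\<in>UNIV. std_normal_density (v $ i))"

lemma gaussian_pos: "0 < gaussian v"
  by (simp add: gaussian_def prod_pos normal_density_pos)

lemma gaussian_measurable [measurable]: "gaussian \<in> borel_measurable borel"
  unfolding gaussian_def[abs_def] by measurable

text \<open>Both claims factor over the coordinates; each factor of the second is the characteristic
  function of the standard normal law at \<open>y $ i\<close>.\<close>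

lemma gaussian_fourier:
  fixes y :: "real ^ 'd::{finite,linorder}"
  shows "integrable lborel (\<lambda>v :: real ^ 'd::{finite,linorder}. gaussian v)"
    and "(\<integral>v. complex_of_real (gaussian v) * exp (\<i> * complex_of_real (y \<bullet> v)) \<partial>lborel)
       = complex_of_real (exp (- (norm y)\<^sup>2 / 2))"
proof -
  interpret product_sigma_finite "\<lambda>_::'d. lborel :: real measure" ..
  let ?Q = "\<Pi>\<^sub>M i\<in>(UNIV :: 'd set). (lborel :: real measure)"
  define f where "f i x = complex_of_real (std_normal_density x) * exp (\<i> * complex_of_real (y $ i * x))" for i x
  have dint: "integrable lborel (\<lambda>x. complex_of_real (std_normal_density x))"
    using integrable_std_normal_moment[of 0] by simp
  have fint: "integrable lborel (f i)" for i
    by (rule Bochner_Integration.integrable_bound[OF dint]) (auto simp: f_def[abs_def] norm_mult)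
  have fval: "integral\<^sup>L lborel (f i) = complex_of_real (exp (- (y $ i)\<^sup>2 / 2))" for i
  proof -
    have "complex_of_real (exp (- (y $ i)\<^sup>2 / 2)) = char std_normal_distribution (y $ i)"
      by (simp add: char_std_normal_distribution)
    also have "\<dots> = integral\<^sup>L lborel (f i)"
      unfolding char_def by (subst integral_density) (auto simp: f_def[abs_def] scaleR_conv_of_real)
    finally show ?thesis by simp
  qed
  have lb: "(lborel :: (real, 'd) vec measure) = distr ?Q borel (embed UNIV)"
    using coord_lborel_UNIV[where 'd = 'd] by (simp add: coord_lborel_def first_coords_UNIV)
  have e: "embed UNIV x $ i = x i" for x and i :: 'd
    using embed_nth[where I = UNIV and y = x and i = i] by simp
  show "integrable lborel (\<lambda>v :: (real, 'd) vec. gaussian v)"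
    unfolding lb by (subst integrable_distr_eq)
      (auto simp: gaussian_def e simp del: sum_component intro!: product_integrable_prod 
         integrable_std_normal_moment[of 0, simplified])
  have prod: "complex_of_real (gaussian (embed UNIV x)) * exp (\<i> * complex_of_real (y \<bullet> embed UNIV x))
      = (\<Prod>i\<in>UNIV. f i (x i))" for x
    by (simp add: gaussian_def e inner_vec_def f_def prod.distrib exp_sum sum_distrib_left del: sum_component)
  have "(\<integral>v. complex_of_real (gaussian v) * exp (\<i> * complex_of_real (y \<bullet> v)) \<partial>lborel)
     = (\<integral>x. (\<Prod>i\<in>UNIV. f i (x i)) \<partial>?Q)"
    unfolding lb by (subst integral_distr) (auto simp: prod)
  also have "\<dots> = (\<Prod>i\<in>UNIV. complex_of_real (exp (- (y $ i)\<^sup>2 / 2)))"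
    by (subst product_integral_prod) (simp_all add: fint fval)
  also have "\<dots> = complex_of_real (exp (\<Sum>i\<in>UNIV. - (y $ i)\<^sup>2 / 2))"
    by (simp add: exp_sum)
  also have "(\<Sum>i\<in>UNIV. - (y $ i)\<^sup>2 / 2) = - (norm y)\<^sup>2 / 2"
    unfolding power2_norm_eq_inner inner_vec_def
    by (simp add: power2_eq_square sum_negf flip: sum_divide_distrib)
  finally show "(\<integral>v. complex_of_real (gaussian v) * exp (\<i> * complex_of_real (y \<bullet> v)) \<partial>lborel)
       = complex_of_real (exp (- (norm y)\<^sup>2 / 2))" .
qed

text \<open>Under the Gaussian measure the linear form \<open>y \<bullet> v\<close> is normally distributed with standard
  deviation \<open>norm y\<close>.\<close>

lemma gaussian_moment:
  fixes y :: "real ^ 'd::{finite,linorder}" and k :: nat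
  defines "c \<equiv> fact (2 * k) / (2 ^ k * fact k) :: real"
  shows "integrable lborel (\<lambda>v. gaussian v * (y \<bullet> v) ^ (2 * k))"
    and "(\<integral>v. gaussian v * (y \<bullet> v) ^ (2 * k) \<partial>lborel) = c * norm y ^ (2 * k)"
proof -
  define \<gamma> where "\<gamma> = density lborel (\<lambda>v :: (real, 'd) vec. ennreal (gaussian v))"
  have [measurable_cong]: "sets \<gamma> = sets borel" by (simp add: \<gamma>_def)
  have sp: "space \<gamma> = UNIV" by (simp add: \<gamma>_def)
  have one: "(\<integral>v. gaussian v \<partial>(lborel :: (real, 'd) vec measure)) = 1"
  proof -
    have "complex_of_real (\<integral>v. gaussian v \<partial>(lborel :: (real, 'd) vec measure)) = 1"
      using gaussian_fourier(2)[of "0 :: (real, 'd) vec"] by simp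
    then show ?thesis by (simp only: of_real_eq_1_iff)
  qed
  have "prob_space \<gamma>"
  proof
    have "emeasure \<gamma> (space \<gamma>) = (\<integral>\<^sup>+v. ennreal (gaussian v) \<partial>(lborel :: (real, 'd) vec measure))"
      unfolding sp by (simp add: \<gamma>_def emeasure_density)
    also have "\<dots> = ennreal (\<integral>v. gaussian v \<partial>(lborel :: (real, 'd) vec measure))"
      using gaussian_fourier(1) by (intro nn_integral_eq_integral) (auto simp: gaussian_pos less_imp_le)
    finally show "emeasure \<gamma> (space \<gamma>) = 1" by (simp add: one)
  qed
  then interpret \<gamma>: prob_space \<gamma> .
  let ?A = "distr \<gamma> borel (\<lambda>v. y \<bullet> v)" and ?B = "distr std_normal_distribution borel (\<lambda>x. norm y * x)"
  \<comment> \<open>Both laws have characteristic function exp(-(t |y|)^2 / 2). The constant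
    \<open>c\<close> is then the moment of order 2k of the standard normal law.\<close>
  have "?A = ?B"
  proof (rule Levy_uniqueness)
    show "real_distribution ?A"
      by (intro real_distribution.intro real_distribution_axioms.intro \<gamma>.prob_space_distr) auto
    interpret N: prob_space std_normal_distribution by (rule prob_space_normal_density) simp
    show "real_distribution ?B"
      by (intro real_distribution.intro real_distribution_axioms.intro N.prob_space_distr) auto
    show "char ?A = char ?B"
    proof
      fix t
      have "char ?A t = (\<integral>v. exp (\<i> * complex_of_real (t * (y \<bullet> v))) \<partial>\<gamma>)"
        unfolding char_def by (subst integral_distr) auto
      also have "\<dots> = (\<integral>v. complex_of_real (gaussian v) * exp (\<i> * complex_of_real ((t *\<^sub>R y) \<bullet> v)) \<partial>lborel)"
        unfolding \<gamma>_def by (subst integral_density) (auto simp: gaussian_pos less_imp_le scaleR_conv_of_real[where 'a = complex])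
      also have "\<dots> = complex_of_real (exp (- (t * norm y)\<^sup>2 / 2))"
        by (subst gaussian_fourier(2)) (simp add: power_mult_distrib)
      also have "\<dots> = char std_normal_distribution (t * norm y)"
        by (simp add: char_std_normal_distribution)
      also have "\<dots> = char ?B t"
        unfolding char_def by (subst integral_distr) (auto simp: mult.assoc)
      finally show "char ?A t = char ?B t" .
    qed
  qed
  have Bint: "integrable ?B (\<lambda>x. x ^ (2 * k))"
    by (subst integrable_distr_eq)
      (auto simp: power_mult_distrib intro!: integrable_mult_right std_normal_distribution_even_moments(2))
  have Bval: "(\<integral>x. x ^ (2 * k) \<partial>?B) = c * norm y ^ (2 * k)"
    by (subst integral_distr) (auto simp: power_mult_distrib c_def std_normal_distribution_even_moments(1))
  have "integrable \<gamma> (\<lambda>v. (y \<bullet> v) ^ (2 * k))"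
    using Bint unfolding \<open>?A = ?B\<close>[symmetric] by (subst (asm) integrable_distr_eq) auto
  then show "integrable lborel (\<lambda>v. gaussian v * (y \<bullet> v) ^ (2 * k))"
    unfolding \<gamma>_def by (subst (asm) integrable_density) (auto simp: gaussian_pos less_imp_le)
  have "c * norm y ^ (2 * k) = (\<integral>v. (y \<bullet> v) ^ (2 * k) \<partial>\<gamma>)"
    unfolding Bval[symmetric] \<open>?A = ?B\<close>[symmetric] by (subst integral_distr) auto
  also have "\<dots> = (\<integral>v. gaussian v * (y \<bullet> v) ^ (2 * k) \<partial>lborel)"
    unfolding \<gamma>_def by (subst integral_density) (auto simp: gaussian_pos less_imp_le)
  finally show "(\<integral>v. gaussian v * (y \<bullet> v) ^ (2 * k) \<partial>lborel) = c * norm y ^ (2 * k)" by simp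
qed

text \<open>A weak form of Fourier inversion. Averaging the vanishing transform over Gaussian
  frequencies shows that \<open>F\<close> integrates to 0 against exp(-|s y|^2 / 2); as s grows,
  this weight concentrates at 0, where \<open>F\<close> is continuous.\<close>

lemma fourier_eq_0_imp:
  fixes F :: "real ^ 'd::{finite,linorder} \<Rightarrow> complex"
  assumes cont: "continuous_on UNIV F" and bound: "\<And>y. cmod (F y) \<le> B" and int: "integrable lborel F"
    and zero: "\<And>v. (\<integral>y. F y * exp (\<i> * complex_of_real (y \<bullet> v)) \<partial>lborel) = 0"
  shows "F 0 = 0"
proof -
  let ?L = "lborel :: (real, 'd) vec measure"
  have [measurable]: "F \<in> borel_measurable borel"
    using cont by (rule borel_measurable_continuous_onI)
  have 1: "(\<integral>y. F y * complex_of_real (exp (- (norm (s *\<^sub>R y))\<^sup>2 / 2)) \<partial>lborel) = 0" for s :: real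
  proof -
    have "(\<integral>y. F y * complex_of_real (exp (- (norm (s *\<^sub>R y))\<^sup>2 / 2)) \<partial>lborel)
       = (\<integral>y. (\<integral>v. F y * (complex_of_real (gaussian v) * exp (\<i> * complex_of_real ((s *\<^sub>R y) \<bullet> v))) \<partial>lborel) \<partial>lborel)"
      by (simp only: integral_mult_right_zero gaussian_fourier(2))
    also have "\<dots> = (\<integral>v. (\<integral>y. F y * (complex_of_real (gaussian v) * exp (\<i> * complex_of_real ((s *\<^sub>R y) \<bullet> v))) \<partial>lborel) \<partial>lborel)"
    proof (rule lborel_pair.Fubini_integral[symmetric])
      have "integrable (?L \<Otimes>\<^sub>M ?L) (\<lambda>(y, v). F y * complex_of_real (gaussian v))"
        using int gaussian_fourier(1) by (intro integrable_pair_mult) (auto intro: lborel.sigma_finite_measure_axioms)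
      then show "integrable (?L \<Otimes>\<^sub>M ?L) (\<lambda>(y, v). F y * (complex_of_real (gaussian v) * exp (\<i> * complex_of_real ((s *\<^sub>R y) \<bullet> v))))"
        by (rule Bochner_Integration.integrable_bound) (auto simp: norm_mult intro!: AE_I2)
    qed
    also have "\<dots> = (\<integral>v. complex_of_real (gaussian v) * (\<integral>y. F y * exp (\<i> * complex_of_real (y \<bullet> (s *\<^sub>R v))) \<partial>lborel) \<partial>lborel)"
      by (simp add: mult_ac flip: integral_mult_right_zero)
    also have "\<dots> = 0" unfolding zero by simp
    finally show ?thesis .
  qed
  \<comment> \<open>Substitution y = z / s with s = n + 1: now the weight is fixed and
    \<open>F\<close> is evaluated ever closer to 0.\<close>
  have 2: "(\<integral>z. F ((1 / real (Suc n)) *\<^sub>R z) * complex_of_real (exp (- (norm z)\<^sup>2 / 2)) \<partial>lborel) = 0" for n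
  proof -
    let ?s = "real (Suc n)"
    have "0 = (\<integral>y. F y * complex_of_real (exp (- (norm (?s *\<^sub>R y))\<^sup>2 / 2)) \<partial>coord_lborel CARD('d))"
      using 1[of ?s] by (simp add: coord_lborel_UNIV)
    also have "\<dots> = ((1 / ?s) ^ CARD('d)) *\<^sub>R (\<integral>z. F ((1 / ?s) *\<^sub>R z) * complex_of_real (exp (- (norm z)\<^sup>2 / 2)) \<partial>coord_lborel CARD('d))"
      by (subst integral_coord_lborel_affine[of "CARD('d)" "1 / ?s" 0]) (auto simp del: of_nat_Suc)
    finally show ?thesis by (simp add: coord_lborel_UNIV del: of_nat_Suc)
  qed
  have gi: "integrable lborel (\<lambda>z :: (real, 'd) vec. exp (- (1/2) * (norm z)\<^sup>2))"
    using integrable_gaussian_moment[of "CARD('d)" "1/2" 0, where 'd = 'd] by (simp add: coord_lborel_UNIV Suc_leI)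
  have "(\<lambda>n. \<integral>z. F ((1 / real (Suc n)) *\<^sub>R z) * complex_of_real (exp (- (norm z)\<^sup>2 / 2)) \<partial>lborel)
     \<longlonglongrightarrow> (\<integral>z. F 0 * complex_of_real (exp (- (norm z)\<^sup>2 / 2)) \<partial>(lborel :: (real, 'd) vec measure))"
  proof (rule integral_dominated_convergence[where w = "\<lambda>z. B * exp (- (1/2) * (norm z)\<^sup>2)"])
    show "integrable lborel (\<lambda>z :: (real, 'd) vec. B * exp (- (1/2) * (norm z)\<^sup>2))"
      using gi by (rule integrable_mult_right)
    show "AE z in lborel. (\<lambda>n. F ((1 / real (Suc n)) *\<^sub>R z) * complex_of_real (exp (- (norm z)\<^sup>2 / 2)))
      \<longlonglongrightarrow> F 0 * complex_of_real (exp (- (norm z)\<^sup>2 / 2))"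
    proof (intro AE_I2 tendsto_intros)
      fix z :: "(real, 'd) vec"
      have "(\<lambda>n. (1 / real (Suc n)) *\<^sub>R z) \<longlonglongrightarrow> 0 *\<^sub>R z"
        by (intro tendsto_intros LIMSEQ_Suc[OF lim_1_over_n])
      then show "(\<lambda>n. F ((1 / real (Suc n)) *\<^sub>R z)) \<longlonglongrightarrow> F 0"
        using continuous_on_tendsto_compose[OF cont, of "\<lambda>n. (1 / real (Suc n)) *\<^sub>R z" 0] by simp
    qed
    show "AE z in lborel. norm (F ((1 / real (Suc n)) *\<^sub>R z) * complex_of_real (exp (- (norm z)\<^sup>2 / 2)))
       \<le> B * exp (- (1/2) * (norm z)\<^sup>2)" for n
      using bound by (auto simp: norm_mult intro!: AE_I2 mult_right_mono)
  qed measurable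
  then have "(\<lambda>n::nat. 0::complex) \<longlonglongrightarrow> F 0 * complex_of_real (\<integral>z. exp (- (1/2) * (norm z)\<^sup>2) \<partial>(lborel :: (real, 'd) vec measure))"
    unfolding 2 by simp
  then have "F 0 * complex_of_real (\<integral>z. exp (- (1/2) * (norm z)\<^sup>2) \<partial>(lborel :: (real, 'd) vec measure)) = 0"
    unfolding LIMSEQ_const_iff by (rule sym)
  moreover have "(\<integral>z. exp (- (1/2) * (norm z)\<^sup>2) \<partial>(lborel :: (real, 'd) vec measure)) > 0"
    using integral_gaussian_pos[of "CARD('d)" "1/2", where 'd = 'd] by (simp only: coord_lborel_UNIV) (simp add: Suc_leI)
  ultimately show ?thesis by (simp only: mult_eq_0_iff of_real_eq_0_iff) simp
qed

subsection \<open>Functions with local power series expansions\<close>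

text \<open>Analyticity on the line, in a form that both sources of expansions deliver: the
  hypothesis \<open>real_analytic\<close> restricted to a line, and exponential moments.\<close>

definition local_power_series :: "(real \<Rightarrow> real) \<Rightarrow> bool" where
  "local_power_series f \<longleftrightarrow>
     (\<forall>s0. \<exists>r>0. \<exists>a. \<forall>s. \<bar>s - s0\<bar> < r \<longrightarrow> (\<lambda>n. a n * (s - s0) ^ n) sums f s)"

lemma local_power_series_isCont:
  assumes "local_power_series f"
  shows "isCont f s0"
proof -
  obtain r a where r: "r > 0" and a: "\<And>s. \<bar>s - s0\<bar> < r \<Longrightarrow> (\<lambda>n. a n * (s - s0) ^ n) sums f s"
    using assms unfolding local_power_series_def by blast
  have "((\<lambda>x. f (x + s0)) \<longlongrightarrow> a 0) (at 0)"
    using a[of "_ + s0"] by (intro powser_limit_0[OF r]) auto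
  moreover have "a 0 = f s0" using a[of s0] r by simp
  ultimately show ?thesis unfolding isCont_def by (simp add: LIM_offset_zero_iff add.commute)
qed

text \<open>The identity theorem by connectedness: the interior of {f = c} is open by construction,
  nonempty by hypothesis, and closed because zeros of a nontrivial power series are
  isolated.\<close>

lemma local_power_series_const:
  assumes f: "local_power_series f" and "a < b" and const: "\<And>s. a < s \<Longrightarrow> s < b \<Longrightarrow> f s = c"
  shows "f s = c"
proof -
  define T where "T = {s. eventually (\<lambda>x. f x = c) (nhds s)}"
  have opn: "open T"
  proof (subst open_subopen, intro ballI)
    fix s assume "s \<in> T"
    then have "eventually (\<lambda>x. x \<in> T) (nhds s)"
      by (simp add: T_def eventually_eventually)
    then show "\<exists>S. open S \<and> s \<in> S \<and> S \<subseteq> T"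
      unfolding eventually_nhds by blast
  qed
  have "closed T"
    unfolding closed_limpt
  proof (intro allI impI)
    fix s0 assume lim: "s0 islimpt T"
    obtain r p where r: "r > 0" and p: "\<And>s. \<bar>s - s0\<bar> < r \<Longrightarrow> (\<lambda>n. p n * (s - s0) ^ n) sums f s"
      using f unfolding local_power_series_def by blast
    have near: "\<exists>x. x \<noteq> s0 \<and> \<bar>x - s0\<bar> < e \<and> f x = c" if e: "e > 0" for e
    proof -
      obtain x where "x \<in> T" "x \<noteq> s0" "dist x s0 < e"
        using lim[unfolded islimpt_approachable, rule_format, OF e] by blast
      then show ?thesis
        by (auto simp: T_def dist_real_def dest: eventually_nhds_x_imp_x)
    qed
    have fs0: "f s0 = c"
    proof (rule ccontr)
      assume ne: "f s0 \<noteq> c"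
      have "eventually (\<lambda>x. f x \<noteq> c) (at s0)"
        using local_power_series_isCont[OF f, of s0] ne unfolding isCont_def by (rule tendsto_imp_eventually_ne)
      then obtain e where "e > 0" "\<And>x. x \<noteq> s0 \<Longrightarrow> dist x s0 < e \<Longrightarrow> f x \<noteq> c"
        unfolding eventually_at by blast
      with near[of e] show False by (auto simp: dist_real_def)
    qed
    have p0: "p m = 0" if "m > 0" for m
    proof (rule ccontr)
      assume "p m \<noteq> 0"
      define q where "q n = (if n = 0 then p 0 - c else p n)" for n
      have "(\<lambda>n. q n * (s - s0) ^ n) sums (f s - c)" if "norm (s - s0) < r" for s
      proof -
        have "(\<lambda>n. p n * (s - s0) ^ n - (if n = 0 then c else 0)) sums (f s - c)"
          using p[of s] that sums_single[of 0 "\<lambda>_. c"] by (intro sums_diff) auto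
        also have "(\<lambda>n. p n * (s - s0) ^ n - (if n = 0 then c else 0)) = (\<lambda>n. q n * (s - s0) ^ n)"
          by (auto simp: q_def fun_eq_iff)
        finally show ?thesis .
      qed
      \<comment> \<open>\<open>q\<close> is the expansion of f - c with q 0 = 0. A nonzero
        coefficient would keep f - c away from 0 in a punctured neighbourhood of \<open>s0\<close>,
        against \<open>near\<close>.\<close>
      from powser_0_nonzero[OF r this, of m] \<open>p m \<noteq> 0\<close> that fs0
      obtain e where e: "e > 0" "\<And>z. z \<in> cball s0 e - {s0} \<Longrightarrow> f z - c \<noteq> 0"
        by (auto simp: q_def)
      from near[OF e(1)] obtain x where "x \<noteq> s0" "\<bar>x - s0\<bar> < e" "f x = c" by blast
      with e(2)[of x] show False by (simp add: dist_real_def abs_minus_commute)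
    qed
    have "f s = c" if "\<bar>s - s0\<bar> < r" for s
    proof -
      have "(\<lambda>n. p n * (s - s0) ^ n) = (\<lambda>n. p n * 0 ^ n)"
        using p0 by (auto simp: fun_eq_iff power_0_left)
      then have "(\<lambda>n. p n * 0 ^ n) sums f s" using p[OF that] by simp
      then have "f s = p 0" using powser_sums_zero[of p] by (rule sums_unique2)
      moreover have "f s0 = p 0" using p[of s0] r by simp
      ultimately show ?thesis using fs0 by simp
    qed
    then show "s0 \<in> T"
      using r by (auto simp: T_def eventually_nhds_metric dist_real_def)
  qed
  moreover have "(a + b) / 2 \<in> T"
    using \<open>a < b\<close> const unfolding T_def eventually_nhds
    by (auto intro!: exI[of _ "{a<..<b}"])
  ultimately have "T = UNIV" using opn by (metis clopen empty_iff)
  then have "eventually (\<lambda>x. f x = c) (nhds s)" by (auto simp: T_def)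
  then show ?thesis by (rule eventually_nhds_x_imp_x)
qed

text \<open>On a line through the origin, a monomial of total degree n becomes a multiple of (s -
  s0)^n; regrouping the unconditionally convergent series by total degree gives a power series in
  one variable.\<close>

lemma real_analytic_line:
  assumes "real_analytic (f :: real ^ 'd \<Rightarrow> complex)"
  shows "local_power_series (\<lambda>s. Re (f (s *\<^sub>R v)))"
  unfolding local_power_series_def
proof
  fix s0
  obtain r c where r: "r > 0" and c: "\<And>x. x \<in> ball (s0 *\<^sub>R v) r \<Longrightarrow>
       ((\<lambda>k. c k * complex_of_real (\<Prod>i\<in>UNIV. (x $ i - (s0 *\<^sub>R v) $ i) ^ k i)) has_sum f x) UNIV"
    using assms[unfolded real_analytic_def, THEN spec, of "s0 *\<^sub>R v"] by (elim exE conjE) (rule that, auto)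
  define D where "D n = {k :: 'd \<Rightarrow> nat. sum k UNIV = n}" for n
  have fin: "finite (D n)" for n
  proof (rule finite_subset)
    show "D n \<subseteq> (\<Pi>\<^sub>E i\<in>UNIV. {..n})"
      unfolding D_def by (auto simp: PiE_iff intro: member_le_sum)
    show "finite (\<Pi>\<^sub>E i\<in>(UNIV :: 'd set). {..n})" by (intro finite_PiE) auto
  qed
  define a where "a n = (\<Sum>k\<in>D n. c k * complex_of_real (\<Prod>i\<in>UNIV. (v $ i) ^ k i))" for n
  \<comment> \<open>The \<open>+ 1\<close> keeps the radius well defined when
    \<open>v = 0\<close>.\<close>
  have sums: "(\<lambda>n. Re (a n) * (s - s0) ^ n) sums Re (f (s *\<^sub>R v))" if s: "\<bar>s - s0\<bar> < r / (norm v + 1)" for s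
  proof -
    define T where "T k = c k * complex_of_real (\<Prod>i\<in>UNIV. (v $ i) ^ k i) * complex_of_real ((s - s0) ^ sum k UNIV)" for k
    have "norm (s *\<^sub>R v - s0 *\<^sub>R v) = \<bar>s - s0\<bar> * norm v"
      unfolding scaleR_diff_left[symmetric] by (rule norm_scaleR)
    also have "\<dots> \<le> \<bar>s - s0\<bar> * (norm v + 1)" by (intro mult_left_mono) auto
    also have "\<dots> < r"
      by (rule pos_less_divide_eq[THEN iffD1, OF _ s]) (simp add: add_nonneg_pos)
    finally have "s *\<^sub>R v \<in> ball (s0 *\<^sub>R v) r" by (simp add: dist_norm norm_minus_commute)
    from c[OF this]
    have "((\<lambda>k. c k * complex_of_real (\<Prod>i\<in>UNIV. ((s - s0) * v $ i) ^ k i)) has_sum f (s *\<^sub>R v)) UNIV"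
      by (simp add: left_diff_distrib)
    also have "(\<lambda>k. c k * complex_of_real (\<Prod>i\<in>UNIV. ((s - s0) * v $ i) ^ k i))
        = (\<lambda>k. c k * complex_of_real (\<Prod>i\<in>UNIV. (v $ i) ^ k i) * complex_of_real ((s - s0) ^ sum k UNIV))"
      by (simp add: power_mult_distrib prod.distrib power_sum mult_ac)
    finally have 1: "(T has_sum f (s *\<^sub>R v)) UNIV" by (simp only: T_def[abs_def])
    have "bij_betw snd (Sigma (UNIV :: nat set) D) UNIV"
      by (rule bij_betwI[where g = "\<lambda>k. (sum k UNIV, k)"]) (auto simp: D_def)
    from has_sum_reindex_bij_betw[OF this, of T] 1
    have 2: "((\<lambda>p. T (snd p)) has_sum f (s *\<^sub>R v)) (Sigma (UNIV :: nat set) D)" by simp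
    have "((\<lambda>n. a n * complex_of_real ((s - s0) ^ n)) has_sum f (s *\<^sub>R v)) UNIV"
    proof (rule has_sum_Sigma[OF _ 2])
      show "uniformly_continuous_on UNIV (\<lambda>(x::complex, y). x + y)"
        by (rule uniformly_continuous_add)
      show "((\<lambda>y. T (snd (n, y))) has_sum a n * complex_of_real ((s - s0) ^ n)) (D n)" for n
        by (rule has_sum_finiteI[OF fin]) (auto simp: T_def a_def sum_distrib_right D_def intro!: sum.cong)
    qed
    then have "(\<lambda>n. a n * complex_of_real ((s - s0) ^ n)) sums f (s *\<^sub>R v)"
      by (rule has_sum_imp_sums)
    then have "(\<lambda>n. Re (a n * complex_of_real ((s - s0) ^ n))) sums Re (f (s *\<^sub>R v))"
      by (rule sums_Re)
    then show ?thesis by simp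
  qed
  show "\<exists>r>0. \<exists>a. \<forall>s. \<bar>s - s0\<bar> < r \<longrightarrow> (\<lambda>n. a n * (s - s0) ^ n) sums Re (f (s *\<^sub>R v))"
    using sums r
    by (intro exI[of _ "r / (norm v + 1)"] conjI exI[of _ "\<lambda>n. Re (a n)"]) (auto simp: add_nonneg_pos)
qed

text \<open>\<open>fourier_moment F v s n\<close> is the \<open>n\<close>-th derivative of the Fourier integral along \<open>v\<close>.\<close>

definition fourier_moment :: "('a::euclidean_space \<Rightarrow> complex) \<Rightarrow> 'a \<Rightarrow> real \<Rightarrow> nat \<Rightarrow> complex" where
  "fourier_moment F v s n = (\<integral>y. F y * exp (\<i> * complex_of_real (s * (y \<bullet> v))) * (\<i> * complex_of_real (y \<bullet> v)) ^ n \<partial>lborel)"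

text \<open>The exponential series in (s - s0) (y \<bullet> v) is integrated term by term; its
  partial sums are dominated by exp(\<delta> |y \<bullet> v|).\<close>

lemma fourier_power_series:
  fixes F :: "'a::euclidean_space \<Rightarrow> complex"
  assumes [measurable]: "F \<in> borel_measurable borel"
    and int: "integrable lborel (\<lambda>y. cmod (F y) * exp (\<delta> * \<bar>y \<bullet> v\<bar>))" and s: "\<bar>s - s0\<bar> \<le> \<delta>"
  shows "(\<lambda>n. fourier_moment F v s0 n / fact n * complex_of_real ((s - s0) ^ n)) sums
      (\<integral>y. F y * exp (\<i> * complex_of_real (s * (y \<bullet> v))) \<partial>lborel)"
proof -
  define e where "e y = \<i> * complex_of_real (y \<bullet> v)" for y
  define t where "t n y = F y * exp (\<i> * complex_of_real (s0 * (y \<bullet> v))) *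
      ((complex_of_real (s - s0) * e y) ^ n / fact n)" for n y
  have [measurable]: "t n \<in> borel_measurable borel" for n
    unfolding t_def[abs_def] e_def by measurable
  have ex: "(\<Sum>n<N. cmod ((complex_of_real (s - s0) * e y) ^ n / fact n)) \<le> exp (\<delta> * \<bar>y \<bullet> v\<bar>)" for N y
  proof -
    have "(\<Sum>n<N. cmod ((complex_of_real (s - s0) * e y) ^ n / fact n))
       = (\<Sum>n<N. (\<bar>s - s0\<bar> * \<bar>y \<bullet> v\<bar>) ^ n /\<^sub>R fact n)"
      by (simp add: e_def norm_divide norm_power norm_mult norm_inverse norm_fact divide_inverse_commute flip: of_real_diff)
    also have "\<dots> \<le> exp (\<bar>s - s0\<bar> * \<bar>y \<bullet> v\<bar>)"
      unfolding exp_def by (rule sum_le_suminf[OF summable_exp_generic]) auto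
    also have "\<dots> \<le> exp (\<delta> * \<bar>y \<bullet> v\<bar>)" using s by (simp add: mult_right_mono)
    finally show ?thesis .
  qed
  have tb: "(\<Sum>n<N. cmod (t n y)) \<le> cmod (F y) * exp (\<delta> * \<bar>y \<bullet> v\<bar>)" for N y
  proof -
    have "(\<Sum>n<N. cmod (t n y)) = cmod (F y) * (\<Sum>n<N. cmod ((complex_of_real (s - s0) * e y) ^ n / fact n))"
      by (simp add: t_def norm_mult norm_divide sum_distrib_left)
    also have "\<dots> \<le> cmod (F y) * exp (\<delta> * \<bar>y \<bullet> v\<bar>)" by (intro mult_left_mono ex) auto
    finally show ?thesis .
  qed
  have tint: "integrable lborel (t n)" for n
  proof (rule Bochner_Integration.integrable_bound[OF int])
    have "cmod (t n y) \<le> (\<Sum>k<Suc n. cmod (t k y))" for y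
      by (intro member_le_sum) auto
    then have "cmod (t n y) \<le> cmod (F y) * exp (\<delta> * \<bar>y \<bullet> v\<bar>)" for y
      using tb[where N = "Suc n"] by (rule order_trans)
    then show "AE y in lborel. norm (t n y) \<le> norm (cmod (F y) * exp (\<delta> * \<bar>y \<bullet> v\<bar>))"
      by (auto intro!: AE_I2)
  qed measurable
  have "(\<lambda>N. \<integral>y. (\<Sum>n<N. t n y) \<partial>lborel) \<longlonglongrightarrow> (\<integral>y. F y * exp (\<i> * complex_of_real (s * (y \<bullet> v))) \<partial>lborel)"
  proof (rule integral_dominated_convergence[OF _ _ int])
    show "AE y in lborel. (\<lambda>N. \<Sum>n<N. t n y) \<longlonglongrightarrow> F y * exp (\<i> * complex_of_real (s * (y \<bullet> v)))"
    proof (intro AE_I2)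
      fix y
      have "(\<lambda>n. (complex_of_real (s - s0) * e y) ^ n /\<^sub>R fact n) sums exp (complex_of_real (s - s0) * e y)"
        by (rule exp_converges)
      then have "(\<lambda>n. F y * exp (\<i> * complex_of_real (s0 * (y \<bullet> v))) * ((complex_of_real (s - s0) * e y) ^ n /\<^sub>R fact n))
         sums (F y * exp (\<i> * complex_of_real (s0 * (y \<bullet> v))) * exp (complex_of_real (s - s0) * e y))"
        by (rule sums_mult)
      also have "(\<lambda>n. F y * exp (\<i> * complex_of_real (s0 * (y \<bullet> v))) * ((complex_of_real (s - s0) * e y) ^ n /\<^sub>R fact n)) = (\<lambda>n. t n y)"
        by (simp add: t_def fun_eq_iff scaleR_conv_of_real divide_inverse_commute)
      also have "F y * exp (\<i> * complex_of_real (s0 * (y \<bullet> v))) * exp (complex_of_real (s - s0) * e y)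
         = F y * exp (\<i> * complex_of_real (s * (y \<bullet> v)))"
        by (simp add: e_def algebra_simps flip: exp_add)
      finally show "(\<lambda>N. \<Sum>n<N. t n y) \<longlonglongrightarrow> F y * exp (\<i> * complex_of_real (s * (y \<bullet> v)))"
        by (simp add: sums_def)
    qed
    show "AE y in lborel. norm (\<Sum>n<N. t n y) \<le> cmod (F y) * exp (\<delta> * \<bar>y \<bullet> v\<bar>)" for N
      by (intro AE_I2 order_trans[OF norm_sum tb])
  qed measurable
  moreover have "(\<integral>y. (\<Sum>n<N. t n y) \<partial>lborel) = (\<Sum>n<N. fourier_moment F v s0 n / fact n * complex_of_real ((s - s0) ^ n))" for N
  proof -
    have "integral\<^sup>L lborel (t n) = fourier_moment F v s0 n / fact n * complex_of_real ((s - s0) ^ n)" for n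
    proof -
      have "integral\<^sup>L lborel (t n) = (\<integral>y. (complex_of_real ((s - s0) ^ n) / fact n) * 
          (F y * exp (\<i> * complex_of_real (s0 * (y \<bullet> v))) * (\<i> * complex_of_real (y \<bullet> v)) ^ n) \<partial>lborel)"
        by (simp add: t_def[abs_def] e_def power_mult_distrib mult_ac)
      also have "\<dots> = fourier_moment F v s0 n / fact n * complex_of_real ((s - s0) ^ n)"
        unfolding fourier_moment_def integral_mult_right_zero by simp
      finally show ?thesis .
    qed
    then show ?thesis using tint by simp
  qed
  ultimately show ?thesis by (simp add: sums_def)
qed

lemma fourier_local_power_series:
  fixes F :: "'a::euclidean_space \<Rightarrow> complex"
  assumes "F \<in> borel_measurable borel" "\<delta> > 0"
    and "integrable lborel (\<lambda>y. cmod (F y) * exp (\<delta> * \<bar>y \<bullet> v\<bar>))"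
  shows "local_power_series (\<lambda>s. Re (\<integral>y. F y * exp (\<i> * complex_of_real (s * (y \<bullet> v))) \<partial>lborel))"
  unfolding local_power_series_def
proof
  fix s0
  have "(\<lambda>n. Re (fourier_moment F v s0 n / fact n) * (s - s0) ^ n) sums
      Re (\<integral>y. F y * exp (\<i> * complex_of_real (s * (y \<bullet> v))) \<partial>lborel)" if "\<bar>s - s0\<bar> < \<delta>" for s
  proof -
    have "Re (z * complex_of_real x) = Re z * x" for z x by simp
    with sums_Re[OF fourier_power_series[OF assms(1,3), of s s0]] that show ?thesis by (simp only: less_imp_le)
  qed
  then show "\<exists>r>0. \<exists>a. \<forall>s. \<bar>s - s0\<bar> < r \<longrightarrow> (\<lambda>n. a n * (s - s0) ^ n) sums
      Re (\<integral>y. F y * exp (\<i> * complex_of_real (s * (y \<bullet> v))) \<partial>lborel)"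
    using assms(2) by (intro exI[of _ \<delta>] conjI exI[of _ "\<lambda>n. Re (fourier_moment F v s0 n / fact n)"]) auto
qed

subsection \<open>Taylor expansion of Fourier integrals at the origin\<close>

text \<open>At even order the derivative in the Lagrange remainder is
  \<open>(-1) ^ p * cos t\<close>, which has an explicit limit as x tends to 0.\<close>

lemma cos_Taylor:
  fixes x :: real
  obtains t where "\<bar>t\<bar> \<le> \<bar>x\<bar>"
    "cos x = (\<Sum>m<2*p. cos_coeff m * x ^ m) + (-1) ^ p * cos t * x ^ (2*p) / fact (2*p)"
proof -
  obtain t where t: "\<bar>t\<bar> \<le> \<bar>x\<bar>"
    "cos x = (\<Sum>m<2*p. cos_coeff m * x ^ m) + (cos (t + 1/2 * real (2*p) * pi) / fact (2*p)) * x ^ (2*p)"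
    using Maclaurin_cos_expansion[of x "2*p"] by blast
  have "cos (t + 1/2 * real (2*p) * pi) = (-1) ^ p * cos t"
    by (simp add: cos_add cos_npi mult.commute)
  with t show ?thesis by (intro that[of t]) auto
qed

definition cos_remainder :: "nat \<Rightarrow> real \<Rightarrow> real" where
  "cos_remainder p x = cos x - (\<Sum>m<2*p. cos_coeff m * x ^ m)"

lemma cos_remainder_bound: "\<bar>cos_remainder p x\<bar> \<le> x ^ (2*p) / fact (2*p)"
proof -
  obtain t where "cos x = (\<Sum>m<2*p. cos_coeff m * x ^ m) + (-1) ^ p * cos t * x ^ (2*p) / fact (2*p)"
    by (rule cos_Taylor)
  then have "\<bar>cos_remainder p x\<bar> = \<bar>cos t\<bar> * (x ^ (2*p) / fact (2*p))"
    by (simp add: cos_remainder_def abs_mult power_abs power_even_abs)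
  also have "\<dots> \<le> 1 * (x ^ (2*p) / fact (2*p))"
    by (intro mult_right_mono) auto
  finally show ?thesis by simp
qed

lemma cos_remainder_limit:
  assumes "s \<longlonglongrightarrow> 0" "\<And>n. s n \<noteq> 0"
  shows "(\<lambda>n. cos_remainder p (s n * x) / s n ^ (2*p)) \<longlonglongrightarrow> (-1) ^ p * x ^ (2*p) / fact (2*p)"
proof -
  have "\<exists>t. \<bar>t\<bar> \<le> \<bar>s n * x\<bar> \<and> cos_remainder p (s n * x) = (-1) ^ p * cos t * (s n * x) ^ (2*p) / fact (2*p)" for n
  proof -
    obtain t where "\<bar>t\<bar> \<le> \<bar>s n * x\<bar>"
      "cos (s n * x) = (\<Sum>m<2*p. cos_coeff m * (s n * x) ^ m) + (-1) ^ p * cos t * (s n * x) ^ (2*p) / fact (2*p)"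
      by (rule cos_Taylor)
    then show ?thesis by (intro exI[of _ t]) (simp only: cos_remainder_def, simp)
  qed
  then obtain t where t: "\<And>n. \<bar>t n\<bar> \<le> \<bar>s n * x\<bar>"
    "\<And>n. cos_remainder p (s n * x) = (-1) ^ p * cos (t n) * (s n * x) ^ (2*p) / fact (2*p)"
    by metis
  have "(\<lambda>n. \<bar>s n * x\<bar>) \<longlonglongrightarrow> \<bar>0 * x\<bar>" by (intro tendsto_intros assms)
  then have t0: "t \<longlonglongrightarrow> 0"
    using t(1) by (intro Lim_null_comparison[of t "\<lambda>n. \<bar>s n * x\<bar>"]) auto
  have "cos_remainder p (s n * x) / s n ^ (2*p) = (-1) ^ p * cos (t n) * x ^ (2*p) / fact (2*p)" for n
    using assms(2)[of n] by (simp add: t(2) power_mult_distrib)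
  moreover have "(\<lambda>n. (-1) ^ p * cos (t n) * x ^ (2*p) / fact (2*p)) \<longlonglongrightarrow> (-1) ^ p * cos 0 * x ^ (2*p) / fact (2*p)"
    by (intro tendsto_intros t0) auto
  ultimately show ?thesis by simp
qed

lemma integral_lborel_uminus:
  fixes f :: "real ^ 'd::{finite,linorder} \<Rightarrow> complex"
  assumes "f \<in> borel_measurable borel"
  shows "(\<integral>y. f (- y) \<partial>lborel) = (\<integral>y. f y \<partial>lborel)"
  using integral_coord_lborel_affine[of "CARD('d)" "-1" 0 f] assms by (simp add: coord_lborel_UNIV)

lemma fourier_even:
  fixes F :: "real ^ 'd::{finite,linorder} \<Rightarrow> complex"
  assumes int: "integrable lborel F" and even: "\<And>y. F (- y) = F y"
  shows "(\<integral>y. F y * exp (\<i> * complex_of_real (y \<bullet> v)) \<partial>lborel) = (\<integral>y. F y * complex_of_real (cos (y \<bullet> v)) \<partial>lborel)"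
proof -
  have [measurable]: "F \<in> borel_measurable borel" using int by simp
  let ?g = "\<lambda>y. F y * exp (\<i> * complex_of_real (y \<bullet> v))"
  have i1: "integrable lborel ?g"
    by (rule Bochner_Integration.integrable_bound[OF int]) (auto simp: norm_mult)
  have i2: "integrable lborel (\<lambda>y. F y * exp (- (\<i> * complex_of_real (y \<bullet> v))))"
    by (rule Bochner_Integration.integrable_bound[OF int]) (auto simp: norm_mult)
  have "(\<integral>y. ?g (- y) \<partial>lborel) = (\<integral>y. ?g y \<partial>lborel)" by (rule integral_lborel_uminus) measurable
  then have "2 * (\<integral>y. ?g y \<partial>lborel) = (\<integral>y. ?g y \<partial>lborel) + (\<integral>y. F y * exp (- (\<i> * complex_of_real (y \<bullet> v))) \<partial>lborel)"
    by (simp add: even)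
  also have "\<dots> = (\<integral>y. ?g y + F y * exp (- (\<i> * complex_of_real (y \<bullet> v))) \<partial>lborel)"
    using i1 i2 by simp
  also have "\<dots> = (\<integral>y. 2 * (F y * complex_of_real (cos (y \<bullet> v))) \<partial>lborel)"
    by (intro Bochner_Integration.integral_cong refl)
      (simp add: cos_exp_eq cos_of_real[symmetric] distrib_left[symmetric] del: cos_of_real)
  also have "\<dots> = 2 * (\<integral>y. F y * complex_of_real (cos (y \<bullet> v)) \<partial>lborel)"
    by (rule integral_mult_right_zero)
  finally show ?thesis by simp
qed

text \<open>The bound |y|^m \<le> 1 + |y|^q combines the two integrability hypotheses.\<close>

lemma integrable_moment_le:
  fixes F :: "'a::euclidean_space \<Rightarrow> complex"
  assumes int: "integrable lborel F" "integrable lborel (\<lambda>y. cmod (F y) * norm y ^ q)" and "m \<le> q"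
  shows "integrable lborel (\<lambda>y. F y * complex_of_real ((y \<bullet> v) ^ m))"
proof (rule Bochner_Integration.integrable_bound)
  have [measurable]: "F \<in> borel_measurable borel" using int by simp
  show "(\<lambda>y. F y * complex_of_real ((y \<bullet> v) ^ m)) \<in> borel_measurable lborel" by measurable
  show "integrable lborel (\<lambda>y. (cmod (F y) + cmod (F y) * norm y ^ q) * norm v ^ m)"
    using int by (intro integrable_mult_left Bochner_Integration.integrable_add) auto
  show "AE y in lborel. norm (F y * complex_of_real ((y \<bullet> v) ^ m)) \<le> norm ((cmod (F y) + cmod (F y) * norm y ^ q) * norm v ^ m)"
  proof (intro AE_I2)
    fix y :: 'a
    have 1: "norm y ^ m \<le> 1 + norm y ^ q"
    proof (cases "norm y \<le> 1")
      case True
      then have "norm y ^ m \<le> 1" by (intro power_le_one) auto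
      then show ?thesis by (rule order_trans) simp
    next
      case False
      then have "norm y ^ m \<le> norm y ^ q" by (intro power_increasing[OF \<open>m \<le> q\<close>]) auto
      then show ?thesis by simp
    qed
    have "\<bar>y \<bullet> v\<bar> ^ m \<le> (norm y * norm v) ^ m"
      by (intro power_mono Cauchy_Schwarz_ineq2) auto
    then have "\<bar>y \<bullet> v\<bar> ^ m \<le> (1 + norm y ^ q) * norm v ^ m"
      unfolding power_mult_distrib by (rule order_trans[OF _ mult_right_mono[OF 1]]) simp
    then have "cmod (F y) * \<bar>y \<bullet> v\<bar> ^ m \<le> cmod (F y) * ((1 + norm y ^ q) * norm v ^ m)"
      by (intro mult_left_mono) auto
    then show "norm (F y * complex_of_real ((y \<bullet> v) ^ m)) \<le> norm ((cmod (F y) + cmod (F y) * norm y ^ q) * norm v ^ m)"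
      by (simp add: norm_mult norm_power power_abs algebra_simps)
  qed
qed

text \<open>By evenness the exponential may be replaced by a cosine. Its Taylor polynomial of degree
  below 2p integrates to the integral of \<open>F\<close>: odd coefficients are 0 and the
  intermediate even moments vanish. The remainder divided by s^(2p) is dominated by |F| (y \<bullet>
  v)^(2p).\<close>

lemma fourier_Taylor:
  fixes F :: "real ^ 'd::{finite,linorder} \<Rightarrow> complex"
  assumes int: "integrable lborel F" "integrable lborel (\<lambda>y. cmod (F y) * norm y ^ (2 * p))"
    and even: "\<And>y. F (- y) = F y" and p: "p \<ge> 1"
    and zero: "\<And>k. 1 \<le> k \<Longrightarrow> k < p \<Longrightarrow> (\<integral>y. F y * complex_of_real ((y \<bullet> v) ^ (2 * k)) \<partial>lborel) = 0"
    and s: "s \<longlonglongrightarrow> 0" "\<And>n. s n \<noteq> 0"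
  shows "(\<lambda>n. ((\<integral>y. F y * exp (\<i> * complex_of_real (y \<bullet> (s n *\<^sub>R v))) \<partial>lborel) - integral\<^sup>L lborel F)
        / complex_of_real (s n ^ (2 * p)))
     \<longlonglongrightarrow> (-1) ^ p / fact (2 * p) * (\<integral>y. F y * complex_of_real ((y \<bullet> v) ^ (2 * p)) \<partial>lborel)"
proof -
  have [measurable]: "F \<in> borel_measurable borel" using int by simp
  have [measurable]: "cos_remainder p \<in> borel_measurable borel"
    unfolding cos_remainder_def[abs_def] by measurable
  have imom: "integrable lborel (\<lambda>y. F y * complex_of_real ((y \<bullet> v) ^ m))" if "m \<le> 2 * p" for m
    using integrable_moment_le[OF int that] .
  have expand: "(\<integral>y. F y * exp (\<i> * complex_of_real (y \<bullet> (t *\<^sub>R v))) \<partial>lborel) - integral\<^sup>L lborel F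
     = (\<integral>y. F y * complex_of_real (cos_remainder p (t * (y \<bullet> v))) \<partial>lborel)" for t
  proof -
    have i: "integrable lborel (\<lambda>y. F y * complex_of_real (cos_coeff m * (t * (y \<bullet> v)) ^ m))" if "m < 2 * p" for m
      using integrable_mult_right[OF imom[of m], of "complex_of_real (cos_coeff m * t ^ m)"] that
      by (simp add: power_mult_distrib mult_ac)
    have ci: "integrable lborel (\<lambda>y. F y * complex_of_real (cos (y \<bullet> (t *\<^sub>R v))))"
      by (rule Bochner_Integration.integrable_bound[OF int(1)]) (auto simp: norm_mult mult_left_le)
    have m0: "(\<integral>y. F y * complex_of_real (cos_coeff m * (t * (y \<bullet> v)) ^ m) \<partial>lborel)
        = (if m = 0 then integral\<^sup>L lborel F else 0)" if "m < 2 * p" for m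
    proof (cases "even m")
      case True
      then obtain k where k: "m = 2 * k" by blast
      have "(\<integral>y. F y * complex_of_real (cos_coeff m * (t * (y \<bullet> v)) ^ m) \<partial>lborel)
         = (\<integral>y. complex_of_real (cos_coeff m * t ^ m) * (F y * complex_of_real ((y \<bullet> v) ^ m)) \<partial>lborel)"
        by (simp add: power_mult_distrib mult_ac)
      also have "\<dots> = complex_of_real (cos_coeff m * t ^ m) * (\<integral>y. F y * complex_of_real ((y \<bullet> v) ^ m) \<partial>lborel)"
        by (rule integral_mult_right_zero)
      finally show ?thesis using zero[of k] that k by (cases "k = 0") auto
    next
      case False
      then show ?thesis by (auto simp: cos_coeff_def)
    qed
    have "(\<integral>y. F y * complex_of_real (cos_remainder p (t * (y \<bullet> v))) \<partial>lborel)
       = (\<integral>y. F y * complex_of_real (cos (y \<bullet> (t *\<^sub>R v))) - (\<Sum>m<2*p. F y * complex_of_real (cos_coeff m * (t * (y \<bullet> v)) ^ m)) \<partial>lborel)"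
      by (simp add: cos_remainder_def right_diff_distrib sum_distrib_left)
    also have "\<dots> = (\<integral>y. F y * complex_of_real (cos (y \<bullet> (t *\<^sub>R v))) \<partial>lborel)
        - (\<Sum>m<2*p. (\<integral>y. F y * complex_of_real (cos_coeff m * (t * (y \<bullet> v)) ^ m) \<partial>lborel))"
      using i ci by (subst Bochner_Integration.integral_diff) (auto intro!: Bochner_Integration.integrable_sum Bochner_Integration.integral_sum)
    also have "(\<Sum>m<2*p. (\<integral>y. F y * complex_of_real (cos_coeff m * (t * (y \<bullet> v)) ^ m) \<partial>lborel))
        = (\<Sum>m<2*p. if m = 0 then integral\<^sup>L lborel F else 0)"
      by (intro sum.cong refl m0) auto
    also have "\<dots> = integral\<^sup>L lborel F" using p by simp
    finally show ?thesis by (simp only: fourier_even[OF int(1) even])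
  qed
  have "(\<lambda>n. \<integral>y. F y * complex_of_real (cos_remainder p (s n * (y \<bullet> v)) / s n ^ (2*p)) \<partial>lborel)
     \<longlonglongrightarrow> (\<integral>y. F y * complex_of_real ((-1) ^ p * (y \<bullet> v) ^ (2*p) / fact (2*p)) \<partial>lborel)"
  proof (rule integral_dominated_convergence)
    show "integrable lborel (\<lambda>y. cmod (F y * complex_of_real ((y \<bullet> v) ^ (2*p))))"
      using imom[of "2*p"] by (intro integrable_norm) simp
    show "AE y in lborel. (\<lambda>n. F y * complex_of_real (cos_remainder p (s n * (y \<bullet> v)) / s n ^ (2*p)))
       \<longlonglongrightarrow> F y * complex_of_real ((-1) ^ p * (y \<bullet> v) ^ (2*p) / fact (2*p))"
      by (intro AE_I2 tendsto_mult_left tendsto_of_real cos_remainder_limit s)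
    show "AE y in lborel. norm (F y * complex_of_real (cos_remainder p (s n * (y \<bullet> v)) / s n ^ (2*p)))
        \<le> cmod (F y * complex_of_real ((y \<bullet> v) ^ (2*p)))" for n
    proof (intro AE_I2)
      fix y
      have "\<bar>cos_remainder p (s n * (y \<bullet> v))\<bar> \<le> (s n * (y \<bullet> v)) ^ (2*p) / fact (2*p)"
        by (rule cos_remainder_bound)
      also have "\<dots> \<le> (s n * (y \<bullet> v)) ^ (2*p)"
        using divide_left_mono[of 1 "fact (2*p)" "(s n * (y \<bullet> v)) ^ (2*p)"] by simp
      finally have "\<bar>cos_remainder p (s n * (y \<bullet> v)) / s n ^ (2*p)\<bar> \<le> (y \<bullet> v) ^ (2*p)"
      proof -
        assume *: "\<bar>cos_remainder p (s n * (y \<bullet> v))\<bar> \<le> (s n * (y \<bullet> v)) ^ (2*p)"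
        have "s n ^ (2*p) > 0" using s(2)[of n] by (simp add: zero_less_power_eq)
        with * show ?thesis
          by (simp only: abs_divide abs_of_pos pos_divide_le_eq power_mult_distrib mult.commute)
      qed
      then show "norm (F y * complex_of_real (cos_remainder p (s n * (y \<bullet> v)) / s n ^ (2*p)))
        \<le> cmod (F y * complex_of_real ((y \<bullet> v) ^ (2*p)))"
        unfolding norm_mult norm_of_real by (intro mult_left_mono) (auto simp del: of_real_divide)
    qed
  qed measurable
  also have "(\<lambda>n. \<integral>y. F y * complex_of_real (cos_remainder p (s n * (y \<bullet> v)) / s n ^ (2*p)) \<partial>lborel)
     = (\<lambda>n. (\<integral>y. F y * complex_of_real (cos_remainder p (s n * (y \<bullet> v))) \<partial>lborel) / complex_of_real (s n ^ (2*p)))"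
    by (simp add: fun_eq_iff)
  also have "(\<integral>y. F y * complex_of_real ((-1) ^ p * (y \<bullet> v) ^ (2*p) / fact (2*p)) \<partial>lborel)
    = (\<integral>y. ((-1) ^ p / fact (2 * p)) * (F y * complex_of_real ((y \<bullet> v) ^ (2*p))) \<partial>lborel)"
    by (simp add: mult_ac)
  also have "\<dots> = (-1) ^ p / fact (2 * p) * (\<integral>y. F y * complex_of_real ((y \<bullet> v) ^ (2 * p)) \<partial>lborel)"
    by (rule integral_mult_right_zero)
  finally show ?thesis by (simp only: expand)
qed

text \<open>With w_n = z_n / n, the error n (ln (1 + w_n) - w_n) in the exponent is at most 2 |z_n
  w_n| for large n, hence tends to 0.\<close>

lemma tendsto_exp_limit_seq:
  fixes z :: "nat \<Rightarrow> real"
  assumes z: "z \<longlonglongrightarrow> l"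
  shows "(\<lambda>n. (1 + z n / real n) ^ n) \<longlonglongrightarrow> exp l"
proof -
  define w where "w n = z n / real n" for n
  have "(\<lambda>n. z n * (1 / real n)) \<longlonglongrightarrow> l * 0" by (intro tendsto_intros z lim_1_over_n)
  then have w0: "w \<longlonglongrightarrow> 0" by (simp add: w_def[abs_def])
  have small: "\<forall>\<^sub>F n in sequentially. n > 0 \<and> \<bar>w n\<bar> \<le> 1/2"
    using eventually_conj[OF eventually_gt_at_top[of 0] tendstoD[OF w0, of "1/2"]]
    by (auto elim: eventually_mono)
  have "(\<lambda>n. real n * (ln (1 + w n) - w n)) \<longlonglongrightarrow> 0"
  proof (rule Lim_null_comparison)
    show "\<forall>\<^sub>F n in sequentially. norm (real n * (ln (1 + w n) - w n)) \<le> 2 * \<bar>z n * w n\<bar>"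
      using small
    proof eventually_elim
      case (elim n)
      then have "\<bar>ln (1 + w n) - w n\<bar> \<le> 2 * (w n)\<^sup>2"
        by (intro abs_ln_one_plus_x_minus_x_bound) auto
      then have "real n * \<bar>ln (1 + w n) - w n\<bar> \<le> real n * (2 * (w n)\<^sup>2)" by (intro mult_left_mono) auto
      also have "\<dots> = 2 * \<bar>real n * w n * w n\<bar>" by (simp add: abs_mult power2_eq_square)
      also have "real n * w n = z n" using elim by (simp add: w_def)
      finally show ?case by (simp add: abs_mult)
    qed
    have "(\<lambda>n. 2 * \<bar>z n * w n\<bar>) \<longlonglongrightarrow> 2 * \<bar>l * 0\<bar>" by (intro tendsto_intros z w0)
    then show "(\<lambda>n. 2 * \<bar>z n * w n\<bar>) \<longlonglongrightarrow> 0" by simp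
  qed
  from tendsto_exp[OF tendsto_add[OF this z]]
  have "(\<lambda>n. exp (real n * (ln (1 + w n) - w n) + z n)) \<longlonglongrightarrow> exp l" by simp
  moreover have "\<forall>\<^sub>F n in sequentially. exp (real n * (ln (1 + w n) - w n) + z n) = (1 + z n / real n) ^ n"
    using small
  proof eventually_elim
    case (elim n)
    then have "real n * (ln (1 + w n) - w n) + z n = real n * ln (1 + w n)"
      by (simp add: w_def right_diff_distrib)
    moreover have "1 + w n > 0" using elim by auto
    ultimately show ?case by (simp add: exp_of_nat_mult w_def)
  qed
  ultimately show ?thesis by (rule Lim_transform_eventually)
qed

subsection \<open>Monotonicity of the scaled transforms\<close>

lemma C_findim_line:
  fixes h :: "'e::real_vector \<Rightarrow> 'b::topological_space"
  assumes h: "h \<in> C_findim S" and B: "finite B" "independent B" "span B = S" and t: "t \<in> S"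
  shows "continuous_on UNIV (\<lambda>u. h (u *\<^sub>R t))"
proof -
  obtain c where c: "t = (\<Sum>b\<in>B. c b *\<^sub>R b)"
    using t B span_finite[OF B(1)] by auto
  have "continuous_map (powertop_real B) euclidean (\<lambda>x. h (\<Sum>b\<in>B. x b *\<^sub>R b))"
    using h B unfolding C_findim_def by auto
  moreover have "continuous_map (euclidean :: real topology) (powertop_real B) (\<lambda>u. \<lambda>b\<in>B. u * c b)"
    unfolding continuous_map_componentwise by (auto intro!: continuous_intros)
  ultimately have "continuous_map euclidean euclidean ((\<lambda>x. h (\<Sum>b\<in>B. x b *\<^sub>R b)) \<circ> (\<lambda>u. \<lambda>b\<in>B. u * c b))"
    by (rule continuous_map_compose[rotated])
  also have "(\<lambda>x. h (\<Sum>b\<in>B. x b *\<^sub>R b)) \<circ> (\<lambda>u. \<lambda>b\<in>B. u * c b) = (\<lambda>u. h (u *\<^sub>R t))"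
    by (simp add: c o_def scaleR_sum_right)
  finally show ?thesis by simp
qed

text \<open>The form in which continuity of \<open>h\<close> enters the intermediate value
  argument.\<close>

lemma C_space_line:
  fixes h :: "'e::real_vector \<Rightarrow> 'b::topological_space"
  assumes "h \<in> C_space"
  shows "continuous_on UNIV (\<lambda>u. h (u *\<^sub>R t))"
proof (cases "\<exists>B::'e set. finite B \<and> span B = UNIV")
  case True
  then obtain B :: "'e set" where B: "finite B" "span B = UNIV" by blast
  \<comment> \<open>\<open>C_findim\<close> speaks of bases, while finite dimension is expressed by
    a spanning set; a basis is extracted from it.\<close>
  obtain B' where B': "B' \<subseteq> B" "independent B'" "B \<subseteq> span B'"
    using maximal_independent_subset[of B] by blast
  have "span B' = UNIV"
    using span_minimal[OF B'(3) subspace_span] B(2) by blast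
  moreover have "finite B'" using B' B finite_subset by blast
  moreover have "h \<in> C_findim UNIV" using assms True by (simp add: C_space_def)
  ultimately show ?thesis using B' by (intro C_findim_line[of h UNIV B']) auto
next
  case False
  show ?thesis
  \<comment> \<open>For t = 0 the set {t} is not a basis of its span.\<close>
  proof (cases "t = 0")
    case True then show ?thesis by simp
  next
    case t: False
    have h: "h \<in> C_findim (span {t})"
      using assms False unfolding C_space_def by (auto intro: exI[of _ "{t}"])
    show ?thesis
      by (rule C_findim_line[OF h, of "{t}"]) (use t in \<open>auto simp: span_base\<close>)
  qed
qed

section \<open>The kernel and its partial Fourier transforms\<close>

locale scaled_kernel = gauge \<rho> for \<rho> :: "real ^ 'd::{finite,linorder} \<Rightarrow> real" +
  fixes h :: "'e::real_vector \<Rightarrow> real" and \<phi> :: "real \<Rightarrow> complex" and d :: nat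
  assumes d: "d = CARD('d)"
    and h_cont: "h \<in> C_space"
    and h_pos: "\<And>t. h t > 0"
    and h_nonconst: "\<not> (\<forall>t. h t = h 0)"
    and phi_cont: "continuous_on {0..} \<phi>"
    and phi_pos: "\<phi> 0 > 0"
    and K: "(\<lambda>(x, t). complex_of_real (h t powr (- real d / 2)) * \<phi> ((\<rho> x)\<^sup>2 / h t)) \<in> Phi"
begin

definition F :: "(real, 'd) vec \<Rightarrow> complex" where "F y = \<phi> ((\<rho> y)\<^sup>2)"

lemma d_pos: "1 \<le> d" by (simp add: d Suc_leI)

lemma F_cont: "continuous_on UNIV F"
  unfolding F_def[abs_def]
  by (rule continuous_on_compose2[OF phi_cont]) (auto intro!: continuous_intros rho_cont)

lemma F_measurable [measurable]: "F \<in> borel_measurable borel"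
  using F_cont by (rule borel_measurable_continuous_onI)

lemma F_minus: "F (- y) = F y"
  by (simp add: F_def rho_minus)

lemma F_zero: "F 0 = \<phi> 0"
  by (simp add: F_def)

text \<open>Homogeneity moves \<open>h t\<close> inside \<open>\<rho>\<close>: for fixed t the
  kernel is a dilate of \<open>F\<close> by the factor sqrt (h t).\<close>

lemma K': "(\<lambda>(x, t). complex_of_real (h t powr (- real d / 2)) * F ((1 / sqrt (h t)) *\<^sub>R x)) \<in> Phi"
proof -
  have "(\<rho> x)\<^sup>2 / h t = (\<rho> ((1 / sqrt (h t)) *\<^sub>R x))\<^sup>2" for x t
    using h_pos[of t] by (simp add: rho_hom power_mult_distrib power_divide)
  then show ?thesis using K by (simp add: F_def)
qed

text \<open>At x = 0 the kernel is \<open>\<phi> 0\<close> times this function, and the positive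
  number \<open>\<phi> 0\<close> can be divided out.\<close>

lemma h_powr_Phi: "(\<lambda>t. complex_of_real (h t powr (- real d / 2))) \<in> Phi"
proof -
  have "(\<lambda>t. case (0, t) of (x, t) \<Rightarrow> complex_of_real (h t powr (- real d / 2)) * F ((1 / sqrt (h t)) *\<^sub>R x)) \<in> Phi"
    by (rule Phi_comp_linear[OF K']) simp
  then have "(\<lambda>t. (1 / \<phi> 0) * (complex_of_real (h t powr (- real d / 2)) * F 0)) \<in> Phi"
    using phi_pos by (intro Phi_scale) (auto simp: less_complex_def less_eq_complex_def Re_divide Im_divide)
  then show ?thesis using phi_pos by (simp add: F_zero less_complex_def mult.commute)
qed

text \<open>At t = 0 the kernel is a positive multiple of a dilate of \<open>F\<close>; composing
  with multiplication by sqrt (h 0) undoes the dilation.\<close>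

lemma F_Phi: "F \<in> Phi"
proof -
  have "(\<lambda>x. case (sqrt (h 0) *\<^sub>R x, 0) of (x, t) \<Rightarrow> complex_of_real (h t powr (- real d / 2)) * F ((1 / sqrt (h t)) *\<^sub>R x)) \<in> Phi"
    by (rule Phi_comp_linear[OF K']) (simp add: scaleR_diff_right)
  moreover define c where "c = h 0 powr (- real d / 2)"
  have c: "c > 0" using h_pos[of 0] by (simp add: c_def)
  ultimately have "(\<lambda>x. complex_of_real c * F x) \<in> Phi"
    using h_pos[of 0] by (simp add: c_def)
  then have "(\<lambda>x. complex_of_real (1 / c) * (complex_of_real c * F x)) \<in> Phi"
    by (rule Phi_scale) (use c in \<open>auto simp: less_eq_complex_def\<close>)
  moreover have "complex_of_real (1 / c) * (complex_of_real c * F x) = F x" for x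
    using c by simp
  ultimately show ?thesis by (simp only:)
qed

lemma F_bound: "cmod (F y) \<le> Re (F 0)"
  by (rule Phi_norm_le[OF F_Phi])

text \<open>The positive definite function h^(-d/2) is largest at 0, and the exponent is negative
  because \<open>d \<ge> 1\<close>.\<close>

lemma h_ge: "h 0 \<le> h t"
proof (rule ccontr)
  assume "\<not> h 0 \<le> h t"
  then have "h 0 powr (- real d / 2) < h t powr (- real d / 2)"
    using h_pos[of t] d_pos by (intro powr_less_mono2_neg) auto
  with Phi_norm_le[OF h_powr_Phi, of t] show False by simp
qed

text \<open>The function f_{m,v} of the theorem; the integer power is used because m - d is negative
  or zero in the range of interest.\<close>

definition scaled_G :: "nat \<Rightarrow> (real, 'd) vec \<Rightarrow> real \<Rightarrow> complex" where
  "scaled_G m v s = complex_of_real (s powi (int m - int d)) * G \<phi> \<rho> m (s *\<^sub>R v)"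

lemma G_F: "G \<phi> \<rho> m v = (\<integral>y. F y * exp (\<i> * complex_of_real (y \<bullet> v)) \<partial>coord_lborel m)"
  by (simp add: G_def F_def)

context
  fixes m :: nat
  assumes m: "1 \<le> m" "m \<le> CARD('d)" and int: "integrable (coord_lborel m) F"
begin

lemma integrable_F_scaled: "c \<noteq> 0 \<Longrightarrow> integrable (coord_lborel m) (\<lambda>x. F (c *\<^sub>R x))"
  using integrable_coord_lborel_affine[OF m(2), of c 0 F] int by simp

text \<open>Substituting x = r y with r = sqrt (h t) contributes r^m, which combines with h^(-d/2) =
  r^(-d).\<close>

lemma kernel_fourier:
  "(\<integral>x. complex_of_real (h t powr (- real d / 2)) * F ((1 / sqrt (h t)) *\<^sub>R x)
        * exp (\<i> * complex_of_real (x \<bullet> v)) \<partial>coord_lborel m) = scaled_G m v (sqrt (h t))"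
proof -
  define r where "r = sqrt (h t)"
  have r: "r > 0" using h_pos[of t] by (simp add: r_def)
  have "h t powr (- real d / 2) = r powr (- real d)"
    using h_pos[of t] by (simp add: r_def powr_half_sqrt[symmetric] powr_powr)
  also have "\<dots> = r powi (- int d)"
    using powr_real_of_int'[of r "- int d"] r by simp
  finally have pw: "h t powr (- real d / 2) = r powi (- int d)" .
  have "(\<integral>x. complex_of_real (h t powr (- real d / 2)) * F ((1 / sqrt (h t)) *\<^sub>R x)
        * exp (\<i> * complex_of_real (x \<bullet> v)) \<partial>coord_lborel m)
     = complex_of_real (r powi (- int d)) * (\<integral>x. F ((1 / r) *\<^sub>R x) * exp (\<i> * complex_of_real (x \<bullet> v)) \<partial>coord_lborel m)"
    unfolding pw r_def[symmetric] mult.assoc by (rule integral_mult_right_zero)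
  also have "(\<integral>x. F ((1 / r) *\<^sub>R x) * exp (\<i> * complex_of_real (x \<bullet> v)) \<partial>coord_lborel m)
     = complex_of_real (r ^ m) * G \<phi> \<rho> m (r *\<^sub>R v)"
    using r by (subst integral_coord_lborel_affine[OF m(2), of r 0])
      (auto simp: G_F scaleR_conv_of_real[where 'a = complex])
  also have "complex_of_real (r powi (- int d)) * (complex_of_real (r ^ m) * G \<phi> \<rho> m (r *\<^sub>R v))
     = scaled_G m v r"
  proof -
    have "r powi (int m - int d) = r powi (- int d) * r ^ m"
      using r by (simp add: power_int_diff power_int_minus field_simps)
    then show ?thesis by (simp add: scaled_G_def mult.assoc)
  qed
  finally show ?thesis by (simp add: r_def)
qed

text \<open>For fixed points and coefficients in E, the quadratic form of the kernel in t is itself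
  a positive definite function \<open>H\<close> of x. Its Fourier integral is therefore nonnegative,
  and by linearity it is the quadratic form to be estimated.\<close>

lemma scaled_G_Phi: "(\<lambda>t. scaled_G m v (sqrt (h t))) \<in> Phi"
proof (rule PhiI)
  fix n :: nat and \<xi> :: "nat \<Rightarrow> 'e" and a :: "nat \<Rightarrow> complex"
  define k where "k x t = complex_of_real (h t powr (- real d / 2)) * F ((1 / sqrt (h t)) *\<^sub>R x)" for x t
  have k: "(\<lambda>p. k (fst p) (snd p)) \<in> Phi" using K' by (simp only: k_def case_prod_beta')
  define H where "H x = (\<Sum>i<n. \<Sum>j<n. a i * k x (\<xi> i - \<xi> j) * cnj (a j))" for x
  have [measurable]: "(\<lambda>x. k x t) \<in> borel_measurable borel" for t unfolding k_def by measurable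
  have H: "H \<in> Phi"
  proof (rule PhiI)
    fix N :: nat and x :: "nat \<Rightarrow> (real, 'd) vec" and b :: "nat \<Rightarrow> complex"
    have S: "(\<Sum>p\<in>A \<times> B. f p) = (\<Sum>u\<in>A. \<Sum>i\<in>B. f (u, i))"
      for A B :: "nat set" and f :: "nat \<times> nat \<Rightarrow> complex"
      by (subst sum.cartesian_product) simp
    \<comment> \<open>Positive definiteness on the product space at the points (x u, \<xi> i) with
      coefficients b u * a i.\<close>
    have "0 \<le> (\<Sum>p\<in>{..<N} \<times> {..<n}. \<Sum>q\<in>{..<N} \<times> {..<n}.
       (b (fst p) * a (snd p)) * k (fst ((x (fst p), \<xi> (snd p)) - (x (fst q), \<xi> (snd q))))
          (snd ((x (fst p), \<xi> (snd p)) - (x (fst q), \<xi> (snd q)))) * cnj (b (fst q) * a (snd q)))"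
      by (rule Phi_finite[OF k]) auto
    also have "\<dots> = (\<Sum>u<N. \<Sum>i<n. \<Sum>w<N. \<Sum>j<n. (b u * a i) * k (x u - x w) (\<xi> i - \<xi> j) * cnj (b w * a j))"
      by (simp only: S fst_conv snd_conv fst_diff snd_diff)
    also have "\<dots> = (\<Sum>u<N. \<Sum>w<N. \<Sum>i<n. \<Sum>j<n. (b u * a i) * k (x u - x w) (\<xi> i - \<xi> j) * cnj (b w * a j))"
      by (intro sum.cong refl sum.swap)
    also have "\<dots> = (\<Sum>u<N. \<Sum>w<N. b u * H (x u - x w) * cnj (b w))"
      by (simp add: H_def sum_distrib_left sum_distrib_right mult_ac)
    finally show "0 \<le> (\<Sum>u<N. \<Sum>w<N. b u * H (x u - x w) * cnj (b w))" .
  qed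
  have kint: "integrable (coord_lborel m) (\<lambda>x. k x t)" for t
    unfolding k_def using h_pos[of t] by (intro integrable_mult_right integrable_F_scaled) auto
  have keint: "integrable (coord_lborel m) (\<lambda>x. k x t * exp (\<i> * complex_of_real (x \<bullet> v)))" for t
    by (rule Bochner_Integration.integrable_bound[OF kint[of t]]) (auto simp: norm_mult)
  have "0 \<le> (\<integral>x. H x * exp (\<i> * complex_of_real (x \<bullet> v)) \<partial>coord_lborel m)"
  proof (rule fourier_Phi_nonneg[OF m H])
    show "H \<in> borel_measurable borel" unfolding H_def[abs_def] by measurable
    show "integrable (coord_lborel m) H"
      unfolding H_def[abs_def]
      by (intro Bochner_Integration.integrable_sum integrable_mult_left integrable_mult_right kint)
  qed
  also have "\<dots> = (\<integral>x. (\<Sum>i<n. \<Sum>j<n. a i * cnj (a j) * (k x (\<xi> i - \<xi> j) * exp (\<i> * complex_of_real (x \<bullet> v)))) \<partial>coord_lborel m)"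
    by (simp add: H_def sum_distrib_left sum_distrib_right mult_ac)
  also have "\<dots> = (\<Sum>i<n. \<Sum>j<n. a i * cnj (a j) * (\<integral>x. k x (\<xi> i - \<xi> j) * exp (\<i> * complex_of_real (x \<bullet> v)) \<partial>coord_lborel m))"
    by (simp add: Bochner_Integration.integral_sum Bochner_Integration.integrable_sum keint)
  also have "\<dots> = (\<Sum>i<n. \<Sum>j<n. a i * scaled_G m v (sqrt (h (\<xi> i - \<xi> j))) * cnj (a j))"
    by (simp only: k_def kernel_fourier) (simp add: mult_ac)
  finally show "0 \<le> (\<Sum>i<n. \<Sum>j<n. a i * scaled_G m v (sqrt (h (\<xi> i - \<xi> j))) * cnj (a j))" .
qed

lemma G_nonneg: "0 \<le> G \<phi> \<rho> m v"
  unfolding G_F by (rule fourier_Phi_nonneg[OF m F_Phi F_measurable int])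

lemma scaled_G_nonneg: "0 < s \<Longrightarrow> 0 \<le> scaled_G m v s"
  unfolding scaled_G_def by (intro complex_nonneg_mult G_nonneg, subst of_real_nonneg_iff) simp

lemma scaled_G_scaleR:
  assumes "s > 0" "r > 0"
  shows "scaled_G m (s *\<^sub>R v) r = complex_of_real (s powi (int d - int m)) * scaled_G m v (r * s)"
proof -
  have "r powi (int m - int d) = s powi (int d - int m) * (r * s) powi (int m - int d)"
    using assms by (simp add: power_int_mult_distrib mult.left_commute flip: power_int_add)
  then show ?thesis by (simp add: scaled_G_def mult.assoc)
qed

text \<open>Positive definiteness in t gives the case s = 1 for every v; using it for s v and
  cancelling a positive power of s gives all s.\<close>

lemma scaled_G_h_le:
  assumes "s > 0"
  shows "Re (scaled_G m v (sqrt (h t) * s)) \<le> Re (scaled_G m v (sqrt (h 0) * s))"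
proof -
  have "Re (scaled_G m (s *\<^sub>R v) (sqrt (h t))) \<le> Re (scaled_G m (s *\<^sub>R v) (sqrt (h 0)))"
    using Phi_norm_le[OF scaled_G_Phi, of "s *\<^sub>R v" t] complex_Re_le_cmod order_trans by blast
  then have "s powi (int d - int m) * Re (scaled_G m v (sqrt (h t) * s)) \<le>
     s powi (int d - int m) * Re (scaled_G m v (sqrt (h 0) * s))"
    using assms h_pos by (simp add: scaled_G_scaleR del: of_real_power_int)
  then show ?thesis
    using assms by (simp add: mult_le_cancel_left_pos)
qed

lemma scaled_G_contract: "\<exists>C>1. \<forall>c\<in>{1..C}. \<forall>s>0. Re (scaled_G m v (c * s)) \<le> Re (scaled_G m v s)"
proof -
  obtain t where t: "h t > h 0" using h_nonconst h_ge by (metis order_less_le)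
  \<comment> \<open>Chosen so that C^2 h(0) = h(t): the values of \<open>h\<close> on the segment
    from 0 to t then cover every c^2 h(0) with 1 \<le> c \<le> C.\<close>
  define C where "C = sqrt (h t / h 0)"
  have "C > 1" using t h_pos[of 0] by (simp add: C_def)
  moreover have "Re (scaled_G m v (c * s)) \<le> Re (scaled_G m v s)" if c: "c \<in> {1..C}" and s: "s > 0" for c s
  proof -
    have "c\<^sup>2 \<le> C\<^sup>2" using c by (intro power_mono) auto
    also have "C\<^sup>2 = h t / h 0" using t h_pos[of 0] by (simp add: C_def)
    finally have "c\<^sup>2 * h 0 \<le> h t" using h_pos[of 0] by (simp add: field_simps)
    moreover have "1 * h 0 \<le> c\<^sup>2 * h 0" using c h_pos[of 0] by (intro mult_right_mono) auto
    ultimately have "\<exists>u. 0 \<le> u \<and> u \<le> 1 \<and> h (u *\<^sub>R t) = c\<^sup>2 * h 0"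
      using C_space_line[OF h_cont, of t]
      by (intro IVT') (auto intro: continuous_on_subset)
    then obtain u where u: "h (u *\<^sub>R t) = c\<^sup>2 * h 0" by blast
    \<comment> \<open>Dividing s by sqrt (h 0) makes the two arguments exactly c s and s.\<close>
    have "Re (scaled_G m v (sqrt (h (u *\<^sub>R t)) * (s / sqrt (h 0)))) \<le> Re (scaled_G m v (sqrt (h 0) * (s / sqrt (h 0))))"
      using s h_pos[of 0] by (intro scaled_G_h_le) auto
    then show ?thesis using c h_pos[of 0] by (simp add: u real_sqrt_mult)
  qed
  ultimately show ?thesis by blast
qed

lemma Re_scaled_G_antimono:
  assumes "0 < x" "x \<le> y"
  shows "Re (scaled_G m v y) \<le> Re (scaled_G m v x)"
proof -
  obtain C where C: "C > 1" "\<And>c s. c \<in> {1..C} \<Longrightarrow> s > 0 \<Longrightarrow> Re (scaled_G m v (c * s)) \<le> Re (scaled_G m v s)"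
    using scaled_G_contract by blast
  obtain n where n: "y / x < C ^ n" using real_arch_pow[OF C(1)] by blast
  define N where "N = Suc n"
  have yx: "1 \<le> y / x" using assms by simp
  have "C ^ n \<le> C ^ N" unfolding N_def using C(1) by (intro power_increasing) auto
  with n have N: "y / x \<le> C ^ N" by simp
  \<comment> \<open>Once C^N \<ge> y / x, the N-th root of y / x lies in [1, C], so N steps of ratio
    c lead exactly from x to y.\<close>
  define c where "c = root N (y / x)"
  have c: "c ^ N = y / x" using yx unfolding c_def by (intro real_root_pow_pos2) (auto simp: N_def)
  have "root N 1 \<le> c" unfolding c_def using yx by (subst real_root_le_iff) (auto simp: N_def)
  moreover have "c \<le> root N (C ^ N)" unfolding c_def using N by (subst real_root_le_iff) (auto simp: N_def)
  moreover have "root N (C ^ N) = C" using C(1) by (intro real_root_power_cancel) (auto simp: N_def)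
  ultimately have cC: "c \<in> {1..C}" by (simp add: N_def)
  have "Re (scaled_G m v (c ^ k * x)) \<le> Re (scaled_G m v x)" for k
  proof (induction k)
    case (Suc k)
    have "Re (scaled_G m v (c * (c ^ k * x))) \<le> Re (scaled_G m v (c ^ k * x))"
      using cC assms by (intro C(2)) auto
    then show ?case using Suc by (simp add: mult.assoc)
  qed simp
  from this[of N] show ?thesis using assms by (simp add: c)
qed

lemma scaled_G_antimono: "antimono_on {0<..} (scaled_G m v)"
proof (rule monotone_onI)
  fix x y :: real assume *: "x \<in> {0<..}" "y \<in> {0<..}" "x \<le> y"
  then show "scaled_G m v x \<ge> scaled_G m v y"
    using Re_scaled_G_antimono[of x y v] scaled_G_nonneg[of x v] scaled_G_nonneg[of y v]
    by (auto simp: less_eq_complex_def)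
qed

lemma G_limit_at_top:
  assumes "v \<in> coord_subspace m" "v \<noteq> 0"
  shows "((\<lambda>s. G \<phi> \<rho> m (s *\<^sub>R v)) \<longlongrightarrow> 0) at_top"
  unfolding G_F by (rule Riemann_Lebesgue[OF m(2) F_cont int assms])

lemma scaled_G_limit_at_top:
  assumes "v \<in> coord_subspace m" "v \<noteq> 0"
  shows "(scaled_G m v \<longlongrightarrow> 0) at_top"
proof (rule Lim_null_comparison)
  show "\<forall>\<^sub>F s in at_top. norm (scaled_G m v s) \<le> cmod (G \<phi> \<rho> m (s *\<^sub>R v))"
    using eventually_ge_at_top[of 1]
  proof eventually_elim
    case (elim s)
    \<comment> \<open>For \<open>s \<ge> 1\<close> the prefactor is at most 1 since m \<le> d, so
      Riemann-Lebesgue for \<open>G\<close> suffices.\<close>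
    have "s powi (int m - int d) \<le> s powi 0" using elim m d by (intro power_int_increasing) auto
    then have "s powi (int m - int d) * cmod (G \<phi> \<rho> m (s *\<^sub>R v)) \<le> 1 * cmod (G \<phi> \<rho> m (s *\<^sub>R v))"
      by (intro mult_right_mono) auto
    then show ?case using elim unfolding scaled_G_def norm_mult norm_of_real by simp
  qed
  show "((\<lambda>s. cmod (G \<phi> \<rho> m (s *\<^sub>R v))) \<longlongrightarrow> 0) at_top"
    using G_limit_at_top[OF assms] by (rule tendsto_norm_zero)
qed

end

end

lemma power_le_exp:
  assumes "0 \<le> u" "0 < (c::real)"
  shows "u ^ k \<le> fact k / c ^ k * exp (c * u)"
proof -
  obtain t where t: "exp (c * u) = (\<Sum>m<Suc k. (c * u) ^ m / fact m) + exp t / fact (Suc k) * (c * u) ^ Suc k"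
    using Maclaurin_exp_le[of "c * u" "Suc k"] by blast
  have "(c * u) ^ k / fact k \<le> (\<Sum>m<Suc k. (c * u) ^ m / fact m)"
    using assms by (intro member_le_sum) auto
  also have "\<dots> \<le> exp (c * u)" unfolding t using assms by simp
  finally have "c ^ k * u ^ k \<le> fact k * exp (c * u)"
    by (simp add: power_mult_distrib pos_divide_le_eq mult.commute)
  then show ?thesis using assms by (simp add: field_simps)
qed

context scaled_kernel
begin

subsection \<open>Integrability of the profile\<close>

lemma phi_sq_cont: "continuous_on UNIV (\<lambda>u. \<phi> (u\<^sup>2))"
  by (rule continuous_on_compose2[OF phi_cont]) (auto intro!: continuous_intros)

lemma phi_sq_measurable [measurable]: "(\<lambda>u. \<phi> (u\<^sup>2)) \<in> borel_measurable borel"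
  using phi_sq_cont by (rule borel_measurable_continuous_onI)

definition radial :: "nat \<Rightarrow> bool" where
  "radial k \<longleftrightarrow> set_integrable lborel {0..} (\<lambda>u::real. cmod (\<phi> (u\<^sup>2)) * u ^ k)"

lemma radial_mono:
  assumes "radial b" "a \<le> b"
  shows "radial a"
  unfolding radial_def set_integrable_def
proof (rule Bochner_Integration.integrable_bound)
  \<comment> \<open>Powers of u compare in the right direction only beyond 1; on [0, 1] continuity
    of \<open>\<phi>\<close> supplies integrability.\<close>
  have "set_integrable lborel {0..1} (\<lambda>u. cmod (\<phi> (u\<^sup>2)))"
    by (rule borel_integrable_atLeastAtMost')
      (auto intro!: continuous_intros continuous_on_subset[OF phi_sq_cont])
  then show "integrable lborel (\<lambda>u. indicator {0..1} u *\<^sub>R cmod (\<phi> (u\<^sup>2)) + indicator {0..} u *\<^sub>R (cmod (\<phi> (u\<^sup>2)) * u ^ b))"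
    using assms(1) unfolding radial_def set_integrable_def by (rule Bochner_Integration.integrable_add)
  show "AE u in lborel. norm (indicator {0..} u *\<^sub>R (cmod (\<phi> (u\<^sup>2)) * u ^ a))
     \<le> norm (indicator {0..1} u *\<^sub>R cmod (\<phi> (u\<^sup>2)) + indicator {0..} u *\<^sub>R (cmod (\<phi> (u\<^sup>2)) * u ^ b))"
  proof (intro AE_I2)
    fix u :: real
    consider "u < 0" | "0 \<le> u" "u \<le> 1" | "1 < u" by linarith
    then show "norm (indicator {0..} u *\<^sub>R (cmod (\<phi> (u\<^sup>2)) * u ^ a))
      \<le> norm (indicator {0..1} u *\<^sub>R cmod (\<phi> (u\<^sup>2)) + indicator {0..} u *\<^sub>R (cmod (\<phi> (u\<^sup>2)) * u ^ b))"
    proof cases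
      case 2
      then have "u ^ a \<le> 1" by (simp add: power_le_one)
      then have "cmod (\<phi> (u\<^sup>2)) * u ^ a \<le> cmod (\<phi> (u\<^sup>2)) * 1" by (intro mult_left_mono) auto
      also have "\<dots> \<le> cmod (\<phi> (u\<^sup>2)) + cmod (\<phi> (u\<^sup>2)) * u ^ b" using 2 by simp
      finally show ?thesis using 2 by simp
    next
      case 3
      then have "u ^ a \<le> u ^ b" using assms(2) by (intro power_increasing) auto
      then have "cmod (\<phi> (u\<^sup>2)) * u ^ a \<le> cmod (\<phi> (u\<^sup>2)) * u ^ b" by (intro mult_left_mono) auto
      then show ?thesis using 3 by simp
    qed simp
  qed
qed measurable

lemma integrable_F:
  assumes "1 \<le> m" "m \<le> CARD('d)" "radial (m - 1)"
  shows "integrable (coord_lborel m) F"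
  unfolding F_def[abs_def] using assms by (intro integrable_radial) (auto simp: radial_def)

lemma integrable_F_lborel:
  assumes "radial (d - 1)"
  shows "integrable lborel F"
  using integrable_F[of d] assms d_pos by (simp add: d coord_lborel_UNIV)

text \<open>Polar coordinates handle powers of \<open>\<rho>\<close>; these dominate powers of the
  norm by \<open>rho_ge_norm\<close>.\<close>

lemma integrable_F_moment:
  assumes "radial (k + (d - 1))"
  shows "integrable lborel (\<lambda>y. cmod (F y) * norm y ^ k)"
proof -
  obtain a where a: "a > 0" "\<And>x. a * norm x \<le> \<rho> x" using rho_ge_norm by blast
  have "set_integrable lborel {0..} (\<lambda>u. norm (cmod (\<phi> (u\<^sup>2)) * u ^ k) * u ^ (d - 1))"
    using assms unfolding radial_def
    by (subst set_integrable_cong[OF refl refl]) (auto simp: power_add abs_mult)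
  then have "integrable (coord_lborel CARD('d)) (\<lambda>y. cmod (\<phi> ((\<rho> y)\<^sup>2)) * \<rho> y ^ k)"
    using d_pos by (intro integrable_radial) (auto simp: d)
  then have "integrable lborel (\<lambda>y. (1 / a ^ k) * (cmod (F y) * \<rho> y ^ k))"
    unfolding coord_lborel_UNIV F_def by (rule integrable_mult_right)
  then show ?thesis
  proof (rule Bochner_Integration.integrable_bound)
    show "AE y in lborel. norm (cmod (F y) * norm y ^ k) \<le> norm ((1 / a ^ k) * (cmod (F y) * \<rho> y ^ k))"
    proof (intro AE_I2)
      fix y
      have "(a * norm y) ^ k \<le> \<rho> y ^ k" using a by (intro power_mono) auto
      then have "norm y ^ k \<le> (1 / a ^ k) * \<rho> y ^ k"
        using a(1) by (simp add: power_mult_distrib field_simps)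
      then have "cmod (F y) * norm y ^ k \<le> cmod (F y) * ((1 / a ^ k) * \<rho> y ^ k)"
        by (intro mult_left_mono) auto
      then show "norm (cmod (F y) * norm y ^ k) \<le> norm ((1 / a ^ k) * (cmod (F y) * \<rho> y ^ k))"
        using a(1) rho_nonneg[of y] by (simp add: abs_mult mult_ac)
    qed
  qed measurable
qed

text \<open>The spare rate \<epsilon> - \<delta> absorbs the power u^k, at the cost of the constant
  from \<open>power_le_exp\<close>.\<close>

lemma set_integrable_exp_power:
  assumes "0 < \<epsilon>" "0 \<le> \<delta>" "\<delta> < \<epsilon>" "set_integrable lborel {0..} (\<lambda>u::real. cmod (\<phi> (u\<^sup>2)) * exp (\<epsilon> * u))"
  shows "set_integrable lborel {0..} (\<lambda>u::real. cmod (\<phi> (u\<^sup>2)) * exp (\<delta> * u) * u ^ k)"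
  unfolding set_integrable_def
proof (rule Bochner_Integration.integrable_bound)
  define C where "C = fact k / (\<epsilon> - \<delta>) ^ k"
  show "integrable lborel (\<lambda>u. C * (indicator {0..} u *\<^sub>R (cmod (\<phi> (u\<^sup>2)) * exp (\<epsilon> * u))))"
    using assms(4) unfolding set_integrable_def by (rule integrable_mult_right)
  show "AE u in lborel. norm (indicator {0..} u *\<^sub>R (cmod (\<phi> (u\<^sup>2)) * exp (\<delta> * u) * u ^ k))
     \<le> norm (C * (indicator {0..} u *\<^sub>R (cmod (\<phi> (u\<^sup>2)) * exp (\<epsilon> * u))))"
  proof (intro AE_I2)
    fix u :: real
    show "norm (indicator {0..} u *\<^sub>R (cmod (\<phi> (u\<^sup>2)) * exp (\<delta> * u) * u ^ k))
      \<le> norm (C * (indicator {0..} u *\<^sub>R (cmod (\<phi> (u\<^sup>2)) * exp (\<epsilon> * u))))"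
    proof (cases "0 \<le> u")
      case True
      have "exp (\<delta> * u) * u ^ k \<le> exp (\<delta> * u) * (C * exp ((\<epsilon> - \<delta>) * u))"
        unfolding C_def using assms True by (intro mult_left_mono power_le_exp) auto
      also have "\<dots> = C * exp (\<epsilon> * u)"
        by (simp add: left_diff_distrib exp_diff)
      finally have "cmod (\<phi> (u\<^sup>2)) * (exp (\<delta> * u) * u ^ k) \<le> cmod (\<phi> (u\<^sup>2)) * (C * exp (\<epsilon> * u))"
        by (intro mult_left_mono) auto
      moreover have "C \<ge> 0" using assms by (simp add: C_def)
      ultimately show ?thesis using True by (simp add: abs_mult mult_ac)
    qed simp
  qed
qed measurable

lemma radial_exp:
  assumes "0 < \<epsilon>" "set_integrable lborel {0..} (\<lambda>u::real. cmod (\<phi> (u\<^sup>2)) * exp (\<epsilon> * u))"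
  shows "radial k"
  using set_integrable_exp_power[of \<epsilon> 0 k] assms by (simp add: radial_def)

lemma integrable_F_exp_moment:
  assumes "0 < \<epsilon>" "set_integrable lborel {0..} (\<lambda>u::real. cmod (\<phi> (u\<^sup>2)) * exp (\<epsilon> * u))"
  obtains \<delta> where "\<delta> > 0" "integrable lborel (\<lambda>y. cmod (F y) * exp (\<delta> * \<bar>y \<bullet> v\<bar>))"
proof -
  obtain a where a: "a > 0" "\<And>x. a * norm x \<le> \<rho> x" using rho_ge_norm by blast
  have "set_integrable lborel {0..} (\<lambda>u. norm (cmod (\<phi> (u\<^sup>2)) * exp (\<epsilon> / 2 * u)) * u ^ (d - 1))"
    using set_integrable_exp_power[of \<epsilon> "\<epsilon> / 2" "d - 1"] assms by simp
  then have "integrable (coord_lborel CARD('d)) (\<lambda>y. cmod (\<phi> ((\<rho> y)\<^sup>2)) * exp (\<epsilon> / 2 * \<rho> y))"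
    using d_pos by (intro integrable_radial) (auto simp: d)
  then have int: "integrable lborel (\<lambda>y. cmod (F y) * exp (\<epsilon> / 2 * \<rho> y))"
    unfolding coord_lborel_UNIV F_def .
  \<comment> \<open>\<delta> is made so that \<delta> |y \<bullet> v| \<le> (\<epsilon>/2)
    \<rho>(y); the other half of \<epsilon> has paid for the polar weight u^(d-1). The
    \<open>+ 1\<close> avoids division by 0.\<close>
  define N where "N = norm v + 1"
  define \<delta> where "\<delta> = \<epsilon> / 2 * a / N"
  have nv: "N > 0" by (simp add: N_def add_nonneg_pos)
  have \<delta>: "\<delta> > 0" using assms(1) a(1) nv by (simp add: \<delta>_def)
  moreover have "integrable lborel (\<lambda>y. cmod (F y) * exp (\<delta> * \<bar>y \<bullet> v\<bar>))"
  proof (rule Bochner_Integration.integrable_bound[OF int])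
    show "AE y in lborel. norm (cmod (F y) * exp (\<delta> * \<bar>y \<bullet> v\<bar>)) \<le> norm (cmod (F y) * exp (\<epsilon> / 2 * \<rho> y))"
    proof (intro AE_I2)
      fix y
      have "\<bar>y \<bullet> v\<bar> \<le> norm y * norm v" by (rule Cauchy_Schwarz_ineq2)
      also have "\<dots> \<le> norm y * N" unfolding N_def by (intro mult_left_mono) auto
      finally have "\<delta> * \<bar>y \<bullet> v\<bar> \<le> \<delta> * (norm y * N)" using \<delta> by (intro mult_left_mono) auto
      also have "\<dots> = \<delta> * N * norm y" by (simp only: mult_ac)
      also have "\<delta> * N = \<epsilon> / 2 * a" using nv by (simp add: \<delta>_def)
      also have "\<dots> * norm y = \<epsilon> / 2 * (a * norm y)" by simp
      also have "\<dots> \<le> \<epsilon> / 2 * \<rho> y" using a(2)[of y] assms(1) by (intro mult_left_mono) auto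
      finally show "norm (cmod (F y) * exp (\<delta> * \<bar>y \<bullet> v\<bar>)) \<le> norm (cmod (F y) * exp (\<epsilon> / 2 * \<rho> y))"
        by (auto intro: mult_left_mono)
    qed
  qed measurable
  ultimately show ?thesis by (rule that)
qed

lemma set_integrable_exp_compact_support:
  assumes "\<And>u. u \<ge> R \<Longrightarrow> \<phi> u = 0"
  shows "set_integrable lborel {0..} (\<lambda>u::real. cmod (\<phi> (u\<^sup>2)) * exp (\<epsilon> * u))"
proof -
  define S where "S = sqrt \<bar>R\<bar>"
  have "set_integrable lborel {0..S} (\<lambda>u. cmod (\<phi> (u\<^sup>2)) * exp (\<epsilon> * u))"
    by (rule borel_integrable_atLeastAtMost')
      (auto intro!: continuous_intros continuous_on_subset[OF phi_sq_cont])
  moreover have "(\<lambda>u. indicator {0..S} u *\<^sub>R (cmod (\<phi> (u\<^sup>2)) * exp (\<epsilon> * u)))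
     = (\<lambda>u. indicator {0..} u *\<^sub>R (cmod (\<phi> (u\<^sup>2)) * exp (\<epsilon> * u)))"
  proof
    fix u :: real
    have "\<phi> (u\<^sup>2) = 0" if "u > S"
    proof -
      have "S\<^sup>2 \<le> u\<^sup>2" using that by (intro power_mono) (auto simp: S_def)
      then show ?thesis by (intro assms) (simp add: S_def)
    qed
    then show "indicator {0..S} u *\<^sub>R (cmod (\<phi> (u\<^sup>2)) * exp (\<epsilon> * u))
        = indicator {0..} u *\<^sub>R (cmod (\<phi> (u\<^sup>2)) * exp (\<epsilon> * u))"
      by (auto simp: indicator_def not_le)
  qed
  ultimately show ?thesis by (simp add: set_integrable_def)
qed

subsection \<open>The transform in full dimension\<close>

context
  assumes int: "integrable lborel F"
begin

lemma int_coord: "integrable (coord_lborel CARD('d)) F"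
  using int by (simp add: coord_lborel_UNIV)

lemma G_lborel: "G \<phi> \<rho> d v = (\<integral>y. F y * exp (\<i> * complex_of_real (y \<bullet> v)) \<partial>lborel)"
  by (simp add: G_F d coord_lborel_UNIV)

lemma G_at_0: "G \<phi> \<rho> d 0 = integral\<^sup>L lborel F"
  by (simp add: G_lborel)

lemma G_d_nonneg: "0 \<le> G \<phi> \<rho> d v"
  using G_nonneg[OF _ _ int_coord] d_pos d by simp

lemma scaled_G_d: "scaled_G d v s = G \<phi> \<rho> d (s *\<^sub>R v)"
  by (simp add: scaled_G_def)

lemma G_d_Phi: "(\<lambda>t. G \<phi> \<rho> d (sqrt (h t) *\<^sub>R v)) \<in> Phi"
  using scaled_G_Phi[OF _ _ int_coord, folded d, of v] d_pos by (simp add: scaled_G_d)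

lemma G_LIMSEQ:
  assumes "s \<longlonglongrightarrow> s0"
  shows "(\<lambda>n. G \<phi> \<rho> d (s n *\<^sub>R v)) \<longlonglongrightarrow> G \<phi> \<rho> d (s0 *\<^sub>R v)"
  unfolding G_lborel
proof (rule integral_dominated_convergence[where w = "\<lambda>y. cmod (F y)"])
  show "AE y in lborel. (\<lambda>n. F y * exp (\<i> * complex_of_real (y \<bullet> (s n *\<^sub>R v))))
      \<longlonglongrightarrow> F y * exp (\<i> * complex_of_real (y \<bullet> (s0 *\<^sub>R v)))"
    by (intro AE_I2 tendsto_intros assms)
qed (use int in \<open>auto simp: norm_mult\<close>)

text \<open>For m = d the power of s disappears, so monotonicity extends to the endpoint s = 0 by
  continuity along s' / (n + 1).\<close>

lemma G_antimono:
  assumes "0 \<le> s" "s \<le> s'"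
  shows "Re (G \<phi> \<rho> d (s' *\<^sub>R v)) \<le> Re (G \<phi> \<rho> d (s *\<^sub>R v))"
proof -
  have pos: "Re (G \<phi> \<rho> d (s' *\<^sub>R v)) \<le> Re (G \<phi> \<rho> d (s *\<^sub>R v))" if "0 < s" "s \<le> s'" for s s'
    using Re_scaled_G_antimono[OF _ _ int_coord that, folded d, of v] d_pos by (simp add: scaled_G_d)
  show ?thesis
  proof (cases "s = 0 \<and> s' > 0")
    case True
    have "(\<lambda>n. s' * (1 / real (Suc n))) \<longlonglongrightarrow> s' * 0"
      by (intro tendsto_intros LIMSEQ_Suc[OF lim_1_over_n])
    then have "(\<lambda>n. s' / real (Suc n)) \<longlonglongrightarrow> 0" by simp
    from tendsto_Re[OF G_LIMSEQ[OF this, of v]]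
    have "(\<lambda>n. Re (G \<phi> \<rho> d ((s' / real (Suc n)) *\<^sub>R v))) \<longlonglongrightarrow> Re (G \<phi> \<rho> d (s *\<^sub>R v))" using True by simp
    moreover have "Re (G \<phi> \<rho> d (s' *\<^sub>R v)) \<le> Re (G \<phi> \<rho> d ((s' / real (Suc n)) *\<^sub>R v))" for n
      using True by (intro pos) (auto simp: field_simps)
    ultimately show ?thesis by (intro LIMSEQ_le_const) auto
  next
    case False
    show ?thesis
    proof (cases "s = 0")
      case True
      with False assms have "s' = s" by simp
      then show ?thesis by simp
    qed (use assms pos in auto)
  qed
qed

text \<open>If the value at 0 vanished, monotonicity and nonnegativity would make \<open>G\<close>
  vanish everywhere, and \<open>fourier_eq_0_imp\<close> would contradict
  \<open>\<phi> 0 > 0\<close>.\<close>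

lemma G_zero_pos: "0 < G \<phi> \<rho> d 0"
proof (rule ccontr)
  assume "\<not> 0 < G \<phi> \<rho> d 0"
  with G_d_nonneg[of 0] have z: "G \<phi> \<rho> d 0 = 0" by (auto simp: less_le)
  have "G \<phi> \<rho> d v = 0" for v
    using G_antimono[of 0 1 v] G_d_nonneg[of v] z by (auto simp: less_eq_complex_def complex_eq_iff)
  then have "F 0 = 0"
    using F_bound int by (intro fourier_eq_0_imp[OF F_cont]) (auto simp: G_lborel)
  with phi_pos show False by (simp add: F_zero)
qed

lemma G_not_locally_const:
  assumes lps: "local_power_series (\<lambda>s. Re (G \<phi> \<rho> d (s *\<^sub>R v)))" and "v \<noteq> 0" "a < b"
    and const: "\<And>s. a < s \<Longrightarrow> s < b \<Longrightarrow> Re (G \<phi> \<rho> d (s *\<^sub>R v)) = c"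
  shows False
proof -
  have c: "Re (G \<phi> \<rho> d (s *\<^sub>R v)) = c" for s
    by (rule local_power_series_const[OF lps assms(3) const])
  have "v \<in> coord_subspace CARD('d)" by (simp add: coord_subspace_UNIV)
  then have "((\<lambda>s. G \<phi> \<rho> d (s *\<^sub>R v)) \<longlongrightarrow> 0) at_top"
    using G_limit_at_top[OF _ _ int_coord] d_pos d assms(2) by simp
  from tendsto_Re[OF this] have "((\<lambda>s::real. c) \<longlongrightarrow> 0) at_top" by (simp add: c)
  then have "c = 0" by (simp add: tendsto_const_iff)
  then show False using c[of 0] G_zero_pos by (simp add: less_complex_def)
qed

text \<open>Equal values at two points would force a monotone function to be constant between
  them.\<close>

lemma G_strict_antimono:
  assumes "local_power_series (\<lambda>s. Re (G \<phi> \<rho> d (s *\<^sub>R v)))" "v \<noteq> 0" "0 \<le> s" "s < s'"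
  shows "G \<phi> \<rho> d (s' *\<^sub>R v) < G \<phi> \<rho> d (s *\<^sub>R v)"
proof -
  have "Re (G \<phi> \<rho> d (s' *\<^sub>R v)) \<noteq> Re (G \<phi> \<rho> d (s *\<^sub>R v))"
  proof
    assume eq: "Re (G \<phi> \<rho> d (s' *\<^sub>R v)) = Re (G \<phi> \<rho> d (s *\<^sub>R v))"
    have "Re (G \<phi> \<rho> d (r *\<^sub>R v)) = Re (G \<phi> \<rho> d (s *\<^sub>R v))" if "s < r" "r < s'" for r
      using G_antimono[of s r v] G_antimono[of r s' v] that assms eq by simp
    then show False using G_not_locally_const[OF assms(1,2,4)] by blast
  qed
  then show ?thesis
    using G_antimono[of s s' v] G_d_nonneg[of "s *\<^sub>R v"] G_d_nonneg[of "s' *\<^sub>R v"] assms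
    by (auto simp: less_complex_def less_eq_complex_def)
qed

subsection \<open>Moments\<close>

lemma alpha_F: "\<alpha> \<phi> \<rho> k v = (\<integral>y. F y * complex_of_real ((y \<bullet> v) ^ (2 * k)) \<partial>lborel)"
  by (simp add: \<alpha>_def F_def)

lemma beta_F: "\<beta> \<phi> \<rho> k = (\<integral>y. F y * complex_of_real (norm y ^ (2 * k)) \<partial>lborel)"
  by (simp add: \<beta>_def F_def)

lemma alpha_scaleR: "\<alpha> \<phi> \<rho> k (c *\<^sub>R v) = complex_of_real (c ^ (2 * k)) * \<alpha> \<phi> \<rho> k v"
proof -
  have "\<alpha> \<phi> \<rho> k (c *\<^sub>R v) = (\<integral>y. complex_of_real (c ^ (2 * k)) * (F y * complex_of_real ((y \<bullet> v) ^ (2 * k))) \<partial>lborel)"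
    by (simp add: alpha_F power_mult_distrib mult_ac)
  also have "\<dots> = complex_of_real (c ^ (2 * k)) * \<alpha> \<phi> \<rho> k v"
    unfolding alpha_F by (rule integral_mult_right_zero)
  finally show ?thesis .
qed

lemma alpha_eq_0_sphere:
  assumes "1 \<le> k" "\<And>v. v \<in> sphere 0 1 \<Longrightarrow> \<alpha> \<phi> \<rho> k v = 0"
  shows "\<alpha> \<phi> \<rho> k v = 0"
proof (cases "v = 0")
  case True
  then show ?thesis using assms(1) by (simp add: alpha_F power_0_left)
next
  case False
  then have "v = norm v *\<^sub>R ((1 / norm v) *\<^sub>R v)" by simp
  moreover have "\<alpha> \<phi> \<rho> k ((1 / norm v) *\<^sub>R v) = 0" using False by (intro assms(2)) simp
  ultimately show ?thesis by (metis alpha_scaleR mult_zero_right)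
qed

context
  fixes p :: nat
  assumes p: "1 \<le> p" and mom: "integrable lborel (\<lambda>y. cmod (F y) * norm y ^ (2 * p))"
begin

lemma alpha_LIMSEQ:
  assumes "\<And>k. 1 \<le> k \<Longrightarrow> k < p \<Longrightarrow> \<alpha> \<phi> \<rho> k v = 0" "s \<longlonglongrightarrow> 0" "\<And>n. s n \<noteq> 0"
  shows "(\<lambda>n. (G \<phi> \<rho> d (s n *\<^sub>R v) - G \<phi> \<rho> d 0) / complex_of_real (s n ^ (2 * p)))
     \<longlonglongrightarrow> (-1) ^ p / fact (2 * p) * \<alpha> \<phi> \<rho> p v"
  unfolding G_at_0 unfolding G_lborel alpha_F
  by (rule fourier_Taylor[OF int mom F_minus p _ assms(2,3)]) (rule assms(1)[unfolded alpha_F])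

text \<open>Since G(s v) \<le> G(0), the leading Taylor coefficient along v cannot be positive, and
  \<open>(-1) ^ p\<close> is the sign it carries from the cosine series.\<close>

lemma alpha_sign:
  assumes "\<And>k. 1 \<le> k \<Longrightarrow> k < p \<Longrightarrow> \<alpha> \<phi> \<rho> k v = 0"
  shows "0 \<le> - ((-1) ^ p * \<alpha> \<phi> \<rho> p v)"
proof -
  define s where "s n = 1 / real (Suc n)" for n
  have s: "s \<longlonglongrightarrow> 0" "\<And>n. s n > 0" unfolding s_def[abs_def] by (rule LIMSEQ_Suc[OF lim_1_over_n]) simp
  have "0 \<le> - ((-1) ^ p / fact (2 * p) * \<alpha> \<phi> \<rho> p v)"
  proof (rule complex_nonneg_LIMSEQ)
    show "(\<lambda>n. - ((G \<phi> \<rho> d (s n *\<^sub>R v) - G \<phi> \<rho> d 0) / complex_of_real (s n ^ (2 * p))))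
       \<longlonglongrightarrow> - ((-1) ^ p / fact (2 * p) * \<alpha> \<phi> \<rho> p v)"
      using s(2) by (intro tendsto_minus alpha_LIMSEQ assms s(1)) (auto simp: less_imp_neq[symmetric])
    show "0 \<le> - ((G \<phi> \<rho> d (s n *\<^sub>R v) - G \<phi> \<rho> d 0) / complex_of_real (s n ^ (2 * p)))" for n
    proof -
      have "0 \<le> G \<phi> \<rho> d 0 - G \<phi> \<rho> d (s n *\<^sub>R v)"
        using G_antimono[of 0 "s n" v] G_d_nonneg[of 0] G_d_nonneg[of "s n *\<^sub>R v"] s(2)[of n]
        by (auto simp: less_eq_complex_def less_imp_le)
      then have "0 \<le> complex_of_real (1 / s n ^ (2 * p)) * (G \<phi> \<rho> d 0 - G \<phi> \<rho> d (s n *\<^sub>R v))"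
        by (rule complex_nonneg_mult[rotated], subst of_real_nonneg_iff) simp
      then show ?thesis by (simp add: diff_divide_distrib)
    qed
  qed
  then have "0 \<le> complex_of_real (fact (2 * p)) * - ((-1) ^ p / fact (2 * p) * \<alpha> \<phi> \<rho> p v)"
    by (rule complex_nonneg_mult[rotated], subst of_real_nonneg_iff) simp
  then show ?thesis by simp
qed

text \<open>With \<open>s\<^sub>n\<close> of order \<open>n ^ (- 1 / (2 * p))\<close> the Taylor expansion of \<open>G\<close> turns the positive definite
  functions \<open>(G (s\<^sub>n * sqrt (h t) * v) / G 0) ^ n\<close> into \<open>(1 - (l * h t ^ p + o(1)) / n) ^ n\<close>.\<close>

lemma exp_h_power_Phi:
  assumes zero: "\<And>k. 1 \<le> k \<Longrightarrow> k < p \<Longrightarrow> \<alpha> \<phi> \<rho> k v = 0" and ne: "\<alpha> \<phi> \<rho> p v \<noteq> 0" and l: "l > 0"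
  shows "(\<lambda>t. complex_of_real (exp (- l * h t ^ p))) \<in> Phi"
proof -
  \<comment> \<open>The leading Taylor coefficient of s \<mapsto> G(s v) at 0, to be shown
    negative.\<close>
  define L where "L = Re ((-1) ^ p / fact (2 * p) * \<alpha> \<phi> \<rho> p v)"
  define g0 where "g0 = Re (G \<phi> \<rho> d 0)"
  have g0: "g0 > 0" "G \<phi> \<rho> d 0 = complex_of_real g0"
    using G_zero_pos by (auto simp: g0_def less_complex_def complex_eq_iff)
  have sgn: "0 \<le> - ((-1) ^ p * \<alpha> \<phi> \<rho> p v)" by (rule alpha_sign[OF zero])
  have eq: "(-1) ^ p / fact (2 * p) * \<alpha> \<phi> \<rho> p v = ((-1) ^ p * \<alpha> \<phi> \<rho> p v) / complex_of_real (fact (2 * p))"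
    by simp
  have L: "L < 0"
  proof -
    have "(-1) ^ p * \<alpha> \<phi> \<rho> p v \<noteq> 0" using ne by simp
    with sgn have "Re ((-1) ^ p * \<alpha> \<phi> \<rho> p v) < 0"
      by (auto simp: less_eq_complex_def complex_eq_iff simp del: Re_power_real Im_power_real)
    then show ?thesis unfolding L_def eq by (simp only: Re_divide_of_real) (simp add: divide_neg_pos)
  qed
  \<comment> \<open>Solves L c / g0 = -l. With s_n^(2p) = c / (n + 1) below, the limit acquires
    exactly the prescribed factor l.\<close>
  define c where "c = - l * g0 / L"
  have c: "c > 0" using l g0 L by (simp add: c_def divide_pos_neg)
  define s where "s n = root (2 * p) (c / real (Suc n))" for n
  have spos: "s n > 0" for n using c p by (simp add: s_def)
  have spow: "s n ^ (2 * p) = c / real (Suc n)" for n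
    unfolding s_def using c p by (intro real_root_pow_pos2) auto
  have "(\<lambda>n. c * (1 / real (Suc n))) \<longlonglongrightarrow> c * 0"
    by (intro tendsto_intros LIMSEQ_Suc[OF lim_1_over_n])
  then have "(\<lambda>n. root (2 * p) (c / real (Suc n))) \<longlonglongrightarrow> root (2 * p) 0"
    by (intro tendsto_real_root) simp
  then have s0: "s \<longlonglongrightarrow> 0" by (simp add: s_def[abs_def])
  show ?thesis
  proof (rule Phi_limit)
    show "(\<lambda>t. (complex_of_real (1 / g0) * G \<phi> \<rho> d (sqrt (h t) *\<^sub>R (s n *\<^sub>R v))) ^ Suc n) \<in> Phi" for n
      using g0 by (intro Phi_power Phi_scale G_d_Phi, subst of_real_nonneg_iff) simp
    fix t
    define r where "r = sqrt (h t)"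
    have r: "r > 0" "r ^ (2 * p) = h t ^ p"
      using h_pos[of t] by (auto simp: r_def power_mult)
    define \<sigma> where "\<sigma> n = s n * r" for n
    have \<sigma>: "\<sigma> \<longlonglongrightarrow> 0" "\<And>n. \<sigma> n \<noteq> 0"
      using tendsto_mult_left_zero[OF s0, of r] spos r by (auto simp: \<sigma>_def[abs_def] less_imp_neq[symmetric])
    define D where "D n = (Re (G \<phi> \<rho> d (\<sigma> n *\<^sub>R v)) - g0) / \<sigma> n ^ (2 * p)" for n
    have "D \<longlonglongrightarrow> L"
    proof -
      have "Re ((G \<phi> \<rho> d (\<sigma> n *\<^sub>R v) - G \<phi> \<rho> d 0) / complex_of_real (\<sigma> n ^ (2 * p))) = D n" for n
        unfolding D_def g0_def by (simp only: Re_divide_of_real minus_complex.simps)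
      then show ?thesis
        using tendsto_Re[OF alpha_LIMSEQ[OF zero \<sigma>]] unfolding L_def by simp
    qed
    \<comment> \<open>Arranged so that G(\<sigma>_n v) / g0 = 1 + Z_n / (n + 1) holds
      exactly.\<close>
    define Z where "Z n = D n / g0 * (c * h t ^ p)" for n
    have "Z \<longlonglongrightarrow> L / g0 * (c * h t ^ p)"
      unfolding Z_def[abs_def] using g0 by (intro tendsto_intros \<open>D \<longlonglongrightarrow> L\<close>) auto
    also have "L / g0 * (c * h t ^ p) = - l * h t ^ p"
      using g0 L by (simp add: c_def field_simps)
    \<comment> \<open>\<open>Z n\<close> belongs to the power \<open>Suc n\<close>, so the sequence
      is shifted to Z (n - 1) before the exponential limit is applied, and shifted back
      afterwards.\<close>
    finally have "(\<lambda>n. Z (Suc n - 1)) \<longlonglongrightarrow> - l * h t ^ p" by simp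
    then have "(\<lambda>n. Z (n - 1)) \<longlonglongrightarrow> - l * h t ^ p" by (rule LIMSEQ_imp_Suc)
    from LIMSEQ_Suc[OF tendsto_exp_limit_seq[OF this]]
    have "(\<lambda>n. (1 + Z n / real (Suc n)) ^ Suc n) \<longlonglongrightarrow> exp (- l * h t ^ p)"
      by (simp only: diff_Suc_1)
    then have "(\<lambda>n. complex_of_real ((1 + Z n / real (Suc n)) ^ Suc n)) \<longlonglongrightarrow> complex_of_real (exp (- l * h t ^ p))"
      by (rule tendsto_of_real)
    also have "(\<lambda>n. complex_of_real ((1 + Z n / real (Suc n)) ^ Suc n))
      = (\<lambda>n. (complex_of_real (1 / g0) * G \<phi> \<rho> d (sqrt (h t) *\<^sub>R (s n *\<^sub>R v))) ^ Suc n)"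
    proof
      fix n
      have \<sigma>p: "\<sigma> n ^ (2 * p) = c * h t ^ p / real (Suc n)"
        by (simp add: \<sigma>_def power_mult_distrib spow r(2) del: of_nat_Suc)
      have "D n * \<sigma> n ^ (2 * p) = Re (G \<phi> \<rho> d (\<sigma> n *\<^sub>R v)) - g0"
        using \<sigma>(2)[of n] by (simp add: D_def)
      then have "Re (G \<phi> \<rho> d (\<sigma> n *\<^sub>R v)) = g0 + D n * (c * h t ^ p / real (Suc n))"
        by (simp only: \<sigma>p)
      also have "\<dots> = g0 * (1 + Z n / real (Suc n))"
        using g0 by (simp add: Z_def field_simps del: of_nat_Suc)
      finally have "Re (G \<phi> \<rho> d (\<sigma> n *\<^sub>R v)) = g0 * (1 + Z n / real (Suc n))" .
      then have "G \<phi> \<rho> d (\<sigma> n *\<^sub>R v) = complex_of_real (g0 * (1 + Z n / real (Suc n)))"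
        using G_d_nonneg[of "\<sigma> n *\<^sub>R v"] by (simp add: complex_eq_iff less_eq_complex_def)
      moreover have "sqrt (h t) *\<^sub>R (s n *\<^sub>R v) = \<sigma> n *\<^sub>R v" by (simp add: \<sigma>_def r_def mult.commute)
      ultimately have "complex_of_real (1 / g0) * G \<phi> \<rho> d (sqrt (h t) *\<^sub>R (s n *\<^sub>R v)) 
         = complex_of_real (1 / g0 * (g0 * (1 + Z n / real (Suc n))))"
        by (simp only: of_real_mult)
      also have "1 / g0 * (g0 * (1 + Z n / real (Suc n))) = 1 + Z n / real (Suc n)"
        using g0 by simp
      finally show "complex_of_real ((1 + Z n / real (Suc n)) ^ Suc n)
        = (complex_of_real (1 / g0) * G \<phi> \<rho> d (sqrt (h t) *\<^sub>R (s n *\<^sub>R v))) ^ Suc n"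
        by (simp only: of_real_power)
    qed
    finally show "(\<lambda>n. (complex_of_real (1 / g0) * G \<phi> \<rho> d (sqrt (h t) *\<^sub>R (s n *\<^sub>R v))) ^ Suc n)
        \<longlonglongrightarrow> complex_of_real (exp (- l * h t ^ p))" .
  qed
qed

text \<open>Upgrades almost everywhere vanishing to vanishing in \<open>beta_eq_0_iff\<close>, and
  gives the open cover in \<open>bdd_above_p_min\<close>.\<close>

lemma alpha_continuous: "continuous_on UNIV (\<alpha> \<phi> \<rho> p)"
proof (rule continuous_on_sequentiallyI)
  fix u :: "nat \<Rightarrow> (real, 'd) vec" and a assume u: "u \<longlonglongrightarrow> a"
  have "Bseq u" using u by (intro convergent_imp_Bseq convergentI)
  then obtain B where B: "B > 0" "\<And>n. norm (u n) \<le> B"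
    unfolding Bseq_def by blast
  show "(\<lambda>n. \<alpha> \<phi> \<rho> p (u n)) \<longlonglongrightarrow> \<alpha> \<phi> \<rho> p a"
    unfolding alpha_F
  proof (rule integral_dominated_convergence[where w = "\<lambda>y. cmod (F y) * norm y ^ (2 * p) * B ^ (2 * p)"])
    show "integrable lborel (\<lambda>y. cmod (F y) * norm y ^ (2 * p) * B ^ (2 * p))"
      using mom by (rule integrable_mult_left)
    show "AE y in lborel. (\<lambda>n. F y * complex_of_real ((y \<bullet> u n) ^ (2 * p))) \<longlonglongrightarrow> F y * complex_of_real ((y \<bullet> a) ^ (2 * p))"
      by (intro AE_I2 tendsto_intros u)
    show "AE y in lborel. norm (F y * complex_of_real ((y \<bullet> u n) ^ (2 * p))) \<le> cmod (F y) * norm y ^ (2 * p) * B ^ (2 * p)" for n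
    proof (intro AE_I2)
      fix y
      have "\<bar>y \<bullet> u n\<bar> \<le> norm y * norm (u n)" by (rule Cauchy_Schwarz_ineq2)
      also have "\<dots> \<le> norm y * B" using B by (intro mult_left_mono) auto
      finally have "\<bar>y \<bullet> u n\<bar> ^ (2 * p) \<le> (norm y * B) ^ (2 * p)" by (intro power_mono) auto
      then have "cmod (F y) * \<bar>y \<bullet> u n\<bar> ^ (2 * p) \<le> cmod (F y) * (norm y * B) ^ (2 * p)"
        by (intro mult_left_mono) auto
      then show "norm (F y * complex_of_real ((y \<bullet> u n) ^ (2 * p))) \<le> cmod (F y) * norm y ^ (2 * p) * B ^ (2 * p)"
        unfolding norm_mult norm_of_real power_abs power_mult_distrib by (simp add: mult.assoc)
    qed
  qed measurable
qed

text \<open>Fubini together with \<open>gaussian_moment\<close>; the constant is the moment of order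
  2p of the standard normal law.\<close>

lemma beta_average:
  shows "integrable lborel (\<lambda>v. complex_of_real (gaussian v) * \<alpha> \<phi> \<rho> p v)"
    and "(\<integral>v. complex_of_real (gaussian v) * \<alpha> \<phi> \<rho> p v \<partial>lborel)
      = complex_of_real (fact (2 * p) / (2 ^ p * fact p)) * \<beta> \<phi> \<rho> p"
proof -
  let ?L = "lborel :: (real, 'd) vec measure"
  define c :: real where "c = fact (2 * p) / (2 ^ p * fact p)"
  define f where "f y v = F y * complex_of_real (gaussian v * (y \<bullet> v) ^ (2 * p))" for y v
  have [measurable]: "(\<lambda>(y, v). f y v) \<in> borel_measurable (?L \<Otimes>\<^sub>M ?L)"
    unfolding f_def by measurable
  have gm: "integrable lborel (\<lambda>v. complex_of_real (gaussian v * (y \<bullet> v) ^ (2 * p)))" for y :: "(real, 'd) vec"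
    using gaussian_moment(1)[of y p] by (rule integrable_of_real)
  have inner: "(\<integral>v. cmod (f y v) \<partial>lborel) = cmod (F y) * (c * norm y ^ (2 * p))" for y
  proof -
    have "(\<integral>v. cmod (f y v) \<partial>lborel) = (\<integral>v. cmod (F y) * (gaussian v * (y \<bullet> v) ^ (2 * p)) \<partial>lborel)"
      by (simp add: f_def norm_mult abs_mult gaussian_pos less_imp_le del: of_real_mult of_real_power)
    also have "\<dots> = cmod (F y) * (c * norm y ^ (2 * p))"
      by (simp add: gaussian_moment(2) c_def)
    finally show ?thesis .
  qed
  have int2: "integrable (?L \<Otimes>\<^sub>M ?L) (\<lambda>(y, v). f y v)"
  proof (rule lborel_pair.Fubini_integrable)
    have "integrable lborel (\<lambda>y. c * (cmod (F y) * norm y ^ (2 * p)))"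
      using mom by (rule integrable_mult_right)
    then show "integrable lborel (\<lambda>x. \<integral>y. norm (case (x, y) of (y, v) \<Rightarrow> f y v) \<partial>lborel)"
      by (simp add: inner mult_ac)
    show "AE x in lborel. integrable lborel (\<lambda>y. case (x, y) of (y, v) \<Rightarrow> f y v)"
      unfolding f_def prod.case by (intro AE_I2 integrable_mult_right gm)
  qed measurable
  have a: "(\<integral>y. f y v \<partial>lborel) = complex_of_real (gaussian v) * \<alpha> \<phi> \<rho> p v" for v
  proof -
    have "(\<integral>y. f y v \<partial>lborel) = (\<integral>y. complex_of_real (gaussian v) * (F y * complex_of_real ((y \<bullet> v) ^ (2 * p))) \<partial>lborel)"
      by (simp add: f_def mult_ac)
    then show ?thesis unfolding alpha_F by simp
  qed
  show "integrable lborel (\<lambda>v. complex_of_real (gaussian v) * \<alpha> \<phi> \<rho> p v)"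
    using lborel_pair.integrable_snd[OF int2] by (simp add: a)
  have "(\<integral>v. complex_of_real (gaussian v) * \<alpha> \<phi> \<rho> p v \<partial>lborel) = (\<integral>y. (\<integral>v. f y v \<partial>lborel) \<partial>lborel)"
    unfolding a[symmetric] by (rule lborel_pair.Fubini_integral[OF int2])
  also have "\<dots> = (\<integral>y. complex_of_real c * (F y * complex_of_real (norm y ^ (2 * p))) \<partial>lborel)"
  proof (intro Bochner_Integration.integral_cong refl)
    fix y
    have "(\<integral>v. f y v \<partial>lborel) = F y * complex_of_real (\<integral>v. gaussian v * (y \<bullet> v) ^ (2 * p) \<partial>lborel)"
      unfolding f_def integral_mult_right_zero by (simp only: integral_complex_of_real)
    then show "(\<integral>v. f y v \<partial>lborel) = complex_of_real c * (F y * complex_of_real (norm y ^ (2 * p)))"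
      by (simp add: gaussian_moment(2) c_def)
  qed
  also have "\<dots> = complex_of_real c * \<beta> \<phi> \<rho> p" unfolding beta_F by (rule integral_mult_right_zero)
  finally show "(\<integral>v. complex_of_real (gaussian v) * \<alpha> \<phi> \<rho> p v \<partial>lborel)
      = complex_of_real (fact (2 * p) / (2 ^ p * fact p)) * \<beta> \<phi> \<rho> p" by (simp only: c_def)
qed

text \<open>The factor \<open>e\<close> stands for the common sign of the moments, which survives
  averaging.\<close>

lemma beta_sign:
  assumes nn: "\<And>v. 0 \<le> e * \<alpha> \<phi> \<rho> p v"
  shows "0 \<le> e * \<beta> \<phi> \<rho> p"
proof -
  define c :: real where "c = fact (2 * p) / (2 ^ p * fact p)"
  have c: "c > 0" by (simp add: c_def)
  have "0 \<le> (\<integral>v. e * (complex_of_real (gaussian v) * \<alpha> \<phi> \<rho> p v) \<partial>lborel)"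
  proof (rule integral_complex_nonneg)
    fix v :: "(real, 'd) vec"
    have "0 \<le> complex_of_real (gaussian v) * (e * \<alpha> \<phi> \<rho> p v)"
      by (rule complex_nonneg_mult[OF _ nn]) (simp add: of_real_nonneg_iff gaussian_pos less_imp_le)
    then show "0 \<le> e * (complex_of_real (gaussian v) * \<alpha> \<phi> \<rho> p v)" by (simp only: mult.left_commute)
  qed
  also have "\<dots> = e * (complex_of_real c * \<beta> \<phi> \<rho> p)"
    unfolding integral_mult_right_zero beta_average(2) c_def ..
  finally have *: "0 \<le> e * (complex_of_real c * \<beta> \<phi> \<rho> p)" .
  have "0 \<le> complex_of_real (1 / c) * (e * (complex_of_real c * \<beta> \<phi> \<rho> p))"
    by (rule complex_nonneg_mult[OF _ *], subst of_real_nonneg_iff) (use c in simp)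
  then show ?thesis using c by simp
qed

text \<open>A Gaussian average of functions of one sign vanishes only if the function is 0 almost
  everywhere, hence everywhere by continuity.\<close>

lemma beta_eq_0_iff:
  assumes nn: "\<And>v. 0 \<le> e * \<alpha> \<phi> \<rho> p v" and e: "e \<noteq> 0"
  shows "\<beta> \<phi> \<rho> p = 0 \<longleftrightarrow> (\<forall>v. \<alpha> \<phi> \<rho> p v = 0)"
proof
  assume "\<forall>v. \<alpha> \<phi> \<rho> p v = 0"
  then show "\<beta> \<phi> \<rho> p = 0" using beta_average(2) by simp
next
  assume b: "\<beta> \<phi> \<rho> p = 0"
  define a where "a v = Re (e * \<alpha> \<phi> \<rho> p v)" for v
  have a: "0 \<le> a v" for v using nn[of v] by (simp add: a_def less_eq_complex_def)
  have eq: "gaussian v * a v = Re (e * (complex_of_real (gaussian v) * \<alpha> \<phi> \<rho> p v))" for v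
    by (simp add: a_def algebra_simps)
  have i: "integrable lborel (\<lambda>v. e * (complex_of_real (gaussian v) * \<alpha> \<phi> \<rho> p v))"
    by (rule integrable_mult_right[OF beta_average(1)])
  have ia: "integrable lborel (\<lambda>v. gaussian v * a v)"
    unfolding eq by (rule integrable_Re[OF i])
  have "(\<integral>v. gaussian v * a v \<partial>lborel) = Re (\<integral>v. e * (complex_of_real (gaussian v) * \<alpha> \<phi> \<rho> p v) \<partial>lborel)"
    unfolding eq by (rule integral_Re[OF i])
  also have "\<dots> = 0" unfolding integral_mult_right_zero beta_average(2) by (simp add: b)
  finally have "AE v in lborel. gaussian v * a v = 0"
    using a ia by (subst (asm) integral_nonneg_eq_0_iff_AE) (auto simp: gaussian_pos less_imp_le)
  then have "AE v in lborel. v \<in> {v. a v = 0}"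
  proof eventually_elim
    case (elim v)
    then show ?case using gaussian_pos[of v] by simp
  qed
  \<comment> \<open>A closed set of full Lebesgue measure is the whole space.\<close>
  then have "AE v in lebesgue. v \<in> {v. a v = 0}" by (rule AE_completion)
  moreover have "closed {v. a v = 0}"
    unfolding a_def by (intro closed_Collect_eq continuous_intros alpha_continuous)
  ultimately have "a v = 0" for v using mem_closed_if_AE_lebesgue[of "{v. a v = 0}" v] by auto
  then have "e * \<alpha> \<phi> \<rho> p v = 0" for v
    using nn[of v] by (auto simp: a_def less_eq_complex_def complex_eq_iff)
  then show "\<forall>v. \<alpha> \<phi> \<rho> p v = 0" using e by simp
qed

end

end

end

section \<open>Derivation of the five assertions from their integrability hypotheses\<close>

lemma sphere_nonzero: "v \<in> sphere 0 1 \<Longrightarrow> v \<noteq> 0" for v :: "'a::real_normed_vector"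
  by auto

context scaled_kernel
begin

lemma assertion1:
  "(\<lambda>t. complex_of_real (h t powr (- real d / 2))) \<in> Phi \<and> (\<lambda>x. \<phi> ((\<rho> x)\<^sup>2)) \<in> Phi"
  using h_powr_Phi F_Phi by (simp add: F_def[abs_def])

lemma assertion2:
  "\<forall>n. 1 \<le> n \<and> n \<le> d \<and>
        set_integrable lborel {0..} (\<lambda>u::real. cmod (\<phi> (u\<^sup>2)) * u ^ (n - 1)) \<longrightarrow>
        (\<forall>m\<in>{1..n}. \<forall>v\<in>coord_subspace m.
           (let f = (\<lambda>s::real. complex_of_real (s powi (int m - int d)) * G \<phi> \<rho> m (s *\<^sub>R v)) in
            antimono_on {0<..} f \<and> (v \<noteq> 0 \<longrightarrow> (f \<longlongrightarrow> 0) at_top)))"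
proof (intro allI impI ballI)
  fix n m :: nat and v :: "(real, 'd) vec"
  assume n: "1 \<le> n \<and> n \<le> d \<and> set_integrable lborel {0..} (\<lambda>u::real. cmod (\<phi> (u\<^sup>2)) * u ^ (n - 1))"
    and m: "m \<in> {1..n}" and v: "v \<in> coord_subspace m"
  have m': "1 \<le> m" "m \<le> CARD('d)" using n m d by auto
  have "radial (m - 1)" by (rule radial_mono[of "n - 1"]) (use n m in \<open>auto simp: radial_def\<close>)
  note int = integrable_F[OF m' this]
  show "let f = (\<lambda>s::real. complex_of_real (s powi (int m - int d)) * G \<phi> \<rho> m (s *\<^sub>R v)) in
            antimono_on {0<..} f \<and> (v \<noteq> 0 \<longrightarrow> (f \<longlongrightarrow> 0) at_top)"
    using scaled_G_antimono[OF m' int, of v] scaled_G_limit_at_top[OF m' int v]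
    unfolding Let_def scaled_G_def[abs_def] by blast
qed

lemma assertion3:
  "set_integrable lborel {0..} (\<lambda>u::real. cmod (\<phi> (u\<^sup>2)) * u ^ (d - 1)) \<longrightarrow>
        G \<phi> \<rho> d 0 > 0 \<and>
        (real_analytic (G \<phi> \<rho> d) \<longrightarrow>
           (\<forall>v. v \<noteq> 0 \<longrightarrow> strict_antimono_on {0..} (\<lambda>s::real. G \<phi> \<rho> d (s *\<^sub>R v))) \<and>
           (\<forall>v. G \<phi> \<rho> d v > 0))"
proof (intro impI conjI allI)
  assume "set_integrable lborel {0..} (\<lambda>u::real. cmod (\<phi> (u\<^sup>2)) * u ^ (d - 1))"
  then have int: "integrable lborel F" by (intro integrable_F_lborel) (simp add: radial_def)
  show G0: "G \<phi> \<rho> d 0 > 0" by (rule G_zero_pos[OF int])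
  fix v :: "(real, 'd) vec"
  assume "real_analytic (G \<phi> \<rho> d)"
  then have lps: "local_power_series (\<lambda>s. Re (G \<phi> \<rho> d (s *\<^sub>R v)))" by (rule real_analytic_line)
  show "strict_antimono_on {0..} (\<lambda>s::real. G \<phi> \<rho> d (s *\<^sub>R v))" if "v \<noteq> 0"
    by (rule monotone_onI) (use G_strict_antimono[OF int lps that] in auto)
  show "G \<phi> \<rho> d v > 0"
  proof (cases "v = 0")
    case False
    \<comment> \<open>Strict decrease from v to 2 v, where the value is still nonnegative, makes the
      value at v positive.\<close>
    have "G \<phi> \<rho> d (2 *\<^sub>R v) < G \<phi> \<rho> d (1 *\<^sub>R v)" by (rule G_strict_antimono[OF int lps False]) auto
    with G_d_nonneg[OF int, of "2 *\<^sub>R v"] show ?thesis by (simp add: less_le_trans)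
  qed (use G0 in simp)
qed

lemma assertion4:
  "set_integrable lborel {0..} (\<lambda>u::real. cmod (\<phi> (u\<^sup>2)) * u ^ (d + 1)) \<longrightarrow>
        (\<forall>v\<in>sphere 0 1. \<alpha> \<phi> \<rho> 1 v \<ge> 0) \<and>
        \<beta> \<phi> \<rho> 1 \<ge> 0 \<and>
        ((\<forall>v\<in>sphere 0 1. \<alpha> \<phi> \<rho> 1 v = 0) \<longleftrightarrow> \<beta> \<phi> \<rho> 1 = 0) \<and>
        (\<beta> \<phi> \<rho> 1 > 0 \<longrightarrow>
           (\<forall>l>0. (\<lambda>t. complex_of_real (exp (- l * h t))) \<in> Phi))"
proof
  assume *: "set_integrable lborel {0..} (\<lambda>u::real. cmod (\<phi> (u\<^sup>2)) * u ^ (d + 1))"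
  have "2 * 1 + (d - 1) = d + 1" using d_pos by simp
  with * have r: "radial (2 * 1 + (d - 1))" by (simp add: radial_def)
  have int: "integrable lborel F"
    by (rule integrable_F_lborel[OF radial_mono[OF r]]) simp
  note mom = integrable_F_moment[OF r]
  have a: "0 \<le> \<alpha> \<phi> \<rho> 1 v" for v
    using alpha_sign[OF int order_refl mom, of v] by simp
  then have a1: "0 \<le> 1 * \<alpha> \<phi> \<rho> 1 v" for v by simp
  have b: "0 \<le> \<beta> \<phi> \<rho> 1" using beta_sign[OF int order_refl mom a1] by simp
  have ab: "\<beta> \<phi> \<rho> 1 = 0 \<longleftrightarrow> (\<forall>v. \<alpha> \<phi> \<rho> 1 v = 0)"
    by (rule beta_eq_0_iff[OF int order_refl mom a1]) simp
  have e: "(\<lambda>t. complex_of_real (exp (- l * h t))) \<in> Phi" if "\<beta> \<phi> \<rho> 1 > 0" "l > 0" for l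
  proof -
    obtain v where "\<alpha> \<phi> \<rho> 1 v \<noteq> 0" using ab \<open>\<beta> \<phi> \<rho> 1 > 0\<close> by auto
    then show ?thesis using exp_h_power_Phi[OF int order_refl mom _ _ \<open>l > 0\<close>, of v] by simp
  qed
  have z: "(\<forall>v\<in>sphere 0 1. \<alpha> \<phi> \<rho> 1 v = 0) \<longleftrightarrow> \<beta> \<phi> \<rho> 1 = 0"
    unfolding ab using alpha_eq_0_sphere[OF int order_refl] by blast
  show "(\<forall>v\<in>sphere 0 1. \<alpha> \<phi> \<rho> 1 v \<ge> 0) \<and> \<beta> \<phi> \<rho> 1 \<ge> 0 \<and>
        ((\<forall>v\<in>sphere 0 1. \<alpha> \<phi> \<rho> 1 v = 0) \<longleftrightarrow> \<beta> \<phi> \<rho> 1 = 0) \<and>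
        (\<beta> \<phi> \<rho> 1 > 0 \<longrightarrow> (\<forall>l>0. (\<lambda>t. complex_of_real (exp (- l * h t))) \<in> Phi))"
    by (rule conjI[OF ballI[OF a] conjI[OF b conjI[OF z]]]) (intro impI allI e)
qed

lemma assertion5_support:
  "(\<exists>R. \<forall>u\<ge>R. \<phi> u = 0) \<longrightarrow>
     (\<exists>\<epsilon>>0. set_integrable lborel {0..} (\<lambda>u::real. cmod (\<phi> (u\<^sup>2)) * exp (\<epsilon> * u)))"
proof (intro impI, elim exE)
  fix R assume "\<forall>u\<ge>R. \<phi> u = 0"
  then have "set_integrable lborel {0..} (\<lambda>u::real. cmod (\<phi> (u\<^sup>2)) * exp (1 * u))"
    by (intro set_integrable_exp_compact_support[of R]) simp
  then show "\<exists>\<epsilon>>0. set_integrable lborel {0..} (\<lambda>u::real. cmod (\<phi> (u\<^sup>2)) * exp (\<epsilon> * u))"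
    by (intro exI[of _ 1] conjI) auto
qed

subsection \<open>Exponential decay\<close>

context
  fixes \<epsilon> :: real
  assumes eps: "\<epsilon> > 0" and exp_int: "set_integrable lborel {0..} (\<lambda>u::real. cmod (\<phi> (u\<^sup>2)) * exp (\<epsilon> * u))"
begin

lemma int_exp: "integrable lborel F"
  by (rule integrable_F_lborel[OF radial_exp[OF eps exp_int]])

lemma mom_exp: "integrable lborel (\<lambda>y. cmod (F y) * norm y ^ (2 * p))"
  by (rule integrable_F_moment[OF radial_exp[OF eps exp_int]])

text \<open>At 0 the even Taylor coefficients are multiples of the \<alpha>_k, and the odd ones
  vanish because \<open>F\<close> is even.\<close>

lemma fourier_moment_eq_0:
  assumes zero: "\<And>k. 1 \<le> k \<Longrightarrow> \<alpha> \<phi> \<rho> k v = 0" and "1 \<le> n"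
  shows "fourier_moment F v 0 n = 0"
proof (cases "even n")
  case True
  then obtain k where k: "n = 2 * k" by blast
  have "fourier_moment F v 0 n = (\<integral>y. (-1) ^ k * (F y * complex_of_real ((y \<bullet> v) ^ (2 * k))) \<partial>lborel)"
  proof -
    have pw: "(\<i> * x) ^ (2 * k) = (-1) ^ k * x ^ (2 * k)" for x
      by (simp only: power_mult power_mult_distrib power2_i)
    show ?thesis unfolding fourier_moment_def k pw by (simp add: mult.left_commute)
  qed
  also have "\<dots> = (-1) ^ k * \<alpha> \<phi> \<rho> k v"
    unfolding alpha_F[OF int_exp] by (rule integral_mult_right_zero)
  finally show ?thesis using zero[of k] assms(2) k by simp
next
  case False
  let ?f = "\<lambda>y. F y * (\<i> * complex_of_real (y \<bullet> v)) ^ n"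
  have "(\<integral>y. ?f (- y) \<partial>lborel) = (\<integral>y. ?f y \<partial>lborel)"
    by (rule integral_lborel_uminus) measurable
  moreover have "?f (- y) = - ?f y" for y
    using False by (simp add: F_minus power_minus_odd)
  ultimately have "- (\<integral>y. ?f y \<partial>lborel) = (\<integral>y. ?f y \<partial>lborel)" by simp
  then show ?thesis by (simp add: fourier_moment_def)
qed

text \<open>If every moment vanished, the power series of s \<mapsto> G(s v) at 0 would reduce to
  its constant term, making it constant on (0, \<delta>).\<close>

lemma ex_alpha_nonzero:
  assumes "v \<noteq> 0"
  shows "\<exists>k\<ge>1. \<alpha> \<phi> \<rho> k v \<noteq> 0"
proof (rule ccontr)
  assume "\<not> ?thesis"
  then have zero: "\<alpha> \<phi> \<rho> k v = 0" if "1 \<le> k" for k using that by blast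
  obtain \<delta> where \<delta>: "\<delta> > 0" and di: "integrable lborel (\<lambda>y. cmod (F y) * exp (\<delta> * \<bar>y \<bullet> v\<bar>))"
    using integrable_F_exp_moment[OF eps exp_int] by blast
  have Gs: "G \<phi> \<rho> d (s *\<^sub>R v) = (\<integral>y. F y * exp (\<i> * complex_of_real (s * (y \<bullet> v))) \<partial>lborel)" for s
    by (simp add: G_lborel[OF int_exp])
  have lps: "local_power_series (\<lambda>s. Re (G \<phi> \<rho> d (s *\<^sub>R v)))"
    unfolding Gs by (rule fourier_local_power_series[OF F_measurable \<delta> di])
  have "G \<phi> \<rho> d (s *\<^sub>R v) = fourier_moment F v 0 0" if "0 < s" "s < \<delta>" for s
  proof -
    have "(\<lambda>n. fourier_moment F v 0 n / fact n * complex_of_real ((s - 0) ^ n)) sums G \<phi> \<rho> d (s *\<^sub>R v)"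
      unfolding Gs by (rule fourier_power_series[OF F_measurable di]) (use that in simp)
    also have "(\<lambda>n. fourier_moment F v 0 n / fact n * complex_of_real ((s - 0) ^ n))
       = (\<lambda>n. if n = 0 then fourier_moment F v 0 0 else 0)"
      using fourier_moment_eq_0[OF zero] by (auto simp: fun_eq_iff)
    finally show ?thesis
      using sums_single[of 0 "\<lambda>_. fourier_moment F v 0 0"] by (rule sums_unique2)
  qed
  then have "Re (G \<phi> \<rho> d (s *\<^sub>R v)) = Re (fourier_moment F v 0 0)" if "0 < s" "s < \<delta>" for s
    using that by simp
  then show False by (rule G_not_locally_const[OF int_exp lps assms \<delta>])
qed

lemma p_min:
  assumes "v \<noteq> 0"
  shows "1 \<le> p_min \<phi> \<rho> v" "\<alpha> \<phi> \<rho> (p_min \<phi> \<rho> v) v \<noteq> 0"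
    and "\<And>k. 1 \<le> k \<Longrightarrow> k < p_min \<phi> \<rho> v \<Longrightarrow> \<alpha> \<phi> \<rho> k v = 0"
proof -
  have "\<exists>k. 1 \<le> k \<and> \<alpha> \<phi> \<rho> k v \<noteq> 0" using ex_alpha_nonzero[OF assms] by blast
  from LeastI_ex[OF this]
  show "1 \<le> p_min \<phi> \<rho> v" "\<alpha> \<phi> \<rho> (p_min \<phi> \<rho> v) v \<noteq> 0" by (simp_all add: p_min_def)
  show "\<alpha> \<phi> \<rho> k v = 0" if "1 \<le> k" "k < p_min \<phi> \<rho> v" for k
    using not_less_Least[of k "\<lambda>k. 1 \<le> k \<and> \<alpha> \<phi> \<rho> k v \<noteq> 0"] that by (auto simp: p_min_def)
qed

lemma exp_p_min_Phi:
  assumes "v \<noteq> 0" "l > 0"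
  shows "(\<lambda>t. complex_of_real (exp (- l * h t ^ p_min \<phi> \<rho> v))) \<in> Phi"
  using p_min[OF assms(1)] by (intro exp_h_power_Phi[OF int_exp _ mom_exp _ _ assms(2), of _ v])

text \<open>Near v the moment of order p(v) stays nonzero by continuity, so p(w) \<le> p(v) there;
  finitely many such neighbourhoods cover the compact sphere.\<close>

lemma bdd_above_p_min: "bdd_above (p_min \<phi> \<rho> ` sphere 0 1)"
proof -
  let ?S = "sphere 0 1 :: (real, 'd) vec set"
  define U where "U v = {w. \<alpha> \<phi> \<rho> (p_min \<phi> \<rho> v) w \<noteq> 0}" for v
  have "open (U v)" if "v \<in> ?S" for v
    unfolding U_def
    using p_min(1)[OF sphere_nonzero[OF that]] by (intro open_Collect_neq alpha_continuous[OF int_exp _ mom_exp] continuous_intros) auto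
  moreover have "v \<in> U v" if "v \<in> ?S" for v
    using p_min(2)[OF sphere_nonzero[OF that]] by (simp add: U_def)
  ultimately obtain T where T: "T \<subseteq> ?S" "finite T" "?S \<subseteq> (\<Union>v\<in>T. U v)"
    by (elim compactE_image[OF compact_sphere]) auto
  show ?thesis
  proof (rule bdd_aboveI2)
    fix w assume w: "w \<in> ?S"
    then obtain v where v: "v \<in> T" "w \<in> U v" using T by blast
    then have "p_min \<phi> \<rho> w \<le> p_min \<phi> \<rho> v"
      unfolding p_min_def[of \<phi> \<rho> w] using p_min(1)[OF sphere_nonzero, of v] T(1) by (intro Least_le) (auto simp: U_def)
    also have "\<dots> \<le> Max (p_min \<phi> \<rho> ` T)" using v T by (intro Max_ge) auto
    finally show "p_min \<phi> \<rho> w \<le> Max (p_min \<phi> \<rho> ` T)" .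
  qed
qed

text \<open>If \<open>\<alpha>\<^sub>k\<close> vanishes identically for \<open>k < p\<close>, then all \<open>\<alpha>\<^sub>p v\<close> have the sign \<open>(-1) ^ (p + 1)\<close>,
  so no cancellation occurs in the Gaussian average \<open>\<beta>\<^sub>p\<close>.\<close>

lemma q_min:
  shows "1 \<le> q_min \<phi> \<rho>" "\<beta> \<phi> \<rho> (q_min \<phi> \<rho>) \<noteq> 0" "q_min \<phi> \<rho> = Min (p_min \<phi> \<rho> ` sphere 0 1)"
proof -
  let ?S = "sphere 0 1 :: (real, 'd) vec set"
  define q where "q = Min (p_min \<phi> \<rho> ` ?S)"
  have "axis undefined 1 \<in> ?S" by simp
  then have ne: "?S \<noteq> {}" by blast
  have fin: "finite (p_min \<phi> \<rho> ` ?S)"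
    using bdd_above_p_min by (simp add: bdd_above_nat)
  have "q \<in> p_min \<phi> \<rho> ` ?S" unfolding q_def using fin ne by (intro Min_in) auto
  then obtain v0 where v0: "v0 \<in> ?S" "q = p_min \<phi> \<rho> v0" by blast
  have v0': "v0 \<noteq> 0" using v0(1) by (rule sphere_nonzero)
  have q1: "1 \<le> q" using p_min(1)[OF v0'] v0(2) by simp
  have zero: "\<alpha> \<phi> \<rho> k v = 0" if "1 \<le> k" "k < q" for k v
  proof (rule alpha_eq_0_sphere[OF int_exp that(1)])
    fix w assume w: "w \<in> ?S"
    have "q \<le> p_min \<phi> \<rho> w" unfolding q_def using fin w by (intro Min_le) auto
    then show "\<alpha> \<phi> \<rho> k w = 0" using p_min(3)[OF sphere_nonzero[OF w], of k] that by simp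
  qed
  \<comment> \<open>For k < q the moments are 0. At k = q all lower moments vanish for every v at
    once, so \<open>alpha_sign\<close> gives a sign independent of v.\<close>
  have sgn: "0 \<le> - ((-1) ^ k) * \<alpha> \<phi> \<rho> k v" if "1 \<le> k" "k \<le> q" for k v
    using alpha_sign[OF int_exp that(1) mom_exp, of v] zero that by simp
  have b: "\<beta> \<phi> \<rho> k = 0 \<longleftrightarrow> (\<forall>v. \<alpha> \<phi> \<rho> k v = 0)" if "1 \<le> k" "k \<le> q" for k
    by (rule beta_eq_0_iff[OF int_exp that(1) mom_exp sgn[OF that]]) simp
  have bq: "\<beta> \<phi> \<rho> q \<noteq> 0" using b[OF q1] p_min(2)[OF v0'] v0(2) by auto
  have "q_min \<phi> \<rho> = q"
    unfolding q_min_def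
  proof (rule Least_equality)
    fix k assume k: "1 \<le> k \<and> \<beta> \<phi> \<rho> k \<noteq> 0"
    show "q \<le> k"
    proof (rule ccontr)
      assume "\<not> q \<le> k"
      with b[of k] zero[of k] k show False by auto
    qed
  qed (use q1 bq in simp)
  then show "1 \<le> q_min \<phi> \<rho>" "\<beta> \<phi> \<rho> (q_min \<phi> \<rho>) \<noteq> 0" "q_min \<phi> \<rho> = Min (p_min \<phi> \<rho> ` ?S)"
    using q1 bq by (simp_all add: q_def)
qed

text \<open>The minimum of p over the sphere is attained, so this is the case of a suitable
  v.\<close>

lemma exp_q_min_Phi:
  assumes "l > 0"
  shows "(\<lambda>t. complex_of_real (exp (- l * h t ^ q_min \<phi> \<rho>))) \<in> Phi"
proof -
  let ?S = "sphere 0 1 :: (real, 'd) vec set"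
  have "axis undefined 1 \<in> ?S" by simp
  then have ne: "?S \<noteq> {}" by blast
  have "q_min \<phi> \<rho> \<in> p_min \<phi> \<rho> ` ?S"
    unfolding q_min(3) using bdd_above_p_min ne by (intro Min_in) (auto simp: bdd_above_nat)
  then obtain v where "v \<in> ?S" "q_min \<phi> \<rho> = p_min \<phi> \<rho> v" by blast
  then show ?thesis using exp_p_min_Phi[OF sphere_nonzero assms, of v] by simp
qed

end

lemma assertion5:
  "(\<exists>\<epsilon>>0. set_integrable lborel {0..} (\<lambda>u::real. cmod (\<phi> (u\<^sup>2)) * exp (\<epsilon> * u))) \<longrightarrow>
        (\<exists>p\<ge>1. \<forall>l>0. (\<lambda>t. complex_of_real (exp (- l * h t ^ p))) \<in> Phi) \<and>
        (\<forall>v\<in>sphere 0 1.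
           (\<exists>k\<ge>1. \<alpha> \<phi> \<rho> k v \<noteq> 0) \<and>
           (\<forall>l>0. (\<lambda>t. complex_of_real (exp (- l * h t ^ p_min \<phi> \<rho> v))) \<in> Phi)) \<and>
        (\<exists>k\<ge>1. \<beta> \<phi> \<rho> k \<noteq> 0) \<and>
        (\<forall>l>0. (\<lambda>t. complex_of_real (exp (- l * h t ^ q_min \<phi> \<rho>))) \<in> Phi) \<and>
        bdd_above (p_min \<phi> \<rho> ` sphere 0 1) \<and>
        q_min \<phi> \<rho> = Min (p_min \<phi> \<rho> ` sphere 0 1)"
proof (intro impI, elim exE conjE)
  fix \<epsilon> :: real
  assume eps: "\<epsilon> > 0" "set_integrable lborel {0..} (\<lambda>u::real. cmod (\<phi> (u\<^sup>2)) * exp (\<epsilon> * u))"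
  have v: "\<forall>v\<in>sphere 0 1. (\<exists>k\<ge>1. \<alpha> \<phi> \<rho> k v \<noteq> 0) \<and>
           (\<forall>l>0. (\<lambda>t. complex_of_real (exp (- l * h t ^ p_min \<phi> \<rho> v))) \<in> Phi)"
    using ex_alpha_nonzero[OF eps sphere_nonzero] exp_p_min_Phi[OF eps sphere_nonzero] by simp
  have q: "\<forall>l>0. (\<lambda>t. complex_of_real (exp (- l * h t ^ q_min \<phi> \<rho>))) \<in> Phi"
    using exp_q_min_Phi[OF eps] by blast
  show "(\<exists>p\<ge>1. \<forall>l>0. (\<lambda>t. complex_of_real (exp (- l * h t ^ p))) \<in> Phi) \<and>
        (\<forall>v\<in>sphere 0 1.
           (\<exists>k\<ge>1. \<alpha> \<phi> \<rho> k v \<noteq> 0) \<and>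
           (\<forall>l>0. (\<lambda>t. complex_of_real (exp (- l * h t ^ p_min \<phi> \<rho> v))) \<in> Phi)) \<and>
        (\<exists>k\<ge>1. \<beta> \<phi> \<rho> k \<noteq> 0) \<and>
        (\<forall>l>0. (\<lambda>t. complex_of_real (exp (- l * h t ^ q_min \<phi> \<rho>))) \<in> Phi) \<and>
        bdd_above (p_min \<phi> \<rho> ` sphere 0 1) \<and>
        q_min \<phi> \<rho> = Min (p_min \<phi> \<rho> ` sphere 0 1)"
  proof (intro conjI)
    show "\<exists>p\<ge>1. \<forall>l>0. (\<lambda>t. complex_of_real (exp (- l * h t ^ p))) \<in> Phi"
      using q q_min(1)[OF eps] by blast
    show "\<exists>k\<ge>1. \<beta> \<phi> \<rho> k \<noteq> 0" using q_min(1,2)[OF eps] by blast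
  qed (rule v q bdd_above_p_min[OF eps] q_min(3)[OF eps])+
qed

end

theorem theorem4:
  fixes h :: "'e::real_vector \<Rightarrow> real"
    and \<phi> :: "real \<Rightarrow> complex"
    and \<rho> :: "real ^ 'd::{finite,linorder} \<Rightarrow> real"
    and d :: nat
  assumes d: "d = CARD('d)"
    and h_cont: "h \<in> C_space"
    and h_pos: "\<And>t. h t > 0"
    and h_nonconst: "\<not> (\<forall>t. h t = h 0)"
    and phi_cont: "continuous_on {0..} \<phi>"
    and phi_pos: "\<phi> 0 > 0"
    and rho_cont: "continuous_on UNIV \<rho>"
    and rho_hom: "\<And>t x. \<rho> (t *\<^sub>R x) = \<bar>t\<bar> * \<rho> x"
    and rho_pos: "\<And>x. x \<noteq> 0 \<Longrightarrow> \<rho> x > 0"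
    and K: "(\<lambda>(x, t).
               complex_of_real (h t powr (- real d / 2)) * \<phi> ((\<rho> x)\<^sup>2 / h t)) \<in> Phi"
  shows
    "((\<lambda>t. complex_of_real (h t powr (- real d / 2))) \<in> Phi \<and>
      (\<lambda>x. \<phi> ((\<rho> x)\<^sup>2)) \<in> Phi)
   \<and>
     (\<forall>n. 1 \<le> n \<and> n \<le> d \<and>
        set_integrable lborel {0..} (\<lambda>u::real. cmod (\<phi> (u\<^sup>2)) * u ^ (n - 1)) \<longrightarrow>
        (\<forall>m\<in>{1..n}. \<forall>v\<in>coord_subspace m.
           (let f = (\<lambda>s::real. complex_of_real (s powi (int m - int d)) * G \<phi> \<rho> m (s *\<^sub>R v)) in
            antimono_on {0<..} f \<and> (v \<noteq> 0 \<longrightarrow> (f \<longlongrightarrow> 0) at_top))))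
   \<and>
     (set_integrable lborel {0..} (\<lambda>u::real. cmod (\<phi> (u\<^sup>2)) * u ^ (d - 1)) \<longrightarrow>
        G \<phi> \<rho> d 0 > 0 \<and>
        (real_analytic (G \<phi> \<rho> d) \<longrightarrow>
           (\<forall>v. v \<noteq> 0 \<longrightarrow> strict_antimono_on {0..} (\<lambda>s::real. G \<phi> \<rho> d (s *\<^sub>R v))) \<and>
           (\<forall>v. G \<phi> \<rho> d v > 0)))
   \<and>
     (set_integrable lborel {0..} (\<lambda>u::real. cmod (\<phi> (u\<^sup>2)) * u ^ (d + 1)) \<longrightarrow>
        (\<forall>v\<in>sphere 0 1. \<alpha> \<phi> \<rho> 1 v \<ge> 0) \<and>
        \<beta> \<phi> \<rho> 1 \<ge> 0 \<and>
        ((\<forall>v\<in>sphere 0 1. \<alpha> \<phi> \<rho> 1 v = 0) \<longleftrightarrow> \<beta> \<phi> \<rho> 1 = 0) \<and>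
        (\<beta> \<phi> \<rho> 1 > 0 \<longrightarrow>
           (\<forall>l>0. (\<lambda>t. complex_of_real (exp (- l * h t))) \<in> Phi)))
   \<and>
     ((\<exists>R. \<forall>u\<ge>R. \<phi> u = 0) \<longrightarrow>
        (\<exists>\<epsilon>>0. set_integrable lborel {0..} (\<lambda>u::real. cmod (\<phi> (u\<^sup>2)) * exp (\<epsilon> * u))))
   \<and>
     ((\<exists>\<epsilon>>0. set_integrable lborel {0..} (\<lambda>u::real. cmod (\<phi> (u\<^sup>2)) * exp (\<epsilon> * u))) \<longrightarrow>
        (\<exists>p\<ge>1. \<forall>l>0. (\<lambda>t. complex_of_real (exp (- l * h t ^ p))) \<in> Phi) \<and>
        (\<forall>v\<in>sphere 0 1.
           (\<exists>k\<ge>1. \<alpha> \<phi> \<rho> k v \<noteq> 0) \<and>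
           (\<forall>l>0. (\<lambda>t. complex_of_real (exp (- l * h t ^ p_min \<phi> \<rho> v))) \<in> Phi)) \<and>
        (\<exists>k\<ge>1. \<beta> \<phi> \<rho> k \<noteq> 0) \<and>
        (\<forall>l>0. (\<lambda>t. complex_of_real (exp (- l * h t ^ q_min \<phi> \<rho>))) \<in> Phi) \<and>
        bdd_above (p_min \<phi> \<rho> ` sphere 0 1) \<and>
        q_min \<phi> \<rho> = Min (p_min \<phi> \<rho> ` sphere 0 1))"
proof -
  interpret scaled_kernel \<rho> h \<phi> d
    by (unfold_locales; fact)
  show ?thesis
    by (intro conjI assertion1[THEN conjunct1] assertion1[THEN conjunct2] assertion2 assertion3 assertion4
        assertion5_support assertion5)
qed

end
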